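(* Let $n\ge1$, $s\in(0,1)$, and let $\Omega\subset\mathbb{R}^n$ be a bounded open set with $C^2$ boundary. Let $A\subset\Omega$ be an open set such that either $A=\Omega$ or $A\subset\subset\Omega$ with $C^2$ boundary. Let $\psi\in L^\infty(A)$ and let $\varphi:\mathbb{R}^n\to\mathbb{R}$ be such that $\varphi\in L^\infty_{loc}(\mathbb{R}^n)$. Let $u\in\mathcal{W}^s_{\varphi,\psi}(\Omega,A)$ be the unique solution of the obstacle problem in $\Omega$ with exterior data $\varphi$ and obstacle $\psi$ in $A$. Then $\mathcal{S}g(u)$ is the unique solution of the geometric obstacle problem.
   Context: Obstacle problem. Set $g_s(t)=(1+t^2)^{-\frac{n+1+s}{2}}$, $G_s(t)=\int_0^t g_s(\tau)\,d\tau$, $\mathcal{G}_s(t)=\int_0^tG_s(\tau)\,d\tau$, and $Q(\Omega)=\mathbb{R}^{2n}\setminus(\mathbb{R}^n\setminus\Omega)^2$. Functions are measurable and identified when equal a.e. $\mathcal{W}^s(\Omega)$ is the set of $u:\mathbb{R}^n\to\mathbb{R}$ with $u|_\Omega\in W^{s,1}(\Omega)$, i.e. $\|u\|_{L^1(\Omega)}+\int_\Omega\int_\Omega\frac{|u(x)-u(y)|}{|x-y|^{n+s}}\,dx\,dy<\infty$. For $A\subset\Omega$ open and $\psi\in L^\infty(A)$, $$\mathcal{W}^s_{\varphi,\psi}(\Omega,A):=\{u\in\mathcal{W}^s(\Omega):u=\varphi\text{ on }\mathbb{R}^n\setminus\Omega,\ u\ge\psi\text{ a.e. in }A\}.$$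 A function $u$ solves the obstacle problem (in $\Omega$, with exterior data $\varphi$ and obstacle $\psi$ in $A$) if $u\in\mathcal{W}^s_{\varphi,\psi}(\Omega,A)$ and for every $v\in\mathcal{W}^s_{\varphi,\psi}(\Omega,A)$ $$\iint_{Q(\Omega)}\left\{\mathcal{G}_s\Big(\tfrac{u(x)-u(y)}{|x-y|}\Big)-\mathcal{G}_s\Big(\tfrac{v(x)-v(y)}{|x-y|}\Big)\right\}\frac{dx\,dy}{|x-y|^{n-1+s}}\le0.$$ Under the stated hypotheses such a solution exists, is unique, and is bounded in $\Omega$. Geometric obstacle problem. For a function $u:\mathcal{A}\to\mathbb{R}$, $\mathcal{A}\subset\mathbb{R}^n$, let $\mathcal{S}g(u,\mathcal{A})=\{(x,x_{n+1})\in\mathcal{A}\times\mathbb{R}:x_{n+1}<u(x)\}$ and $\mathcal{S}g(u)=\mathcal{S}g(u,\mathbb{R}^n)$ when $\mathcal A=\mathbb{R}^n$. Let $\Omega^\infty=\Omega\times\mathbb{R}$, $\Omega^M=\Omega\times(-M,M)$. For a bounded open set $\mathcal{O}\subset\mathbb{R}^{n+1}$ with Lipschitz boundary and measurable $E\subset\mathbb{R}^{n+1}$, $$\mathrm{Per}_s(E,\mathcal{O})=\iint_{\mathbb{R}^{2(n+1)}\setminus(\mathbb{R}^{n+1}\setminus\mathcal{O})^2}\frac{|\chi_E(X)-\chi_E(Y)|}{|X-Y|^{n+1+s}}\,dX\,dY.$$ A set $E\subset\mathbb{R}^{n+1}$ with $E\setminus\Omega^\infty=\mathcal{S}g(\varphi)\setminus\Omega^\infty$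 and $\mathcal{S}g(\psi,A)\subset E$ solves the geometric obstacle problem if for every $M\ge\|\psi\|_{L^\infty(A)}$ one has $\mathrm{Per}_s(E,\Omega^M)<\infty$ and $\mathrm{Per}_s(E,\Omega^M)\le\mathrm{Per}_s(F,\Omega^M)$ for every $F\subset\mathbb{R}^{n+1}$ with $F\setminus\Omega^M=E\setminus\Omega^M$ and $\mathcal{S}g(\psi,A)\subset F$. Sets are measurable, and all set relations (including uniqueness) are understood up to sets of Lebesgue measure zero. *)

theory Defs
  imports "HOL-Analysis.Analysis" "HOL-Probability.Essential_Supremum"
begin

(* Conventions: R^n is real^'n, so n = CARD('n) >= 1; R^(n+1) is (real^'n) \<times> real and R^(2n) is
   (real^'n) \<times> (real^'n), whose product norms and Lebesgue measures are the Euclidean ones.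
   "Measurable" means Lebesgue measurable. *)

definition C2_function :: "('a::euclidean_space \<Rightarrow> real) \<Rightarrow> bool" where
  "C2_function f \<longleftrightarrow>
     (\<exists>(f' :: 'a \<Rightarrow> 'a \<Rightarrow>\<^sub>L real) (f'' :: 'a \<Rightarrow> 'a \<Rightarrow>\<^sub>L ('a \<Rightarrow>\<^sub>L real)).
        (\<forall>x. (f has_derivative blinfun_apply (f' x)) (at x)) \<and>
        (\<forall>x. (f' has_derivative blinfun_apply (f'' x)) (at x)) \<and>
        continuous_on UNIV f'')"

(* Near each boundary point, S is the strict epigraph of a C^2 function of n-1 variables in some
   orthonormal frame. The frame enters only through its last vector \<nu>; the n-1 remaining coordinates
   of x are represented by the orthogonal projection of x onto the hyperplane normal to \<nu>. *)
definition C2_boundary :: "'a::euclidean_space set \<Rightarrow> bool" where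
  "C2_boundary S \<longleftrightarrow>
     (\<forall>p\<in>frontier S. \<exists>\<nu> r \<gamma>. norm \<nu> = 1 \<and> r > 0 \<and> C2_function \<gamma> \<and>
        S \<inter> ball p r = {x \<in> ball p r. x \<bullet> \<nu> > \<gamma> (x - (x \<bullet> \<nu>) *\<^sub>R \<nu>)})"

definition compactly_contained :: "'a::euclidean_space set \<Rightarrow> 'a set \<Rightarrow> bool" where
  "compactly_contained A S \<longleftrightarrow> compact (closure A) \<and> closure A \<subseteq> S"

(* The maximum with 0 matters only for null sets A, where esssup is -\<infinity>. *)
definition Linf_norm :: "'a::euclidean_space set \<Rightarrow> ('a \<Rightarrow> real) \<Rightarrow> ereal" where
  "Linf_norm A f = max 0 (esssup (lebesgue_on A) (\<lambda>x. ereal \<bar>f x\<bar>))"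

definition Linf :: "'a::euclidean_space set \<Rightarrow> ('a \<Rightarrow> real) \<Rightarrow> bool" where
  "Linf A f \<longleftrightarrow> f \<in> borel_measurable (lebesgue_on A) \<and> Linf_norm A f < \<infinity>"

definition Linf_loc :: "('a::euclidean_space \<Rightarrow> real) \<Rightarrow> bool" where
  "Linf_loc f \<longleftrightarrow> (\<forall>K. compact K \<longrightarrow> Linf K f)"

definition gs :: "nat \<Rightarrow> real \<Rightarrow> real \<Rightarrow> real" where
  "gs n s t = (1 + t\<^sup>2) powr (- ((real n + 1 + s) / 2))"

definition Gs :: "nat \<Rightarrow> real \<Rightarrow> real \<Rightarrow> real" where
  "Gs n s t = (LBINT \<tau>=0..t. gs n s \<tau>)"

definition GGs :: "nat \<Rightarrow> real \<Rightarrow> real \<Rightarrow> real" where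
  "GGs n s t = (LBINT \<tau>=0..t. Gs n s \<tau>)"

definition Qset :: "'a set \<Rightarrow> ('a \<times> 'a) set" where
  "Qset S = UNIV - (UNIV - S) \<times> (UNIV - S)"

definition Ws :: "real \<Rightarrow> (real^'n) set \<Rightarrow> (real^'n \<Rightarrow> real) set" where
  "Ws s \<Omega> = {u. u \<in> borel_measurable lebesgue \<and>
     (\<integral>\<^sup>+x\<in>\<Omega>. ennreal \<bar>u x\<bar> \<partial>lebesgue) +
     (\<integral>\<^sup>+z\<in>\<Omega> \<times> \<Omega>. ennreal (\<bar>u (fst z) - u (snd z)\<bar> /
         norm (fst z - snd z) powr (real CARD('n) + s)) \<partial>lebesgue) < \<infinity>}"

definition Ws_obstacle ::
  "real \<Rightarrow> (real^'n) set \<Rightarrow> (real^'n) set \<Rightarrow> (real^'n \<Rightarrow> real) \<Rightarrow> (real^'n \<Rightarrow> real) \<Rightarrow> (real^'n \<Rightarrow> real) set"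
  where
  "Ws_obstacle s \<Omega> A \<phi> \<psi> = {u \<in> Ws s \<Omega>.
     (AE x in lebesgue. x \<notin> \<Omega> \<longrightarrow> u x = \<phi> x) \<and> (AE x in lebesgue. x \<in> A \<longrightarrow> u x \<ge> \<psi> x)}"

definition energy_diff ::
  "real \<Rightarrow> (real^'n \<Rightarrow> real) \<Rightarrow> (real^'n \<Rightarrow> real) \<Rightarrow> (real^'n) \<times> (real^'n) \<Rightarrow> real" where
  "energy_diff s u v = (\<lambda>(x, y).
     (GGs CARD('n) s ((u x - u y) / norm (x - y)) - GGs CARD('n) s ((v x - v y) / norm (x - y)))
       / norm (x - y) powr (real CARD('n) - 1 + s))"

(* Integrability is stated because the Bochner integral of a non-integrable function is 0 by
   convention. The two energies may separately be infinite, but their difference is absolutely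
   integrable for all u, v in Ws_obstacle when \<Omega> is bounded with C^2 boundary: GGs is Lipschitz,
   and the fractional Hardy inequality bounds the interaction of \<Omega> with its complement. *)
definition solves_obstacle_problem ::
  "real \<Rightarrow> (real^'n) set \<Rightarrow> (real^'n) set \<Rightarrow> (real^'n \<Rightarrow> real) \<Rightarrow> (real^'n \<Rightarrow> real) \<Rightarrow> (real^'n \<Rightarrow> real) \<Rightarrow> bool"
  where
  "solves_obstacle_problem s \<Omega> A \<phi> \<psi> u \<longleftrightarrow>
     u \<in> Ws_obstacle s \<Omega> A \<phi> \<psi> \<and>
     (\<forall>v \<in> Ws_obstacle s \<Omega> A \<phi> \<psi>.
        set_integrable lebesgue (Qset \<Omega>) (energy_diff s u v) \<and>
        (LINT z:Qset \<Omega>|lebesgue. energy_diff s u v z) \<le> 0)"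

definition subgraph :: "('a \<Rightarrow> real) \<Rightarrow> 'a set \<Rightarrow> ('a \<times> real) set" where
  "subgraph u S = {(x, t). x \<in> S \<and> t < u x}"

definition ae_subset :: "'a::euclidean_space set \<Rightarrow> 'a set \<Rightarrow> bool" where
  "ae_subset E F \<longleftrightarrow> (AE z in lebesgue. z \<in> E \<longrightarrow> z \<in> F)"

definition ae_eq :: "'a::euclidean_space set \<Rightarrow> 'a set \<Rightarrow> bool" where
  "ae_eq E F \<longleftrightarrow> (AE z in lebesgue. z \<in> E \<longleftrightarrow> z \<in> F)"

(* X ranges over R^(n+1), so DIM('a) is the n+1 of the kernel exponent n+1+s. *)
definition Per :: "real \<Rightarrow> 'a::euclidean_space set \<Rightarrow> 'a set \<Rightarrow> ennreal" where
  "Per s E U = (\<integral>\<^sup>+Z\<in>Qset U. ennreal (\<bar>indicat_real E (fst Z) - indicat_real E (snd Z)\<bar> /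
       norm (fst Z - snd Z) powr (real DIM('a) + s)) \<partial>lebesgue)"

definition cylinder :: "'a set \<Rightarrow> real \<Rightarrow> ('a \<times> real) set" where
  "cylinder \<Omega> M = \<Omega> \<times> {-M<..<M}"

definition solves_geometric_obstacle_problem ::
  "real \<Rightarrow> (real^'n) set \<Rightarrow> (real^'n) set \<Rightarrow> (real^'n \<Rightarrow> real) \<Rightarrow> (real^'n \<Rightarrow> real) \<Rightarrow> ((real^'n) \<times> real) set \<Rightarrow> bool"
  where
  "solves_geometric_obstacle_problem s \<Omega> A \<phi> \<psi> E \<longleftrightarrow>
     E \<in> sets lebesgue \<and>
     ae_eq (E - \<Omega> \<times> UNIV) (subgraph \<phi> UNIV - \<Omega> \<times> UNIV) \<and>
     ae_subset (subgraph \<psi> A) E \<and>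
     (\<forall>M::real. ereal M \<ge> Linf_norm A \<psi> \<longrightarrow>
        Per s E (cylinder \<Omega> M) < \<infinity> \<and>
        (\<forall>F \<in> sets lebesgue.
           ae_eq (F - cylinder \<Omega> M) (E - cylinder \<Omega> M) \<longrightarrow>
           ae_subset (subgraph \<psi> A) F \<longrightarrow>
           Per s E (cylinder \<Omega> M) \<le> Per s F (cylinder \<Omega> M)))"

end

theory Submission
  imports Defs
begin

text \<open>
  The fiber of a set over a point \<open>x\<close> of the base is a subset of the line. For two base points
  \<open>x\<close> and \<open>y\<close> at distance \<open>r\<close>, the interaction of the fibers is the integral over all
  vertical shifts \<open>\<sigma>\<close> of the kernel \<open>kern\<close> times the length of the symmetric difference of the
  fiber over \<open>x\<close> and the shifted fiber over \<open>y\<close> (\<open>nn_integral_slices\<close>). If the fibers are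
  half-lines that end at \<open>u x\<close> and \<open>u y\<close>, this length is \<open>\<bar>u x - u y - \<sigma>\<bar>\<close>, and the integral
  is twice the density of the functional of the obstacle problem, up to a term that depends on
  \<open>r\<close> only (\<open>nn_integral_pkern_abs\<close>, \<open>interaction_diff_eq\<close>). So on subgraphs the
  differences of the perimeter and of the functional agree, up to a constant factor.

  For general fibers that agree with half-lines far away, let \<open>w x\<close> be the end of the half-line
  with the same signed length as the fiber over \<open>x\<close>. The length of the symmetric difference is
  at least the absolute value of the signed difference \<open>w x - w y - \<sigma>\<close>
  (\<open>disagree_shift_lower\<close>). Thus vertical rearrangement into a subgraph does not raise the energy,
  and it keeps the obstacle condition.

  To keep track of what is lost, \<open>u\<close> is moved only part of the way, to \<open>u + \<theta> (w - u)\<close>. By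
  convexity of the absolute value the perimeter of the competitor exceeds that of the subgraph of
  \<open>u\<close> by at least a multiple \<open>1 / \<theta>\<close> of the energy difference of \<open>u + \<theta> (w - u)\<close> and \<open>u\<close>, which is
  nonnegative because \<open>u\<close> solves the obstacle problem, plus a remainder. For \<open>x\<close> in \<open>\<Omega>\<close> and
  \<open>y\<close> outside, the remainder is at least the length of the part of the fiber of the competitor
  that lies on the wrong side of the level \<open>c = u y + \<sigma>\<close>, as soon as \<open>c\<close> is further from \<open>u x\<close>
  than a distance that shrinks with \<open>\<theta>\<close> (\<open>halfline_gain\<close>, \<open>slice_inequality\<close>). This is
  \<open>perimeter_gain\<close>; it gives minimality at once. The remainder is linear in the discrepancy,
  and this drives uniqueness.

  The perimeter of the subgraph in a cylinder is finite (\<open>Per_subgraph_finite\<close>) because \<open>u\<close> has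
  finite energy in \<open>\<Omega> \<times> \<Omega>\<close> and \<open>\<bar>x - y\<bar>\<close> to the power \<open>- n - s\<close> is integrable on
  \<open>\<Omega>\<close> times its complement. The latter is forced by the integrability of the energy
  differences between \<open>u\<close> and its competitors: the truncation of \<open>u\<close>
  from below at a high level and the same function raised by \<open>1\<close> in \<open>\<Omega>\<close> have an energy
  difference of this size (\<open>boundary_interaction_finite\<close>).

  For uniqueness, exchange a second solution \<open>E\<close> and the subgraph inside a cylinder of height
  \<open>M\<close>. Both exchanged sets are competitors, and the sum of the perimeters grows at most by a
  multiple of the interaction of the cylinder with those points above and below it where the two sets disagree
  (\<open>Per_splice_le\<close>). So the remainder is bounded by this cross term. The cross term is bounded in
  \<open>M\<close>, which makes almost every fiber of \<open>E\<close> differ from a half-line by finite length;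
  dominated convergence then makes the cross term vanish as \<open>M\<close> grows. Hence the remainder is
  zero, and almost every fiber of \<open>E\<close> is the half-line that ends at \<open>u x\<close>
  (\<open>geometric_solution_unique\<close>).
\<close>

section \<open>Power integrals near the origin and near infinity\<close>

text \<open>
  A dyadic comparison: on the shell of radius \<open>r j\<close> the integrand is at most \<open>r j\<close> to the power
  \<open>- a\<close>, and the shell lies in a ball of volume proportional to \<open>r j\<close> to the power \<open>DIM('a)\<close>.
  Radii growing from 1 give integrability at infinity, shrinking radii integrability at 0.
\<close>

lemma nn_integral_norm_powr_shells:
  fixes S :: "'a::euclidean_space set" and r :: "nat \<Rightarrow> real" and a :: real
  assumes r: "\<And>j. r j > 0" and a: "a \<ge> 0"
    and cover: "\<And>z. z \<in> S \<Longrightarrow> \<exists>j. r j \<le> norm z \<and> norm z \<le> 2 * r j"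
    and sm: "summable (\<lambda>j. r j powr (real DIM('a) - a))"
  shows "(\<integral>\<^sup>+z. ennreal (norm z powr (-a)) * indicator S z \<partial>lborel) < \<infinity>"
proof -
  define V where "V = 2 ^ DIM('a) * unit_ball_vol (real DIM('a))"
  have V: "V \<ge> 0" by (simp add: V_def)
  have pt: "ennreal (norm z powr (-a)) * indicator S z
      \<le> (\<Sum>j. ennreal (r j powr (-a)) * indicator (cball 0 (2 * r j)) z)" (is "?l \<le> (\<Sum>j. ?f j)") for z
  proof (cases "z \<in> S")
    case True
    then obtain j where j: "r j \<le> norm z" "norm z \<le> 2 * r j" using cover by blast
    have "norm z powr (-a) \<le> r j powr (-a)"
      using r[of j] j a by (intro powr_mono2') auto
    then have "?l \<le> ?f j" using True j by (auto simp: indicator_def intro: ennreal_leI)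
    also have "?f j \<le> (\<Sum>j. ?f j)"
    proof -
      have "sum ?f {j} \<le> (\<Sum>j. ?f j)" by (intro sum_le_suminf) auto
      then show ?thesis
        by (simp only: sum.insert finite.emptyI sum.empty empty_iff not_False_eq_True add_0_right)
    qed
    finally show ?thesis .
  qed auto
  have "(\<integral>\<^sup>+z. ennreal (norm z powr (-a)) * indicator S z \<partial>lborel)
      \<le> (\<integral>\<^sup>+(z::'a). (\<Sum>j. ennreal (r j powr (-a)) * indicator (cball 0 (2 * r j)) z) \<partial>lborel)"
    by (rule nn_integral_mono) (rule pt)
  also have "\<dots> = (\<Sum>j. ennreal (r j powr (-a)) * emeasure lborel (cball (0::'a) (2 * r j)))"
  proof -
    have "(\<integral>\<^sup>+(z::'a). (\<Sum>j. ennreal (r j powr (-a)) * indicator (cball 0 (2 * r j)) z) \<partial>lborel)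
      = (\<Sum>j. \<integral>\<^sup>+(z::'a). ennreal (r j powr (-a)) * indicator (cball 0 (2 * r j)) z \<partial>lborel)"
      by (intro nn_integral_suminf borel_measurable_times_ennreal borel_measurable_const
          borel_measurable_indicator) simp
    then show ?thesis
      by (simp only: nn_integral_cmult_indicator sets_lborel borel_closed closed_cball)
  qed
  also have "\<dots> = (\<Sum>j. ennreal (V * r j powr (real DIM('a) - a)))"
  proof (intro suminf_cong)
    fix j
    have "emeasure lborel (cball (0::'a) (2 * r j)) = ennreal (V * r j ^ DIM('a))"
    proof -
      have "emeasure lborel (cball (0::'a) (2 * r j)) = ennreal (unit_ball_vol (real DIM('a)) * (2 * r j) ^ DIM('a))"
        using r[of j] by (intro emeasure_cball) auto
      also have "unit_ball_vol (real DIM('a)) * (2 * r j) ^ DIM('a) = V * r j ^ DIM('a)"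
        by (simp only: V_def power_mult_distrib mult_ac)
      finally show ?thesis .
    qed
    then show "ennreal (r j powr (-a)) * emeasure lborel (cball (0::'a) (2 * r j))
        = ennreal (V * r j powr (real DIM('a) - a))"
    proof -
      have "r j powr (real DIM('a) - a) = r j ^ DIM('a) * r j powr (-a)"
        using r[of j] by (simp add: powr_add[symmetric] powr_realpow[symmetric])
      then have "V * r j powr (real DIM('a) - a) = r j powr (-a) * (V * r j ^ DIM('a))"
        by (simp only: mult_ac)
      then show ?thesis
        unfolding \<open>emeasure lborel (cball (0::'a) (2 * r j)) = _\<close>
        using r[of j] V by (simp only: ennreal_mult' powr_ge_zero)
    qed
  qed
  also have "\<dots> < \<infinity>"
  proof -
    have "(\<Sum>j. ennreal (V * r j powr (real DIM('a) - a))) = ennreal (\<Sum>j. V * r j powr (real DIM('a) - a))"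
      by (rule suminf_ennreal2[OF _ summable_mult[OF sm]]) (simp add: V)
    then show ?thesis by (simp only: ennreal_less_top infinity_ennreal_def)
  qed
  finally show ?thesis .
qed

lemma two_power_powr: "((2::real) ^ j) powr c = (2 powr c) ^ j"
proof -
  have "((2::real) ^ j) powr c = (2 powr real j) powr c"
    by (subst powr_realpow) simp_all
  also have "\<dots> = (2 powr c) powr real j"
    by (subst (1 2) powr_powr) (simp only: mult.commute)
  also have "\<dots> = (2 powr c) ^ j"
    by (rule powr_realpow) simp
  finally show ?thesis .
qed

lemma nn_integral_norm_powr_far:
  assumes "a > real DIM('a::euclidean_space)"
  shows "(\<integral>\<^sup>+(z::'a). ennreal (norm z powr (-a)) * indicator {z. 1 \<le> norm z} z \<partial>lborel) < \<infinity>"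
proof (rule nn_integral_norm_powr_shells[where r = "\<lambda>j. 2 ^ j"])
  fix z :: 'a assume "z \<in> {z. 1 \<le> norm z}"
  then have z: "1 \<le> norm z" by simp
  define j where "j = nat \<lfloor>log 2 (norm z)\<rfloor>"
  from z have "0 < norm z" by linarith
  have "0 \<le> log 2 (norm z)" using z by (subst zero_le_log_cancel_iff) auto
  then have "real j \<le> log 2 (norm z)" "log 2 (norm z) < real j + 1"
    unfolding j_def by linarith+
  then have "2 powr real j \<le> norm z" "norm z < 2 powr (real j + 1)"
    using \<open>0 < norm z\<close> by (simp_all add: le_log_iff log_less_iff)
  then show "\<exists>j. 2 ^ j \<le> norm z \<and> norm z \<le> 2 * 2 ^ j"
    by (intro exI[of _ j]) (simp add: powr_add powr_realpow)
next
  have "(2::real) powr (real DIM('a) - a) < 1"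
    using assms powr_less_mono[of "real DIM('a) - a" 0 2] by simp
  then have "summable (\<lambda>j. (2 powr (real DIM('a) - a)) ^ j)"
    by (intro summable_geometric) simp
  then show "summable (\<lambda>j. ((2::real) ^ j) powr (real DIM('a) - a))"
    by (simp only: two_power_powr)
  show "0 \<le> a"
    using assms of_nat_0_le_iff[of "DIM('a)"] by linarith
qed simp

lemma nn_integral_norm_powr_near:
  assumes a: "0 \<le> a" "a < real DIM('a::euclidean_space)" and D: "D > 0"
  shows "(\<integral>\<^sup>+(z::'a). ennreal (norm z powr (-a)) * indicator {z. norm z \<le> D} z \<partial>lborel) < \<infinity>"
proof -
  have "(\<integral>\<^sup>+(z::'a). ennreal (norm z powr (-a)) * indicator {z. 0 < norm z \<and> norm z \<le> D} z \<partial>lborel) < \<infinity>"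
  proof (rule nn_integral_norm_powr_shells[where r = "\<lambda>j. D / 2 ^ Suc j"])
    fix z :: 'a assume "z \<in> {z. 0 < norm z \<and> norm z \<le> D}"
    then have z: "0 < norm z" "norm z \<le> D" by auto
    define j where "j = nat \<lfloor>log 2 (D / norm z)\<rfloor>"
    have "0 \<le> log 2 (D / norm z)" using z D by (subst zero_le_log_cancel_iff) auto
    then have "real j \<le> log 2 (D / norm z)" "log 2 (D / norm z) < real j + 1"
      unfolding j_def by linarith+
    then have "2 powr real j \<le> D / norm z" "D / norm z < 2 powr (real j + 1)"
      using z D le_log_iff[of 2 "D / norm z" "real j"] log_less_iff[of 2 "D / norm z" "real j + 1"]
      by auto
    then show "\<exists>j. D / 2 ^ Suc j \<le> norm z \<and> norm z \<le> 2 * (D / 2 ^ Suc j)"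
      using z by (intro exI[of _ j]) (simp add: powr_add powr_realpow field_simps)
  next
    have "(D / 2 ^ Suc j) powr (real DIM('a) - a)
      = (D / 2) powr (real DIM('a) - a) * (2 powr (a - real DIM('a))) ^ j" for j
    proof -
      have "(D / 2 ^ Suc j) powr (real DIM('a) - a) = ((D / 2) / 2 ^ j) powr (real DIM('a) - a)"
        by (simp only: power_Suc divide_divide_eq_left)
      also have "\<dots> = (D / 2) powr (real DIM('a) - a) / (2 ^ j) powr (real DIM('a) - a)"
        by (rule powr_divide)
      also have "\<dots> = (D / 2) powr (real DIM('a) - a) * (2 powr (- (real DIM('a) - a))) ^ j"
        by (simp only: two_power_powr powr_minus power_inverse divide_inverse)
      finally show ?thesis unfolding minus_diff_eq .
    qed
    note eq = this
    have "(2::real) powr (a - real DIM('a)) < 1"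
      using a powr_less_mono[of "a - real DIM('a)" 0 2] by simp
    then have "summable (\<lambda>j. (2 powr (a - real DIM('a))) ^ j)"
      by (intro summable_geometric) simp
    then show "summable (\<lambda>j. (D / 2 ^ Suc j) powr (real DIM('a) - a))"
      unfolding eq by (rule summable_mult)
  qed (use a D in auto)
  also have "(\<integral>\<^sup>+(z::'a). ennreal (norm z powr (-a)) * indicator {z. 0 < norm z \<and> norm z \<le> D} z \<partial>lborel)
    = (\<integral>\<^sup>+(z::'a). ennreal (norm z powr (-a)) * indicator {z. norm z \<le> D} z \<partial>lborel)"
    by (intro nn_integral_cong) (auto simp: indicator_def)
  finally show ?thesis .
qed

section \<open>The kernel and its energy density on the line\<close>

text \<open>
  The kernel of the fractional perimeter in dimension \<open>n + 1\<close>, for two points at horizontal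
  distance \<open>r\<close> and vertical distance \<open>\<sigma>\<close>; for \<open>r = 1\<close> it is \<open>gs n s\<close>.
\<close>

definition kern :: "nat \<Rightarrow> real \<Rightarrow> real \<Rightarrow> real \<Rightarrow> real" where
  "kern n s r \<sigma> = (r\<^sup>2 + \<sigma>\<^sup>2) powr (- ((real n + 1 + s) / 2))"

lemma kern_nonneg [simp]: "kern n s r \<sigma> \<ge> 0"
  by (simp add: kern_def)

lemma kern_pos: "r \<noteq> 0 \<Longrightarrow> kern n s r \<sigma> > 0"
proof -
  assume "r \<noteq> 0"
  then have "r\<^sup>2 + \<sigma>\<^sup>2 > 0" by (simp add: add_pos_nonneg)
  then show ?thesis unfolding kern_def powr_gt_zero by (rule less_imp_neq[symmetric])
qed

lemma kern_uminus [simp]: "kern n s r (- \<sigma>) = kern n s r \<sigma>"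
  by (simp add: kern_def)

lemma measurable_kern' [measurable (raw)]:
  "f \<in> borel_measurable M \<Longrightarrow> g \<in> borel_measurable M \<Longrightarrow> (\<lambda>x. kern n s (f x) (g x)) \<in> borel_measurable M"
  unfolding kern_def
  by (intro powr_real_measurable borel_measurable_add borel_measurable_power borel_measurable_const)

lemma gs_pos: "gs n s t > 0"
proof -
  have "1 + t\<^sup>2 > 0" by (simp add: add_pos_nonneg)
  then show ?thesis by (simp add: gs_def)
qed

lemma gs_uminus [simp]: "gs n s (- t) = gs n s t"
  by (simp add: gs_def)

lemma gs_le_1: "s \<ge> 0 \<Longrightarrow> gs n s t \<le> 1"
proof -
  assume "s \<ge> 0"
  have "(1 + t\<^sup>2) powr (- ((real n + 1 + s) / 2)) \<le> (1 + t\<^sup>2) powr 0"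
    using \<open>s \<ge> 0\<close> by (intro powr_mono) auto
  also have "\<dots> = 1" using add_pos_nonneg[OF zero_less_one zero_le_power2[of t]] by simp
  finally show ?thesis by (simp add: gs_def)
qed

lemma continuous_gs: "continuous_on S (gs n s)"
proof -
  have pos: "0 < 1 + t\<^sup>2" for t :: real
    by (intro add_pos_nonneg) auto
  have "1 + t\<^sup>2 \<noteq> 0" for t :: real
    using pos[of t] by (rule less_imp_neq[THEN not_sym])
  then show ?thesis
    unfolding gs_def by (intro continuous_intros) blast
qed

lemma measurable_gs [measurable]: "gs n s \<in> borel_measurable borel"
  by (rule borel_measurable_continuous_onI[OF continuous_gs])

lemma twice_half: "2 * (- (c / 2)) = - (c::real)"
  by simp

lemma kern_scale:
  assumes "r > 0"
  shows "kern n s r (r * \<tau>) = r powr (- (real n + 1 + s)) * gs n s \<tau>"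
proof -
  have "r\<^sup>2 + (r * \<tau>)\<^sup>2 = r powr 2 * (1 + \<tau>\<^sup>2)"
    using assms by (simp add: algebra_simps power_mult_distrib)
  then have "kern n s r (r * \<tau>) = (r powr 2) powr (- ((real n + 1 + s) / 2)) * gs n s \<tau>"
    by (simp only: kern_def gs_def powr_mult)
  also have "(r powr 2) powr (- ((real n + 1 + s) / 2)) = r powr (2 * (- ((real n + 1 + s) / 2)))"
    by (rule powr_powr)
  also have "2 * (- ((real n + 1 + s) / 2)) = - (real n + 1 + s)" by (simp only: twice_half)
  finally show ?thesis .
qed

lemma integrable_abs_gs:
  assumes "s > 0" "n \<ge> 1"
  shows "integrable lborel (\<lambda>\<sigma>. \<bar>\<sigma>\<bar> * gs n s \<sigma>)"
proof (rule integrableI_bounded)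
  have bd: "ennreal (norm (\<bar>\<sigma>\<bar> * gs n s \<sigma>)) \<le> indicator {-1..1} \<sigma> +
     ennreal (norm \<sigma> powr (- (1 + s))) * indicator {z. 1 \<le> norm z} \<sigma>" for \<sigma>
  proof (cases "\<bar>\<sigma>\<bar> \<le> 1")
    case True
    then have "\<bar>\<sigma>\<bar> * gs n s \<sigma> \<le> 1"
      using gs_le_1[of s n \<sigma>] assms gs_pos[of n s \<sigma>] by (intro mult_le_one) auto
    then have "ennreal (norm (\<bar>\<sigma>\<bar> * gs n s \<sigma>)) \<le> 1"
      using gs_pos[of n s \<sigma>] by (simp add: abs_mult)
    also have "1 \<le> (indicator {-1..1} \<sigma> :: ennreal) +
     ennreal (norm \<sigma> powr (- (1 + s))) * indicator {z. 1 \<le> norm z} \<sigma>"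
      using True by (auto simp: indicator_def)
    finally show ?thesis .
  next
    case False
    have "gs n s \<sigma> \<le> (\<sigma>\<^sup>2) powr (- ((real n + 1 + s) / 2))"
      unfolding gs_def using False assms by (intro powr_mono2') auto
    also have "\<sigma>\<^sup>2 = \<bar>\<sigma>\<bar> powr 2" using False by simp
    also have "(\<bar>\<sigma>\<bar> powr 2) powr (- ((real n + 1 + s) / 2)) = \<bar>\<sigma>\<bar> powr (- (real n + 1 + s))"
      by (simp only: powr_powr twice_half)
    also have "\<dots> \<le> \<bar>\<sigma>\<bar> powr (- (2 + s))"
      using False assms by (intro powr_mono) auto
    finally have "\<bar>\<sigma>\<bar> * gs n s \<sigma> \<le> \<bar>\<sigma>\<bar> * \<bar>\<sigma>\<bar> powr (- (2 + s))"
      by (intro mult_left_mono) auto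
    also have "\<dots> = \<bar>\<sigma>\<bar> powr (1 + (- (2 + s)))"
      using False by (subst powr_add) simp
    finally show ?thesis
      using False gs_pos[of n s \<sigma>] by (auto simp: abs_mult indicator_def intro!: ennreal_leI)
  qed
  have "(\<integral>\<^sup>+ \<sigma>. ennreal (norm (\<bar>\<sigma>\<bar> * gs n s \<sigma>)) \<partial>lborel) \<le>
     (\<integral>\<^sup>+ (\<sigma>::real). indicator {-1..1} \<sigma> +
     ennreal (norm \<sigma> powr (- (1 + s))) * indicator {z. 1 \<le> norm z} \<sigma> \<partial>lborel)"
    by (intro nn_integral_mono bd)
  also have "\<dots> = emeasure lborel {-1..1::real} +
      (\<integral>\<^sup>+ \<sigma>. ennreal (norm \<sigma> powr (- (1 + s))) * indicator {z. 1 \<le> norm (z::real)} \<sigma> \<partial>lborel)"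
    by (subst nn_integral_add) auto
  also have "\<dots> < \<infinity>"
    using nn_integral_norm_powr_far[where 'a = real, of "1 + s"] assms by (auto simp: ennreal_add_less_top)
  finally show "(\<integral>\<^sup>+ \<sigma>. ennreal (norm (\<bar>\<sigma>\<bar> * gs n s \<sigma>)) \<partial>lborel) < \<infinity>" .
qed simp

lemma integrable_gs:
  assumes "s > 0" "n \<ge> 1"
  shows "integrable lborel (gs n s)"
proof (rule Bochner_Integration.integrable_bound)
  show "integrable lborel (\<lambda>\<sigma>. \<bar>\<sigma>\<bar> * gs n s \<sigma> + indicator {-1..1} \<sigma>)"
    by (intro Bochner_Integration.integrable_add integrable_abs_gs assms) auto
  have "gs n s \<sigma> \<le> \<bar>\<sigma>\<bar> * gs n s \<sigma> + indicator {-1..1} \<sigma>" for \<sigma>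
  proof (cases "\<bar>\<sigma>\<bar> \<le> 1")
    case True
    then have "indicator {-1..1} \<sigma> = (1::real)" by (auto simp: abs_le_iff)
    moreover have "\<bar>\<sigma>\<bar> * gs n s \<sigma> \<ge> 0" using gs_pos[of n s \<sigma>] by simp
    ultimately show ?thesis using gs_le_1[of s n \<sigma>] assms by linarith
  next
    case False
    then have "1 * gs n s \<sigma> \<le> \<bar>\<sigma>\<bar> * gs n s \<sigma>" 
      using gs_pos[of n s \<sigma>] by (intro mult_right_mono) auto
    then show ?thesis by (simp add: add_increasing2)
  qed
  then show "AE \<sigma> in lborel. norm (gs n s \<sigma>) \<le> norm (\<bar>\<sigma>\<bar> * gs n s \<sigma> + indicator {-1..1} \<sigma>)"
    using gs_pos[of n s] by (intro AE_I2) (smt (verit) real_norm_def)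
qed simp

definition mass_gs :: "nat \<Rightarrow> real \<Rightarrow> real" where
  "mass_gs n s = (LINT \<sigma>|lborel. gs n s \<sigma>)"

text \<open>
  The energy density on the line, before it is recognized as \<open>2 * GGs n s d\<close> plus a constant. In
  this form convexity and the comparison with symmetric differences are immediate.
\<close>

definition Phi :: "nat \<Rightarrow> real \<Rightarrow> real \<Rightarrow> real" where
  "Phi n s d = (LINT \<sigma>|lborel. gs n s \<sigma> * \<bar>d - \<sigma>\<bar>)"

lemma integrable_gs_abs_diff:
  assumes "s > 0" "n \<ge> 1"
  shows "integrable lborel (\<lambda>\<sigma>. gs n s \<sigma> * \<bar>d - \<sigma>\<bar>)"
proof (rule Bochner_Integration.integrable_bound)
  show "integrable lborel (\<lambda>\<sigma>. \<bar>d\<bar> * gs n s \<sigma> + \<bar>\<sigma>\<bar> * gs n s \<sigma>)"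
    by (intro Bochner_Integration.integrable_add integrable_abs_gs integrable_mult_right integrable_gs assms)
  have "gs n s \<sigma> * \<bar>d - \<sigma>\<bar> \<le> gs n s \<sigma> * (\<bar>d\<bar> + \<bar>\<sigma>\<bar>)" for \<sigma>
    using gs_pos[of n s \<sigma>] by (intro mult_left_mono) auto
  then show "AE \<sigma> in lborel. norm (gs n s \<sigma> * \<bar>d - \<sigma>\<bar>) \<le> norm (\<bar>d\<bar> * gs n s \<sigma> + \<bar>\<sigma>\<bar> * gs n s \<sigma>)"
    using gs_pos[of n s] by (intro AE_I2) (simp add: abs_mult algebra_simps less_imp_le)
qed simp

lemma mass_gs_pos:
  assumes "s > 0" "n \<ge> 1"
  shows "mass_gs n s > 0"
proof -
  have "mass_gs n s \<noteq> 0"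
  proof
    assume "mass_gs n s = 0"
    then have "AE \<sigma> in lborel. gs n s \<sigma> = 0"
      unfolding mass_gs_def using integrable_gs[OF assms] gs_pos[of n s]
      by (subst (asm) integral_nonneg_eq_0_iff_AE) (auto simp: less_imp_le)
    then have "AE \<sigma> in (lborel :: real measure). False"
      using gs_pos[of n s] by (auto simp: less_le)
    then show False by (simp add: AE_iff_measurable[OF _ refl])
  qed
  moreover have "mass_gs n s \<ge> 0"
    unfolding mass_gs_def using gs_pos[of n s] by (intro Bochner_Integration.integral_nonneg) (auto simp: less_imp_le)
  ultimately show ?thesis by simp
qed

lemma Phi_upper:
  assumes "s > 0" "n \<ge> 1"
  shows "Phi n s d \<le> mass_gs n s * \<bar>d\<bar> + Phi n s 0"
proof -
  have "Phi n s d \<le> (LINT \<sigma>|lborel. gs n s \<sigma> * \<bar>d\<bar> + gs n s \<sigma> * \<bar>0 - \<sigma>\<bar>)"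
    unfolding Phi_def
  proof (rule integral_mono)
    fix \<sigma> :: real
    have "gs n s \<sigma> * \<bar>d - \<sigma>\<bar> \<le> gs n s \<sigma> * (\<bar>d\<bar> + \<bar>0 - \<sigma>\<bar>)"
      using gs_pos[of n s \<sigma>] by (intro mult_left_mono) auto
    then show "gs n s \<sigma> * \<bar>d - \<sigma>\<bar> \<le> gs n s \<sigma> * \<bar>d\<bar> + gs n s \<sigma> * \<bar>0 - \<sigma>\<bar>"
      by (simp add: algebra_simps)
  qed (intro Bochner_Integration.integrable_add integrable_gs_abs_diff integrable_mult_left integrable_gs assms)+
  also have "\<dots> = mass_gs n s * \<bar>d\<bar> + Phi n s 0"
  proof -
    have "(LINT \<sigma>|lborel. gs n s \<sigma> * \<bar>d\<bar> + gs n s \<sigma> * \<bar>0 - \<sigma>\<bar>) =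
        (LINT \<sigma>|lborel. gs n s \<sigma> * \<bar>d\<bar>) + (LINT \<sigma>|lborel. gs n s \<sigma> * \<bar>0 - \<sigma>\<bar>)"
      by (intro Bochner_Integration.integral_add integrable_gs_abs_diff integrable_mult_left integrable_gs assms)
    then show ?thesis
      unfolding Phi_def mass_gs_def by (simp only: integral_mult_left_zero)
  qed
  finally show ?thesis .
qed

lemma Phi_uminus: "Phi n s (- d) = Phi n s d"
proof -
  have "Phi n s (- d) = \<bar>-1\<bar> *\<^sub>R (LINT \<sigma>|lborel. gs n s (0 + (-1) * \<sigma>) * abs (- d - (0 + (-1) * \<sigma>)))"
    unfolding Phi_def by (rule lborel_integral_real_affine) auto
  also have "(\<lambda>\<sigma>. gs n s (0 + (-1) * \<sigma>) * abs (- d - (0 + (-1) * \<sigma>))) = (\<lambda>\<sigma>. gs n s \<sigma> * abs (d - \<sigma>))"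
  proof
    fix \<sigma>
    have "gs n s (0 + (-1) * \<sigma>) = gs n s \<sigma>"
      by (simp only: mult_minus1 add_0 gs_uminus)
    moreover have "abs (- d - (0 + (-1) * \<sigma>)) = abs (d - \<sigma>)" by arith
    ultimately show "gs n s (0 + (-1) * \<sigma>) * abs (- d - (0 + (-1) * \<sigma>)) = gs n s \<sigma> * abs (d - \<sigma>)"
      by (simp only:)
  qed
  finally show ?thesis unfolding Phi_def by (simp only: abs_minus_cancel abs_one scaleR_one)
qed

text \<open>
  Since \<open>gs\<close> is even, \<open>Phi\<close> is even as well, and the two reflected integrands add up to at least
  \<open>2 * \<bar>d\<bar>\<close> times \<open>gs\<close>.
\<close>

lemma Phi_lower:
  assumes "s > 0" "n \<ge> 1"
  shows "mass_gs n s * \<bar>d\<bar> \<le> Phi n s d"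
proof -
  have "mass_gs n s * (2 * \<bar>d\<bar>) = (LINT \<sigma>|lborel. gs n s \<sigma> * (2 * \<bar>d\<bar>))"
    unfolding mass_gs_def by simp
  also have "\<dots> \<le> (LINT \<sigma>|lborel. gs n s \<sigma> * \<bar>d - \<sigma>\<bar> + gs n s \<sigma> * \<bar>- d - \<sigma>\<bar>)"
  proof (rule integral_mono)
    fix \<sigma> :: real
    have "gs n s \<sigma> * (2 * \<bar>d\<bar>) \<le> gs n s \<sigma> * (\<bar>d - \<sigma>\<bar> + \<bar>- d - \<sigma>\<bar>)"
      using gs_pos[of n s \<sigma>] by (intro mult_left_mono) auto
    then show "gs n s \<sigma> * (2 * \<bar>d\<bar>) \<le> gs n s \<sigma> * \<bar>d - \<sigma>\<bar> + gs n s \<sigma> * \<bar>- d - \<sigma>\<bar>"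
      by (simp add: algebra_simps)
  qed (intro Bochner_Integration.integrable_add integrable_gs_abs_diff integrable_mult_left integrable_gs assms)+
  also have "\<dots> = Phi n s d + Phi n s (- d)"
    unfolding Phi_def by (intro Bochner_Integration.integral_add integrable_gs_abs_diff assms)
  finally show ?thesis by (simp add: Phi_uminus)
qed

text \<open>
  The integrals at \<open>d\<close> and at \<open>0\<close> differ by twice the mass of \<open>gs\<close> between \<open>0\<close> and \<open>d\<close>, and at
  \<open>0\<close> the integrand is odd.
\<close>

lemma Gs_eq_integral_sgn:
  assumes "s > 0" "n \<ge> 1"
  shows "(LINT \<sigma>|lborel. gs n s \<sigma> * sgn (d - \<sigma>)) = 2 * Gs n s d"
proof -
  define H where "H = (\<lambda>d. LINT \<sigma>|lborel. gs n s \<sigma> * sgn (d - \<sigma>))"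
  have int: "integrable lborel (\<lambda>\<sigma>. gs n s \<sigma> * sgn (d - \<sigma>))" for d
  proof (rule Bochner_Integration.integrable_bound[OF integrable_gs[OF assms]])
    show "(\<lambda>\<sigma>. gs n s \<sigma> * sgn (d - \<sigma>)) \<in> borel_measurable lborel" by measurable
    show "AE \<sigma> in lborel. norm (gs n s \<sigma> * sgn (d - \<sigma>)) \<le> norm (gs n s \<sigma>)"
      by (intro AE_I2) (simp add: abs_mult abs_sgn_eq)
  qed
  \<comment> \<open>The substitution of the negative shows that the integral at 0 equals its own negative.\<close>
  have "H 0 = \<bar>-1\<bar> *\<^sub>R (LINT \<sigma>|lborel. gs n s (0 + (-1) * \<sigma>) * sgn (0 - (0 + (-1) * \<sigma>)))"
    unfolding H_def by (rule lborel_integral_real_affine) auto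
  also have "(\<lambda>\<sigma>. gs n s (0 + (-1) * \<sigma>) * sgn (0 - (0 + (-1) * \<sigma>))) = (\<lambda>\<sigma>. - (gs n s \<sigma> * sgn (0 - \<sigma>)))"
    by (auto simp: sgn_if)
  finally have "H 0 = - H 0" unfolding H_def by simp
  then have H0: "H 0 = 0" by simp
  have ne: "AE \<sigma> in lborel. \<sigma> \<noteq> c" for c :: real
    by (rule AE_lborel_singleton)
  have *: "H d - H 0 = (LINT \<sigma>|lborel. gs n s \<sigma> * sgn (d - \<sigma>) - gs n s \<sigma> * sgn (0 - \<sigma>))"
    unfolding H_def by (rule Bochner_Integration.integral_diff[symmetric]) (rule int)+
  have "H d - H 0 = 2 * Gs n s d"
  proof (cases "0 \<le> d")
    case True
    have "H d - H 0 = (LINT \<sigma>|lborel. 2 * (indicator {0<..<d} \<sigma> *\<^sub>R gs n s \<sigma>))"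
      unfolding *
    proof (rule integral_cong_AE)
      show "AE \<sigma> in lborel. gs n s \<sigma> * sgn (d - \<sigma>) - gs n s \<sigma> * sgn (0 - \<sigma>) =
        2 * (indicator {0<..<d} \<sigma> *\<^sub>R gs n s \<sigma>)"
        using ne[of 0] ne[of d]
        by eventually_elim (use True in \<open>auto simp: sgn_if indicator_def\<close>)
    qed measurable
    also have "\<dots> = 2 * Gs n s d"
      using True by (simp add: Gs_def interval_lebesgue_integral_def set_lebesgue_integral_def zero_ereal_def einterval_eq)
    finally show ?thesis .
  next
    case False
    have "H d - H 0 = (LINT \<sigma>|lborel. (-2) * (indicator {d<..<0} \<sigma> *\<^sub>R gs n s \<sigma>))"
      unfolding *
    proof (rule integral_cong_AE)
      show "AE \<sigma> in lborel. gs n s \<sigma> * sgn (d - \<sigma>) - gs n s \<sigma> * sgn (0 - \<sigma>) =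
        (-2) * (indicator {d<..<0} \<sigma> *\<^sub>R gs n s \<sigma>)"
        using ne[of 0] ne[of d]
        by eventually_elim (use False in \<open>auto simp: sgn_if indicator_def\<close>)
    qed measurable
    also have "\<dots> = 2 * Gs n s d"
      using False by (simp add: Gs_def interval_lebesgue_integral_def set_lebesgue_integral_def zero_ereal_def einterval_eq)
    finally show ?thesis .
  qed
  then show ?thesis unfolding H0 unfolding H_def by simp
qed

lemma DERIV_quadratic_bound:
  fixes f :: "real \<Rightarrow> real"
  assumes "\<And>h. \<bar>f (x + h) - f x - h * D\<bar> \<le> C * h\<^sup>2"
  shows "DERIV f x :> D"
proof -
  have "((\<lambda>h. (f (x + h) - f x) / h - D) \<longlongrightarrow> 0) (at 0)"
  proof (rule Lim_null_comparison)
    show "eventually (\<lambda>h. norm ((f (x + h) - f x) / h - D) \<le> C * \<bar>h\<bar>) (at 0)"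
    proof (rule eventually_at_filter[THEN iffD2], rule always_eventually, intro allI impI)
      fix h :: real assume h: "h \<noteq> 0"
      have "norm ((f (x + h) - f x) / h - D) = \<bar>f (x + h) - f x - h * D\<bar> / \<bar>h\<bar>"
        using h by (simp add: abs_divide[symmetric] diff_divide_distrib)
      also have "\<dots> \<le> (C * h\<^sup>2) / \<bar>h\<bar>"
        by (intro divide_right_mono assms) simp
      also have "\<dots> = C * \<bar>h\<bar>"
        using h by (simp add: power2_eq_square field_simps)
      finally show "norm ((f (x + h) - f x) / h - D) \<le> C * \<bar>h\<bar>" .
    qed
    show "((\<lambda>h. C * \<bar>h\<bar>) \<longlongrightarrow> 0) (at 0)"
      by (auto intro!: tendsto_eq_intros)
  qed
  then show ?thesis
    unfolding DERIV_def by (rule LIM_zero_cancel)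
qed

text \<open>
  The function \<open>\<lambda>d. \<bar>d - \<sigma>\<bar>\<close> is affine with slope \<open>sgn (d - \<sigma>)\<close> except within distance \<open>\<bar>h\<bar>\<close>
  of \<open>\<sigma>\<close>, where the error is at most \<open>2 * \<bar>h\<bar>\<close>; since \<open>gs\<close> is at most 1, the total error is
  quadratic in \<open>h\<close>.
\<close>

lemma DERIV_Phi:
  assumes s: "s > 0" "n \<ge> 1"
  shows "DERIV (Phi n s) d :> 2 * Gs n s d"
proof (rule DERIV_quadratic_bound[where C = 4])
  fix h :: real
  have isgn: "integrable lborel (\<lambda>\<sigma>. gs n s \<sigma> * sgn (d - \<sigma>))"
  proof (rule Bochner_Integration.integrable_bound[OF integrable_gs[OF s]])
    show "(\<lambda>\<sigma>. gs n s \<sigma> * sgn (d - \<sigma>)) \<in> borel_measurable lborel" by measurable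
    show "AE \<sigma> in lborel. norm (gs n s \<sigma> * sgn (d - \<sigma>)) \<le> norm (gs n s \<sigma>)"
      by (intro AE_I2) (simp add: abs_mult abs_sgn_eq)
  qed
  let ?f = "\<lambda>\<sigma>. gs n s \<sigma> * \<bar>d + h - \<sigma>\<bar> - gs n s \<sigma> * \<bar>d - \<sigma>\<bar> - h * (gs n s \<sigma> * sgn (d - \<sigma>))"
  have int: "integrable lborel ?f"
    by (intro Bochner_Integration.integrable_diff integrable_gs_abs_diff s integrable_mult_right isgn)
  have eq: "Phi n s (d + h) - Phi n s d - h * (2 * Gs n s d) = (LINT \<sigma>|lborel. ?f \<sigma>)"
  proof -
    have "(LINT \<sigma>|lborel. ?f \<sigma>) = (LINT \<sigma>|lborel. gs n s \<sigma> * \<bar>d + h - \<sigma>\<bar> - gs n s \<sigma> * \<bar>d - \<sigma>\<bar>)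
        - (LINT \<sigma>|lborel. h * (gs n s \<sigma> * sgn (d - \<sigma>)))"
      by (intro Bochner_Integration.integral_diff Bochner_Integration.integrable_diff
          integrable_gs_abs_diff s integrable_mult_right isgn)
    also have "(LINT \<sigma>|lborel. gs n s \<sigma> * \<bar>d + h - \<sigma>\<bar> - gs n s \<sigma> * \<bar>d - \<sigma>\<bar>) = Phi n s (d + h) - Phi n s d"
      unfolding Phi_def by (intro Bochner_Integration.integral_diff integrable_gs_abs_diff s)
    also have "(LINT \<sigma>|lborel. h * (gs n s \<sigma> * sgn (d - \<sigma>))) = h * (2 * Gs n s d)"
      unfolding Gs_eq_integral_sgn[OF s, symmetric] by (rule integral_mult_right_zero)
    finally show ?thesis by (rule sym)
  qed
  have "\<bar>Phi n s (d + h) - Phi n s d - h * (2 * Gs n s d)\<bar> = \<bar>LINT \<sigma>|lborel. ?f \<sigma>\<bar>"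
    by (simp only: eq)
  also have "\<dots> \<le> (LINT \<sigma>|lborel. \<bar>?f \<sigma>\<bar>)"
    using integral_norm_bound[of lborel ?f] by (simp only: real_norm_def)
  also have "\<dots> \<le> (LINT \<sigma>|lborel. (2 * \<bar>h\<bar>) * indicator {d - \<bar>h\<bar>..d + \<bar>h\<bar>} \<sigma>)"
  proof (rule integral_mono)
    fix \<sigma> :: real
    have "\<bar>?f \<sigma>\<bar> = gs n s \<sigma> * \<bar>\<bar>d + h - \<sigma>\<bar> - \<bar>d - \<sigma>\<bar> - h * sgn (d - \<sigma>)\<bar>"
    proof -
      have "?f \<sigma> = gs n s \<sigma> * (\<bar>d + h - \<sigma>\<bar> - \<bar>d - \<sigma>\<bar> - h * sgn (d - \<sigma>))"
        by (simp add: algebra_simps)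
      then show ?thesis using gs_pos[of n s \<sigma>] by (simp add: abs_mult)
    qed
    also have "\<dots> \<le> 1 * ((2 * \<bar>h\<bar>) * indicator {d - \<bar>h\<bar>..d + \<bar>h\<bar>} \<sigma>)"
    proof (rule mult_mono)
      show "gs n s \<sigma> \<le> 1" using gs_le_1 s by simp
      show "\<bar>\<bar>d + h - \<sigma>\<bar> - \<bar>d - \<sigma>\<bar> - h * sgn (d - \<sigma>)\<bar> \<le> (2 * \<bar>h\<bar>) * indicator {d - \<bar>h\<bar>..d + \<bar>h\<bar>} \<sigma>"
      proof (cases "\<bar>\<sigma> - d\<bar> \<le> \<bar>h\<bar>")
        case True
        then have "indicat_real {d - \<bar>h\<bar>..d + \<bar>h\<bar>} \<sigma> = 1" by (simp add: abs_le_iff)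
        moreover have "\<bar>\<bar>d + h - \<sigma>\<bar> - \<bar>d - \<sigma>\<bar> - h * sgn (d - \<sigma>)\<bar> \<le> 2 * \<bar>h\<bar>"
          by (cases "d - \<sigma>" "0::real" rule: linorder_cases) (simp_all add: sgn_if)
        ultimately show ?thesis by simp
      next
        case False
        then have "\<bar>d + h - \<sigma>\<bar> - \<bar>d - \<sigma>\<bar> - h * sgn (d - \<sigma>) = 0"
          by (cases "d - \<sigma>" "0::real" rule: linorder_cases) (simp_all add: sgn_if)
        then show ?thesis by simp
      qed
    qed (auto simp: indicator_def)
    finally show "\<bar>?f \<sigma>\<bar> \<le> (2 * \<bar>h\<bar>) * indicator {d - \<bar>h\<bar>..d + \<bar>h\<bar>} \<sigma>" by simp
  next
    show "integrable lborel (\<lambda>\<sigma>. \<bar>?f \<sigma>\<bar>)" by (rule integrable_abs[OF int])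
    show "integrable lborel (\<lambda>\<sigma>. (2 * \<bar>h\<bar>) * indicat_real {d - \<bar>h\<bar>..d + \<bar>h\<bar>} \<sigma>)"
      by (intro integrable_mult_right integrable_real_indicator) auto
  qed
  also have "\<dots> = 4 * h\<^sup>2"
    by (simp add: power2_eq_square abs_mult_self_eq)
  finally show "\<bar>Phi n s (d + h) - Phi n s d - h * (2 * Gs n s d)\<bar> \<le> 4 * h\<^sup>2" .
qed

lemma DERIV_interval_integral:
  fixes f :: "real \<Rightarrow> real"
  assumes "continuous_on UNIV f"
  shows "DERIV (\<lambda>t. LBINT \<tau>=0..t. f \<tau>) t :> f t"
proof -
  let ?a = "- \<bar>t\<bar> - 1" and ?b = "\<bar>t\<bar> + 1"
  have "((\<lambda>u. LBINT y=ereal 0..ereal u. f y) has_vector_derivative (f t)) (at t within {?a..?b})"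
    by (rule interval_integral_FTC2) (auto intro: continuous_on_subset[OF assms])
  moreover have "at t within {?a..?b} = at t"
    by (rule at_within_interior) (simp add: interior_atLeastAtMost_real; arith)
  ultimately show ?thesis
    by (simp add: has_real_derivative_iff_has_vector_derivative zero_ereal_def)
qed

lemma DERIV_Gs: "DERIV (Gs n s) t :> gs n s t"
  using DERIV_interval_integral[OF continuous_gs, of n s t] unfolding Gs_def .

lemma continuous_Gs: "continuous_on S (Gs n s)"
  by (rule DERIV_continuous_on) (rule DERIV_subset[OF DERIV_Gs subset_UNIV])

lemma DERIV_GGs: "DERIV (GGs n s) t :> Gs n s t"
  using DERIV_interval_integral[OF continuous_Gs, of n s t] unfolding GGs_def .

lemma measurable_GGs [measurable]: "GGs n s \<in> borel_measurable borel"
  by (rule borel_measurable_continuous_onI[OF DERIV_continuous_on])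
     (rule DERIV_subset[OF DERIV_GGs subset_UNIV])

lemma GGs_0: "GGs n s 0 = 0"
  by (simp add: GGs_def zero_ereal_def)

lemma Gs_0: "Gs n s 0 = 0"
  by (simp add: Gs_def zero_ereal_def)

lemma Gs_strict_mono: "a < b \<Longrightarrow> Gs n s a < Gs n s b"
  by (rule DERIV_pos_imp_increasing[of a b "Gs n s"]) (use DERIV_Gs gs_pos in blast)+

lemma Phi_eq_GGs:
  assumes "s > 0" "n \<ge> 1"
  shows "Phi n s d = 2 * GGs n s d + Phi n s 0"
proof -
  have "DERIV (\<lambda>d. Phi n s d - 2 * GGs n s d) x :> 0" for x
    by (rule derivative_eq_intros DERIV_Phi[OF assms] DERIV_GGs refl | simp)+
  then have "Phi n s d - 2 * GGs n s d = Phi n s 0 - 2 * GGs n s 0"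
    by (intro DERIV_isconst_all) auto
  then show ?thesis by (simp add: GGs_0)
qed

lemma nn_integral_kern:
  assumes "s > 0" "n \<ge> 1" "r > 0"
  shows "(\<integral>\<^sup>+\<sigma>. ennreal (kern n s r \<sigma>) \<partial>lborel) = ennreal (r powr (- (real n + s)) * mass_gs n s)"
proof -
  have "(\<integral>\<^sup>+\<sigma>. ennreal (kern n s r \<sigma>) \<partial>lborel) = ennreal \<bar>r\<bar> * (\<integral>\<^sup>+\<tau>. ennreal (kern n s r (0 + r * \<tau>)) \<partial>lborel)"
    using assms by (intro nn_integral_real_affine) auto
  also have "(\<lambda>\<tau>. ennreal (kern n s r (0 + r * \<tau>))) = (\<lambda>\<tau>. ennreal (r powr (- (real n + 1 + s))) * ennreal (gs n s \<tau>))"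
    by (simp only: add_0 kern_scale[OF assms(3)] ennreal_mult'[OF powr_ge_zero])
  also have "(\<integral>\<^sup>+\<tau>. ennreal (r powr (- (real n + 1 + s))) * ennreal (gs n s \<tau>) \<partial>lborel) =
      ennreal (r powr (- (real n + 1 + s))) * ennreal (mass_gs n s)"
    unfolding mass_gs_def using gs_pos[of n s] integrable_gs[OF assms(1,2)]
    by (subst nn_integral_cmult, simp, subst nn_integral_eq_integral) (auto simp: less_imp_le)
  also have "ennreal \<bar>r\<bar> * \<dots> = ennreal (\<bar>r\<bar> * (r powr (- (real n + 1 + s)) * mass_gs n s))"
    using mass_gs_pos[OF assms(1,2)] by (simp only: ennreal_mult' abs_ge_zero powr_ge_zero)
  also have "\<bar>r\<bar> * (r powr (- (real n + 1 + s)) * mass_gs n s) = r powr (1 + (- (real n + 1 + s))) * mass_gs n s"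
    using assms(3) by (subst powr_add) simp
  also have "1 + (- (real n + 1 + s)) = - (real n + s)" by simp
  finally show ?thesis .
qed

lemma nn_integral_kern_abs_diff:
  assumes "s > 0" "n \<ge> 1" "r > 0"
  shows "(\<integral>\<^sup>+\<sigma>. ennreal (kern n s r \<sigma>) * ennreal \<bar>d - \<sigma>\<bar> \<partial>lborel)
    = ennreal (r powr (- (real n - 1 + s)) * Phi n s (d / r))"
proof -
  have "(\<integral>\<^sup>+\<sigma>. ennreal (kern n s r \<sigma>) * ennreal \<bar>d - \<sigma>\<bar> \<partial>lborel)
    = ennreal \<bar>r\<bar> * (\<integral>\<^sup>+\<tau>. ennreal (kern n s r (0 + r * \<tau>)) * ennreal \<bar>d - (0 + r * \<tau>)\<bar> \<partial>lborel)"
    using assms by (intro nn_integral_real_affine) auto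
  also have "(\<lambda>\<tau>. ennreal (kern n s r (0 + r * \<tau>)) * ennreal \<bar>d - (0 + r * \<tau>)\<bar>) =
    (\<lambda>\<tau>. ennreal (r powr (- (real n + 1 + s)) * r) * ennreal (gs n s \<tau> * \<bar>d / r - \<tau>\<bar>))"
  proof
    fix \<tau>
    have "\<bar>d - (0 + r * \<tau>)\<bar> = \<bar>r * (d / r - \<tau>)\<bar>"
      using assms(3) by (simp add: algebra_simps)
    also have "\<dots> = r * \<bar>d / r - \<tau>\<bar>" using assms(3) by (simp only: abs_mult abs_of_pos)
    finally have 1: "\<bar>d - (0 + r * \<tau>)\<bar> = r * \<bar>d / r - \<tau>\<bar>" .
    have k: "kern n s r (0 + r * \<tau>) = r powr (- (real n + 1 + s)) * gs n s \<tau>"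
      by (simp only: add_0 kern_scale[OF assms(3)])
    have "ennreal (kern n s r (0 + r * \<tau>)) * ennreal \<bar>d - (0 + r * \<tau>)\<bar> =
      ennreal (kern n s r (0 + r * \<tau>) * \<bar>d - (0 + r * \<tau>)\<bar>)"
      by (simp only: ennreal_mult' kern_nonneg)
    also have "kern n s r (0 + r * \<tau>) * \<bar>d - (0 + r * \<tau>)\<bar> =
      (r powr (- (real n + 1 + s)) * r) * (gs n s \<tau> * \<bar>d / r - \<tau>\<bar>)"
      unfolding 1 k by (simp only: mult_ac)
    also have "ennreal \<dots> = ennreal (r powr (- (real n + 1 + s)) * r) * ennreal (gs n s \<tau> * \<bar>d / r - \<tau>\<bar>)"
      using assms(3) by (intro ennreal_mult') simp
    finally show "ennreal (kern n s r (0 + r * \<tau>)) * ennreal \<bar>d - (0 + r * \<tau>)\<bar> = \<dots>" .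
  qed
  also have "(\<integral>\<^sup>+\<tau>. ennreal (r powr (- (real n + 1 + s)) * r) * ennreal (gs n s \<tau> * \<bar>d / r - \<tau>\<bar>) \<partial>lborel) =
      ennreal (r powr (- (real n + 1 + s)) * r) * ennreal (Phi n s (d / r))"
    unfolding Phi_def using gs_pos[of n s] integrable_gs_abs_diff[OF assms(1,2)]
    by (subst nn_integral_cmult, simp, subst nn_integral_eq_integral) (auto simp: less_imp_le)
  also have "ennreal \<bar>r\<bar> * \<dots> = ennreal (\<bar>r\<bar> * (r powr (- (real n + 1 + s)) * r * Phi n s (d / r)))"
    using assms(3) by (simp only: ennreal_mult' abs_ge_zero powr_ge_zero mult_nonneg_nonneg less_imp_le)
  also have "\<bar>r\<bar> * (r powr (- (real n + 1 + s)) * r * Phi n s (d / r)) = r powr (2 + (- (real n + 1 + s))) * Phi n s (d / r)"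
    using assms(3) by (subst powr_add) (simp add: power2_eq_square)
  also have "2 + (- (real n + 1 + s)) = - (real n - 1 + s)" by simp
  finally show ?thesis .
qed

section \<open>Integrals over pairs of points, sliced vertically\<close>

lemma measurable_borel_fst [measurable (raw)]:
  fixes f :: "'c \<Rightarrow> 'a::second_countable_topology \<times> 'b::second_countable_topology"
  shows "f \<in> borel_measurable M \<Longrightarrow> (\<lambda>x. fst (f x)) \<in> borel_measurable M"
  by (rule measurable_compose[OF _ borel_measurable_continuous_onI[OF continuous_on_fst[OF continuous_on_id]]])

lemma measurable_borel_snd [measurable (raw)]:
  fixes f :: "'c \<Rightarrow> 'a::second_countable_topology \<times> 'b::second_countable_topology"
  shows "f \<in> borel_measurable M \<Longrightarrow> (\<lambda>x. snd (f x)) \<in> borel_measurable M"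
  by (rule measurable_compose[OF _ borel_measurable_continuous_onI[OF continuous_on_snd[OF continuous_on_id]]])

lemma nn_integral_lborel_pair:
  fixes f :: "'a::euclidean_space \<times> 'b::euclidean_space \<Rightarrow> ennreal"
  assumes [measurable]: "f \<in> borel_measurable borel"
  shows "(\<integral>\<^sup>+z. f z \<partial>lborel) = (\<integral>\<^sup>+x. \<integral>\<^sup>+y. f (x, y) \<partial>lborel \<partial>lborel)"
proof -
  have "f \<in> borel_measurable (lborel \<Otimes>\<^sub>M lborel)" by (simp add: lborel_prod)
  then show ?thesis
    by (subst lborel_prod[symmetric]) (rule lborel.nn_integral_fst[symmetric])
qed

lemma nn_integral_lborel_pair_swap:
  fixes f :: "'a::euclidean_space \<Rightarrow> 'b::euclidean_space \<Rightarrow> ennreal"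
  assumes [measurable]: "(\<lambda>z. f (fst z) (snd z)) \<in> borel_measurable borel"
  shows "(\<integral>\<^sup>+x. \<integral>\<^sup>+y. f x y \<partial>lborel \<partial>lborel) = (\<integral>\<^sup>+y. \<integral>\<^sup>+x. f x y \<partial>lborel \<partial>lborel)"
proof -
  have "(\<lambda>z. f (fst z) (snd z)) \<in> borel_measurable (lborel \<Otimes>\<^sub>M lborel)" by (simp add: lborel_prod)
  then show ?thesis
    by (intro lborel_pair.Fubini'[symmetric]) (simp add: case_prod_beta')
qed

lemma measurable_nn_integral_lborel [measurable (raw)]:
  fixes f :: "'a \<Rightarrow> 'b::euclidean_space \<Rightarrow> ennreal"
  assumes "(\<lambda>z. f (fst z) (snd z)) \<in> borel_measurable (M \<Otimes>\<^sub>M borel)"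
  shows "(\<lambda>x. \<integral>\<^sup>+y. f x y \<partial>lborel) \<in> borel_measurable M"
proof -
  have "case_prod f \<in> borel_measurable (M \<Otimes>\<^sub>M lborel)"
    using assms by (simp add: case_prod_beta' cong: measurable_cong_sets)
  then show ?thesis by (rule lborel.borel_measurable_nn_integral)
qed

text \<open>
  Fubini with the vertical variables grouped as \<open>t\<close> and the shift \<open>\<sigma>\<close>. For a fixed pair of base
  points and a fixed shift, the inner integral compares the two fibers by a single length.
\<close>

lemma nn_integral_lborel_slices:
  fixes f :: "('a::euclidean_space \<times> real) \<times> ('a \<times> real) \<Rightarrow> ennreal"
  assumes [measurable]: "f \<in> borel_measurable borel"
  shows "(\<integral>\<^sup>+Z. f Z \<partial>lborel) =
    (\<integral>\<^sup>+p. \<integral>\<^sup>+\<sigma>. \<integral>\<^sup>+t. f ((fst p, t), (snd p, t - \<sigma>)) \<partial>lborel \<partial>lborel \<partial>lborel)"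
proof -
  have "(\<integral>\<^sup>+Z. f Z \<partial>lborel) = (\<integral>\<^sup>+x. \<integral>\<^sup>+t. \<integral>\<^sup>+y. \<integral>\<^sup>+\<tau>. f ((x, t), (y, \<tau>)) \<partial>lborel \<partial>lborel \<partial>lborel \<partial>lborel)"
    by (simp add: nn_integral_lborel_pair)
  also have "\<dots> = (\<integral>\<^sup>+x. \<integral>\<^sup>+y. \<integral>\<^sup>+t. \<integral>\<^sup>+\<tau>. f ((x, t), (y, \<tau>)) \<partial>lborel \<partial>lborel \<partial>lborel \<partial>lborel)"
    by (intro nn_integral_cong nn_integral_lborel_pair_swap) measurable
  also have "\<dots> = (\<integral>\<^sup>+x. \<integral>\<^sup>+y. \<integral>\<^sup>+t. \<integral>\<^sup>+\<sigma>. f ((x, t), (y, t - \<sigma>)) \<partial>lborel \<partial>lborel \<partial>lborel \<partial>lborel)"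
  proof (rule nn_integral_cong, rule nn_integral_cong, rule nn_integral_cong)
    fix x y :: 'a and t :: real
    have "(\<lambda>\<tau>. f ((x, t), (y, \<tau>))) \<in> borel_measurable borel"
      by (rule measurable_compose[OF _ assms]) (intro borel_measurable_Pair borel_measurable_const measurable_ident_sets refl)
    from nn_integral_real_affine[OF this, of "-1" t]
    show "(\<integral>\<^sup>+\<tau>. f ((x, t), (y, \<tau>)) \<partial>lborel) = (\<integral>\<^sup>+\<sigma>. f ((x, t), (y, t - \<sigma>)) \<partial>lborel)"
      by simp
  qed
  also have "\<dots> = (\<integral>\<^sup>+x. \<integral>\<^sup>+y. \<integral>\<^sup>+\<sigma>. \<integral>\<^sup>+t. f ((x, t), (y, t - \<sigma>)) \<partial>lborel \<partial>lborel \<partial>lborel \<partial>lborel)"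
    by (intro nn_integral_cong nn_integral_lborel_pair_swap) measurable
  also have "\<dots> = (\<integral>\<^sup>+p. \<integral>\<^sup>+\<sigma>. \<integral>\<^sup>+t. f ((fst p, t), (snd p, t - \<sigma>)) \<partial>lborel \<partial>lborel \<partial>lborel)"
  proof -
    have "continuous_on UNIV (\<lambda>w::(('a \<times> 'a) \<times> real) \<times> real.
        ((fst (fst (fst w)), snd w), (snd (fst (fst w)), snd w - snd (fst w))))"
      by (intro continuous_intros)
    then have "(\<lambda>w. f ((fst (fst (fst w)), snd w), (snd (fst (fst w)), snd w - snd (fst w)))) \<in> borel_measurable borel"
      by (rule measurable_compose[OF borel_measurable_continuous_onI assms])
    then have "(\<lambda>p. \<integral>\<^sup>+\<sigma>. \<integral>\<^sup>+t. f ((fst p, t), (snd p, t - \<sigma>)) \<partial>lborel \<partial>lborel) \<in> borel_measurable borel"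
      by (intro measurable_nn_integral_lborel) (simp add: borel_prod)
    then show ?thesis
      by (subst nn_integral_lborel_pair[of "\<lambda>p. \<integral>\<^sup>+\<sigma>. \<integral>\<^sup>+t. f ((fst p, t), (snd p, t - \<sigma>)) \<partial>lborel \<partial>lborel"])
         simp_all
  qed
  finally show ?thesis .
qed

text \<open>
  The length, in the height of the first point, of the set of those pairs in \<open>S\<close> that lie over the base
  points \<open>p\<close> and whose heights differ by \<open>\<sigma>\<close>. It is written as an integral so that joint measurability is automatic.
\<close>

definition sect :: "(('a \<times> real) \<times> ('a \<times> real)) set \<Rightarrow> 'a \<times> 'a \<Rightarrow> real \<Rightarrow> ennreal" where
  "sect S p \<sigma> = (\<integral>\<^sup>+t. indicator S ((fst p, t), (snd p, t - \<sigma>)) \<partial>lborel)"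

definition pkern :: "real \<Rightarrow> ('a::euclidean_space \<times> 'a) \<Rightarrow> real \<Rightarrow> ennreal" where
  "pkern s p \<sigma> = ennreal (kern DIM('a) s (norm (fst p - snd p)) \<sigma>)"

abbreviation kernel_integral :: "real \<Rightarrow> 'a::euclidean_space \<times> 'a \<Rightarrow> (real \<Rightarrow> ennreal) \<Rightarrow> ennreal" where
  "kernel_integral s p h \<equiv> (\<integral>\<^sup>+\<sigma>. pkern s p \<sigma> * h \<sigma> \<partial>lborel)"

lemma measurable_pkern [measurable (raw)]:
  assumes "f \<in> borel_measurable M" "g \<in> borel_measurable M"
  shows "(\<lambda>x. pkern s (f x) (g x)) \<in> borel_measurable M"
proof -
  have "(\<lambda>x. fst (f x) - snd (f x)) \<in> borel_measurable M"
    by (intro borel_measurable_diff measurable_borel_fst measurable_borel_snd assms)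
  then have "(\<lambda>x. norm (fst (f x) - snd (f x))) \<in> borel_measurable M" by measurable
  then show ?thesis
    unfolding pkern_def
    by (intro measurable_compose[OF _ measurable_ennreal] measurable_kern' assms)
qed

lemma measurable_sect [measurable (raw)]:
  assumes [measurable]: "S \<in> sets borel" "f \<in> borel_measurable M" "g \<in> borel_measurable M"
  shows "(\<lambda>x. sect S (f x :: 'a::euclidean_space \<times> 'a) (g x)) \<in> borel_measurable M"
  unfolding sect_def by measurable

lemma nn_integral_slices:
  fixes S :: "(('a::euclidean_space \<times> real) \<times> ('a \<times> real)) set"
  assumes [measurable]: "S \<in> sets borel"
  shows "(\<integral>\<^sup>+Z. indicator S Z * pkern s (fst (fst Z), fst (snd Z)) (snd (fst Z) - snd (snd Z)) \<partial>lborel)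
    = (\<integral>\<^sup>+p. \<integral>\<^sup>+\<sigma>. pkern s p \<sigma> * sect S p \<sigma> \<partial>lborel \<partial>lborel)"
  unfolding sect_def
  by (subst nn_integral_lborel_slices) (measurable, simp add: nn_integral_cmult mult.commute)

lemma kern_eq_norm:
  fixes X Y :: "'a::euclidean_space \<times> real"
  shows "1 / norm (X - Y) powr (real DIM('a \<times> real) + s) =
    kern DIM('a) s (norm (fst X - fst Y)) (snd X - snd Y)"
proof -
  let ?a = "(norm (fst X - fst Y))\<^sup>2 + (snd X - snd Y)\<^sup>2"
  have "norm (X - Y) = ?a powr (1 / 2)"
    by (simp add: norm_prod_def powr_half_sqrt)
  then have "norm (X - Y) powr (real DIM('a \<times> real) + s) = ?a powr ((1 / 2) * (real DIM('a) + 1 + s))"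
    by (simp add: powr_powr add_ac)
  also have "(1 / 2) * (real DIM('a) + 1 + s) = (real DIM('a) + 1 + s) / 2" by simp
  finally show ?thesis
    by (simp only: kern_def powr_minus divide_inverse mult_1)
qed

text \<open>
  The pairs that contribute to the perimeter of \<open>E\<close>.
\<close>

definition disagree :: "'a set \<Rightarrow> ('a \<times> 'a) set" where
  "disagree E = {Z. (fst Z \<in> E) \<noteq> (snd Z \<in> E)}"

lemma sets_disagree [measurable]:
  fixes E :: "'a::second_countable_topology set"
  assumes [measurable]: "E \<in> sets borel"
  shows "disagree E \<in> sets borel"
proof -
  have "disagree E = {Z \<in> space borel. (fst Z \<in> E) \<noteq> (snd Z \<in> E)}" by (simp add: disagree_def)
  also have "\<dots> \<in> sets borel" by measurable
  finally show ?thesis .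
qed

lemma sets_Qset [measurable]:
  fixes U :: "'a::second_countable_topology set"
  assumes [measurable]: "U \<in> sets borel"
  shows "Qset U \<in> sets borel"
proof -
  have "Qset U = {Z \<in> space borel. fst Z \<in> U \<or> snd Z \<in> U}" by (auto simp: Qset_def)
  also have "\<dots> \<in> sets borel" by measurable
  finally show ?thesis .
qed

lemma Per_eq_indicator:
  fixes E U :: "('a::euclidean_space \<times> real) set"
  shows "Per s E U = (\<integral>\<^sup>+Z. indicator (disagree E \<inter> Qset U) Z
      * pkern s (fst (fst Z), fst (snd Z)) (snd (fst Z) - snd (snd Z)) \<partial>lborel)"
  unfolding Per_def nn_integral_completion
proof (rule nn_integral_cong)
  fix Z :: "('a \<times> real) \<times> 'a \<times> real"
  have "ennreal (\<bar>indicat_real E (fst Z) - indicat_real E (snd Z)\<bar> /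
      norm (fst Z - snd Z) powr (real DIM('a \<times> real) + s))
    = indicator (disagree E) Z * ennreal (1 / norm (fst Z - snd Z) powr (real DIM('a \<times> real) + s))"
    by (auto simp: disagree_def indicator_def)
  then show "ennreal (\<bar>indicat_real E (fst Z) - indicat_real E (snd Z)\<bar> /
      norm (fst Z - snd Z) powr (real DIM('a \<times> real) + s)) * indicator (Qset U) Z
    = indicator (disagree E \<inter> Qset U) Z
      * pkern s (fst (fst Z), fst (snd Z)) (snd (fst Z) - snd (snd Z))"
    unfolding kern_eq_norm pkern_def by (auto simp: indicator_def)
qed

lemma Per_slices:
  fixes E U :: "('a::euclidean_space \<times> real) set"
  assumes "E \<in> sets borel" "U \<in> sets borel"
  shows "Per s E U = (\<integral>\<^sup>+p. kernel_integral s p (sect (disagree E \<inter> Qset U) p) \<partial>lborel)"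
  unfolding Per_eq_indicator using assms
  by (intro nn_integral_slices sets.Int sets_disagree sets_Qset)

lemma AE_lebesgue_pairD:
  fixes P :: "'a::euclidean_space \<times> 'b::euclidean_space \<Rightarrow> bool"
  assumes "AE z in lebesgue. P z"
  shows "AE x in lborel. AE y in lborel. P (x, y)"
proof -
  have "AE z in lborel \<Otimes>\<^sub>M lborel. P z"
    using assms[unfolded AE_completion_iff] by (simp only: lborel_prod)
  then show ?thesis by (rule lborel_pair.AE_pair)
qed

lemma null_sets_lborel_Times_UNIV:
  fixes N :: "'a::euclidean_space set"
  assumes "N \<in> null_sets lborel"
  shows "N \<times> (UNIV :: 'b::euclidean_space set) \<in> null_sets lborel"
    and "(UNIV :: 'b set) \<times> N \<in> null_sets lborel"
  using assms unfolding null_sets_def lborel_prod[symmetric]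
  by (auto simp: lborel.emeasure_pair_measure_Times)

lemma AE_lebesgue_fst_snd:
  assumes "AE x in lebesgue. P (x :: 'a::euclidean_space)"
  shows AE_lebesgue_fst: "AE z in (lebesgue :: ('a \<times> 'b::euclidean_space) measure). P (fst z)"
    and AE_lebesgue_snd: "AE z in (lebesgue :: ('b \<times> 'a) measure). P (snd z)"
proof -
  have "AE x in lborel. P x" using assms by (simp add: AE_completion_iff)
  then obtain N where N: "N \<in> null_sets lborel" "\<And>x. x \<notin> N \<Longrightarrow> P x"
    by (auto elim!: AE_E3)
  have "AE z in (lborel :: ('a \<times> 'b) measure). P (fst z)"
    using AE_not_in[OF null_sets_lborel_Times_UNIV(1)[OF N(1)]]
    by eventually_elim (auto intro: N(2))
  then show "AE z in (lebesgue :: ('a \<times> 'b) measure). P (fst z)" by (rule AE_completion)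
  have "AE z in (lborel :: ('b \<times> 'a) measure). P (snd z)"
    using AE_not_in[OF null_sets_lborel_Times_UNIV(2)[OF N(1)]]
    by eventually_elim (auto intro: N(2))
  then show "AE z in (lebesgue :: ('b \<times> 'a) measure). P (snd z)" by (rule AE_completion)
qed

lemma Per_cong_AE:
  assumes "ae_eq E F"
  shows "Per s E U = Per s F U"
proof -
  have "AE z in lebesgue. z \<in> E \<longleftrightarrow> z \<in> F" using assms by (simp add: ae_eq_def)
  from AE_lebesgue_fst[OF this] AE_lebesgue_snd[OF this] show ?thesis
    unfolding Per_def
    by (intro nn_integral_cong_AE) (auto elim!: eventually_elim2 simp: indicator_def)
qed

section \<open>Subsets of the line that are almost half-lines\<close>

lemma integrable_halfline_diff:
  "integrable lborel (\<lambda>t. indicat_real {..<a} t - indicat_real {..<b} t)"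
  "(LINT t|lborel. indicat_real {..<a} t - indicat_real {..<b} t) = a - b"
proof -
  have *: "(\<lambda>t. indicat_real {..<a} t - indicat_real {..<b} t)
      = (\<lambda>t. indicat_real {b..<a} t - indicat_real {a..<b} t)"
    by (auto simp: indicator_def)
  have i: "integrable lborel (indicat_real {c..<d})" for c d :: real
    by (cases "c \<le> d") (auto intro!: integrable_real_indicator)
  show "integrable lborel (\<lambda>t. indicat_real {..<a} t - indicat_real {..<b} t)"
    unfolding * by (intro Bochner_Integration.integrable_diff i)
  show "(LINT t|lborel. indicat_real {..<a} t - indicat_real {..<b} t) = a - b"
    unfolding * by (subst Bochner_Integration.integral_diff[OF i i], cases "b \<le> a") (simp_all add: measure_def)
qed

definition excess :: "real set \<Rightarrow> real \<Rightarrow> real" where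
  "excess P a = (LINT t|lborel. indicat_real P t - indicat_real {..<a} t)"

text \<open>
  The fibers of interest are unbounded below, so their length is measured relative to a half-line.
  Then \<open>a + excess P a\<close> is the end of the half-line with the same signed length as \<open>P\<close>; by
  the next lemma it does not depend on the reference point \<open>a\<close>.
\<close>

definition near_halfline :: "real set \<Rightarrow> real \<Rightarrow> bool" where
  "near_halfline P a \<longleftrightarrow> P \<in> sets borel \<and> integrable lborel (\<lambda>t. indicat_real P t - indicat_real {..<a} t)"

lemma near_halfline_move:
  assumes "near_halfline P a"
  shows "near_halfline P c" "c + excess P c = a + excess P a"
proof -
  have *: "(\<lambda>t. indicat_real P t - indicat_real {..<c} t) =
     (\<lambda>t. (indicat_real P t - indicat_real {..<a} t) + (indicat_real {..<a} t - indicat_real {..<c} t))"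
    by auto
  have i: "integrable lborel (\<lambda>t. indicat_real P t - indicat_real {..<a} t)"
    using assms by (simp add: near_halfline_def)
  have "integrable lborel (\<lambda>t. indicat_real P t - indicat_real {..<c} t)"
    by (subst *) (rule Bochner_Integration.integrable_add[OF i integrable_halfline_diff(1)])
  then show "near_halfline P c"
    using assms by (simp add: near_halfline_def)
  have "excess P c = excess P a + (a - c)"
    unfolding excess_def *
    by (subst Bochner_Integration.integral_add[OF i integrable_halfline_diff(1)])
       (simp only: integrable_halfline_diff(2))
  then show "c + excess P c = a + excess P a" by simp
qed

text \<open>
  The rearrangement inequality in one dimension: the length of a symmetric difference is at least the
  absolute value of the signed length, and the signed length of \<open>P\<close> minus the shifted \<open>Q\<close> is the
  difference of the ends of the equivalent half-lines.
\<close>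

lemma disagree_shift_lower:
  assumes P: "near_halfline P a" and Q: "near_halfline Q b"
  shows "ennreal \<bar>(a + excess P a) - (b + excess Q b) - \<sigma>\<bar> \<le> emeasure lborel {t. (t \<in> P) \<noteq> (t - \<sigma> \<in> Q)}"
proof -
  have P': "P \<in> sets borel" "integrable lborel (\<lambda>t. indicat_real P t - indicat_real {..<b + \<sigma>} t)"
    using near_halfline_move(1)[OF P, of "b + \<sigma>"] by (auto simp: near_halfline_def)
  have Q': "Q \<in> sets borel" "integrable lborel (\<lambda>t. indicat_real Q t - indicat_real {..<b} t)"
    using Q by (auto simp: near_halfline_def)
  have sh: "(\<lambda>t. indicat_real Q (- \<sigma> + 1 * t) - indicat_real {..<b} (- \<sigma> + 1 * t)) =
     (\<lambda>t. indicat_real Q (t - \<sigma>) - indicat_real {..<b + \<sigma>} t)"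
    by (auto simp: indicator_def fun_eq_iff algebra_simps)
  have Qs: "integrable lborel (\<lambda>t. indicat_real Q (t - \<sigma>) - indicat_real {..<b + \<sigma>} t)"
    using lborel_integrable_real_affine[OF Q'(2), of 1 "- \<sigma>"] unfolding sh by simp
  have "excess Q b = \<bar>1\<bar> *\<^sub>R (LINT t|lborel. indicat_real Q (- \<sigma> + 1 * t) - indicat_real {..<b} (- \<sigma> + 1 * t))"
    unfolding excess_def by (rule lborel_integral_real_affine) simp
  then have eQ: "excess Q b = (LINT t|lborel. indicat_real Q (t - \<sigma>) - indicat_real {..<b + \<sigma>} t)"
    unfolding sh by simp
  let ?h = "\<lambda>t. indicat_real P t - indicat_real Q (t - \<sigma>)"
  have h: "?h = (\<lambda>t. (indicat_real P t - indicat_real {..<b + \<sigma>} t) - (indicat_real Q (t - \<sigma>) - indicat_real {..<b + \<sigma>} t))"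
    by auto
  have "(LINT t|lborel. ?h t) = excess P (b + \<sigma>) - excess Q b"
    unfolding h eQ unfolding excess_def by (rule Bochner_Integration.integral_diff[OF P'(2) Qs])
  also have "\<dots> = (a + excess P a) - (b + excess Q b) - \<sigma>"
    using near_halfline_move(2)[OF P, of "b + \<sigma>"] by simp
  finally have "ennreal \<bar>(a + excess P a) - (b + excess Q b) - \<sigma>\<bar> = ennreal (norm (LINT t|lborel. ?h t))"
    by (simp only: real_norm_def)
  also have "\<dots> \<le> (\<integral>\<^sup>+t. ennreal (norm (?h t)) \<partial>lborel)"
    by (rule integral_norm_bound_ennreal) (simp only: h Bochner_Integration.integrable_diff[OF P'(2) Qs])
  also have "\<dots> = (\<integral>\<^sup>+t. indicator {t. (t \<in> P) \<noteq> (t - \<sigma> \<in> Q)} t \<partial>lborel)"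
    by (intro nn_integral_cong) (auto simp: indicator_def)
  also have "\<dots> = emeasure lborel {t. (t \<in> P) \<noteq> (t - \<sigma> \<in> Q)}"
  proof (rule nn_integral_indicator)
    have [measurable]: "P \<in> sets borel" "Q \<in> sets borel" by fact+
    have "{t \<in> space borel. (t \<in> P) \<noteq> (t - \<sigma> \<in> Q)} \<in> sets borel" by measurable
    then show "{t. (t \<in> P) \<noteq> (t - \<sigma> \<in> Q)} \<in> sets lborel" by simp
  qed
  finally show ?thesis .
qed

text \<open>
  The comparison of \<open>P\<close> with a half-line is reduced to arithmetic of two real numbers: the symmetric
  difference only sees their sum, the signed length only their difference.
\<close>

lemma halfline_excess_parts:
  assumes P: "near_halfline P a"
  obtains p q :: real where "p \<ge> 0" "q \<ge> 0"
    "emeasure lborel {t. c \<le> t \<and> t \<in> P} = ennreal p"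
    "emeasure lborel {t. t < c \<and> t \<notin> P} = ennreal q"
    "emeasure lborel {t. (t \<in> P) \<noteq> (t < c)} = ennreal (p + q)"
    "p - q = a + excess P a - c"
proof -
  have [measurable]: "P \<in> sets borel" and i: "integrable lborel (\<lambda>t. indicat_real P t - indicat_real {..<c} t)"
    using near_halfline_move(1)[OF P, of c] by (auto simp: near_halfline_def)
  let ?A = "{t. c \<le> t \<and> t \<in> P}" and ?B = "{t. t < c \<and> t \<notin> P}"
  have [measurable]: "?A \<in> sets borel" "?B \<in> sets borel"
  proof -
    have "{t \<in> space borel. c \<le> t \<and> t \<in> P} \<in> sets borel" by measurable
    then show "?A \<in> sets borel" by simp
    have "{t \<in> space borel. t < c \<and> t \<notin> P} \<in> sets borel" by measurable
    then show "?B \<in> sets borel" by simp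
  qed
  have "integrable lborel (\<lambda>t. \<bar>indicat_real P t - indicat_real {..<c} t\<bar>)"
    using i by (rule integrable_abs)
  then have iA: "integrable lborel (indicat_real ?A)" and iB: "integrable lborel (indicat_real ?B)"
    by (rule Bochner_Integration.integrable_bound; auto simp: indicator_def)+
  then have fin: "emeasure lborel ?A < \<infinity>" "emeasure lborel ?B < \<infinity>"
    by (simp_all add: integrable_indicator_iff)
  define p q where "p = measure lborel ?A" and "q = measure lborel ?B"
  have p: "emeasure lborel ?A = ennreal p" and q: "emeasure lborel ?B = ennreal q"
    using fin by (auto simp: p_def q_def emeasure_eq_ennreal_measure)
  have eq: "(\<lambda>t. indicat_real P t - indicat_real {..<c} t) = (\<lambda>t. indicat_real ?A t - indicat_real ?B t)"
    by (auto simp: indicator_def fun_eq_iff)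
  have "excess P c = p - q"
    unfolding excess_def eq by (subst Bochner_Integration.integral_diff[OF iA iB]) (simp add: p_def q_def)
  then have pq: "p - q = a + excess P a - c"
    using near_halfline_move(2)[OF P, of c] by simp
  have "{t. (t \<in> P) \<noteq> (t < c)} = ?A \<union> ?B" by auto
  moreover have "emeasure lborel (?A \<union> ?B) = emeasure lborel ?A + emeasure lborel ?B"
    by (rule plus_emeasure[symmetric]) auto
  ultimately have "emeasure lborel {t. (t \<in> P) \<noteq> (t < c)} = ennreal p + ennreal q"
    using p q by simp
  also have "\<dots> = ennreal (p + q)" by (simp add: p_def q_def)
  finally show thesis using p q pq by (intro that[of p q]) (auto simp: p_def q_def)
qed

lemma abs_convex_step:
  fixes z d \<theta> :: real
  assumes "0 \<le> \<theta>" "\<theta> \<le> 1"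
  shows "\<theta> * \<bar>z\<bar> + \<bar>z + \<theta> * d\<bar> \<le> \<theta> * \<bar>z + d\<bar> + \<bar>z\<bar>"
proof -
  have "z + \<theta> * d = (1 - \<theta>) * z + \<theta> * (z + d)" by (simp add: algebra_simps)
  then have "\<bar>z + \<theta> * d\<bar> \<le> \<bar>(1 - \<theta>) * z\<bar> + \<bar>\<theta> * (z + d)\<bar>" by (simp only: abs_triangle_ineq)
  also have "\<dots> = (1 - \<theta>) * \<bar>z\<bar> + \<theta> * \<bar>z + d\<bar>" using assms by (simp add: abs_mult)
  finally show ?thesis by (simp add: algebra_simps)
qed

text \<open>
  The rearrangement inequality when one of the sets is the half-line that ends at \<open>c\<close>, improved by
  the length of the part of \<open>P\<close> on the wrong side of \<open>c\<close>. If \<open>c\<close> is further than \<open>\<eta>\<close> from \<open>a\<close>,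
  then \<open>a\<close> and \<open>a + \<theta> * excess P a\<close> lie on the same side of \<open>c\<close>. There the absolute
  value is affine along the step, whereas the symmetric difference counts both one-sided
  discrepancies with positive sign; the difference is twice the discrepancy on the wrong side.
\<close>

lemma halfline_gain:
  assumes P: "near_halfline P a" and \<theta>: "0 < \<theta>" "\<theta> \<le> 1" and \<eta>: "\<theta> * \<bar>excess P a\<bar> \<le> \<eta>"
  shows "ennreal \<theta> * ennreal \<bar>a - c\<bar> + ennreal \<bar>a - c + \<theta> * excess P a\<bar>
      + ennreal \<theta> * emeasure lborel {t. (a + \<eta> < c \<and> c \<le> t \<and> t \<in> P) \<or> (c < a - \<eta> \<and> t < c \<and> t \<notin> P)}
    \<le> ennreal \<theta> * emeasure lborel {t. (t \<in> P) \<noteq> (t < c)} + ennreal \<bar>a - c\<bar>"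
proof -
  obtain p q where pq: "p \<ge> 0" "q \<ge> 0"
    "emeasure lborel {t. c \<le> t \<and> t \<in> P} = ennreal p"
    "emeasure lborel {t. t < c \<and> t \<notin> P} = ennreal q"
    "emeasure lborel {t. (t \<in> P) \<noteq> (t < c)} = ennreal (p + q)"
    "p - q = a + excess P a - c"
    by (rule halfline_excess_parts[OF P, of c])
  have \<eta>0: "0 \<le> \<eta>" using order_trans[OF mult_nonneg_nonneg[OF less_imp_le[OF \<theta>(1)] abs_ge_zero] \<eta>] .
  have th0: "0 \<le> \<theta>" using \<theta> by simp
  define d where "d = excess P a"
  have "\<bar>\<theta> * d\<bar> \<le> \<eta>" using \<eta> th0 by (simp add: d_def abs_mult)
  then have td: "\<theta> * d \<le> \<eta>" "- \<eta> \<le> \<theta> * d" by linarith+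
  define T where "T = (if a + \<eta> < c then p else if c < a - \<eta> then q else 0)"
  have T: "emeasure lborel {t. (a + \<eta> < c \<and> c \<le> t \<and> t \<in> P) \<or> (c < a - \<eta> \<and> t < c \<and> t \<notin> P)} = ennreal T"
    using pq \<eta>0 by (auto simp: T_def)
  have T0: "T \<ge> 0" using pq by (simp add: T_def)
  have main: "\<theta> * \<bar>a - c\<bar> + \<bar>a - c + \<theta> * d\<bar> + \<theta> * T \<le> \<theta> * (p + q) + \<bar>a - c\<bar>"
  proof -
    consider (up) "a + \<eta> < c" | (down) "c < a - \<eta>" | (mid) "\<not> a + \<eta> < c" "\<not> c < a - \<eta>" by blast
    then show ?thesis
    proof cases
      case up
      then have "\<bar>a - c\<bar> = c - a" "\<bar>a - c + \<theta> * d\<bar> = c - a - \<theta> * d" "T = p"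
        using td \<eta>0 by (auto simp: T_def)
      moreover have "\<theta> * (c - a - d) \<le> \<theta> * q"
        using \<theta> pq by (intro mult_left_mono) (auto simp: d_def)
      ultimately show ?thesis by (simp add: algebra_simps)
    next
      case down
      then have "\<bar>a - c\<bar> = a - c" "\<bar>a - c + \<theta> * d\<bar> = a - c + \<theta> * d" "T = q"
        using td \<eta>0 by (auto simp: T_def)
      moreover have "\<theta> * (a - c + d) \<le> \<theta> * p"
        using \<theta> pq by (intro mult_left_mono) (auto simp: d_def)
      ultimately show ?thesis by (simp add: algebra_simps)
    next
      case mid
      then have T: "T = 0" by (simp add: T_def)
      have "\<bar>a - c + d\<bar> \<le> p + q" using pq by (auto simp: d_def)
      then have "\<theta> * \<bar>a - c + d\<bar> \<le> \<theta> * (p + q)" using \<theta> by (intro mult_left_mono) auto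
      then show ?thesis using abs_convex_step[of \<theta> "a - c" d] \<theta> unfolding T mult_zero_right by linarith
    qed
  qed
  have "ennreal \<theta> * ennreal \<bar>a - c\<bar> + ennreal \<bar>a - c + \<theta> * d\<bar> + ennreal \<theta> * ennreal T
    = ennreal (\<theta> * \<bar>a - c\<bar> + \<bar>a - c + \<theta> * d\<bar> + \<theta> * T)"
    by (simp only: ennreal_plus ennreal_mult' add_nonneg_nonneg mult_nonneg_nonneg abs_ge_zero T0 th0)
  also have "\<dots> \<le> ennreal (\<theta> * (p + q) + \<bar>a - c\<bar>)" by (rule ennreal_leI[OF main])
  also have "\<dots> = ennreal \<theta> * ennreal (p + q) + ennreal \<bar>a - c\<bar>"
    by (subst ennreal_plus) (simp_all only: ennreal_mult' add_nonneg_nonneg mult_nonneg_nonneg abs_ge_zero pq(1,2) th0)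
  finally show ?thesis unfolding T pq(5) d_def .
qed

lemma emeasure_disagree_halflines:
  "emeasure lborel {t. (t < a) \<noteq> (t - \<sigma> < b)} = ennreal \<bar>a - b - \<sigma>\<bar>" for a b \<sigma> :: real
proof (cases "a \<le> b + \<sigma>")
  case True
  then have "{t. (t < a) \<noteq> (t - \<sigma> < b)} = {a..<b + \<sigma>}" by auto
  then show ?thesis using True by simp
next
  case False
  then have "{t. (t < a) \<noteq> (t - \<sigma> < b)} = {b + \<sigma>..<a}" by auto
  then show ?thesis using False by (simp add: algebra_simps)
qed

section \<open>The slice inequality\<close>

abbreviation fiber :: "('a \<times> real) set \<Rightarrow> 'a \<Rightarrow> real set" where
  "fiber F x \<equiv> {t. (x, t) \<in> F}"

lemma sets_fiber [measurable]:
  fixes F :: "('a::euclidean_space \<times> real) set"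
  assumes [measurable]: "F \<in> sets borel"
  shows "fiber F x \<in> sets borel"
proof -
  have "{t \<in> space borel. (x, t) \<in> F} \<in> sets borel" by measurable
  then show ?thesis by simp
qed

lemma sets_subgraph [measurable]:
  fixes u :: "'a::euclidean_space \<Rightarrow> real"
  assumes [measurable]: "u \<in> borel_measurable borel"
  shows "subgraph u UNIV \<in> sets borel"
proof -
  have "subgraph u UNIV = {z \<in> space borel. snd z < u (fst z)}" by (auto simp: subgraph_def)
  also have "\<dots> \<in> sets borel" by measurable
  finally show ?thesis .
qed

lemma sets_cylinder [measurable]:
  fixes \<Omega> :: "'a::euclidean_space set"
  shows "open \<Omega> \<Longrightarrow> cylinder \<Omega> M \<in> sets borel"
  unfolding cylinder_def by (intro borel_open open_Times) auto

lemma sect_eq_emeasure: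
  fixes S :: "(('a::euclidean_space \<times> real) \<times> 'a \<times> real) set"
  assumes [measurable]: "S \<in> sets borel"
  shows "{t. ((x, t), (y, t - \<sigma>)) \<in> S} \<in> sets borel"
    and "sect S (x, y) \<sigma> = emeasure lborel {t. ((x, t), (y, t - \<sigma>)) \<in> S}"
proof -
  have "{t \<in> space borel. ((x, t), (y, t - \<sigma>)) \<in> S} \<in> sets borel" by measurable
  then show *: "{t. ((x, t), (y, t - \<sigma>)) \<in> S} \<in> sets borel" by simp
  have "sect S (x, y) \<sigma> = (\<integral>\<^sup>+t. indicator {t. ((x, t), (y, t - \<sigma>)) \<in> S} t \<partial>lborel)"
    unfolding sect_def by (intro nn_integral_cong) (simp add: indicator_def)
  then show "sect S (x, y) \<sigma> = emeasure lborel {t. ((x, t), (y, t - \<sigma>)) \<in> S}"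
    using * by (simp only: nn_integral_indicator sets_lborel)
qed

lemma sect_disagree_subgraph:
  fixes u :: "'a::euclidean_space \<Rightarrow> real"
  assumes "u \<in> borel_measurable borel"
  shows "sect (disagree (subgraph u UNIV)) (x, y) \<sigma> = ennreal \<bar>u x - u y - \<sigma>\<bar>"
proof -
  have "sect (disagree (subgraph u UNIV)) (x, y) \<sigma> =
      emeasure lborel {t. ((x, t), (y, t - \<sigma>)) \<in> disagree (subgraph u UNIV)}"
    by (rule sect_eq_emeasure(2)[OF sets_disagree[OF sets_subgraph[OF assms]]])
  also have "{t. ((x, t), (y, t - \<sigma>)) \<in> disagree (subgraph u UNIV)} = {t. (t < u x) \<noteq> (t - \<sigma> < u y)}"
    by (simp add: disagree_def subgraph_def)
  also have "emeasure lborel \<dots> = ennreal \<bar>u x - u y - \<sigma>\<bar>"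
    by (rule emeasure_disagree_halflines)
  finally show ?thesis .
qed

text \<open>
  What distinguishes the fiber from the half-line that ends at \<open>u x\<close>, as seen from the level \<open>c\<close>.
  Levels within \<open>\<eta>\<close> of \<open>u x\<close> are left out, because a small displacement of \<open>u x\<close> towards the
  rearrangement of the fiber may cross them.
\<close>

definition wrong_side ::
  "('a \<Rightarrow> real) \<Rightarrow> ('a \<times> real) set \<Rightarrow> real \<Rightarrow> 'a \<Rightarrow> real \<Rightarrow> real set" where
  "wrong_side u F \<eta> x c =
    {t. (u x + \<eta> < c \<and> c \<le> t \<and> (x, t) \<in> F) \<or> (c < u x - \<eta> \<and> t < c \<and> (x, t) \<notin> F)}"

lemma sets_wrong_side:
  fixes E :: "('a::euclidean_space \<times> real) set"
  assumes "E \<in> sets borel"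
  shows "wrong_side u E \<eta> x c \<in> sets borel"
proof -
  have "wrong_side u E \<eta> x c = (if u x + \<eta> < c then {c..} \<inter> fiber E x else {})
      \<union> (if c < u x - \<eta> then {..<c} - fiber E x else {})"
    by (auto simp: wrong_side_def)
  then show ?thesis using sets_fiber[OF assms, of x] by (auto simp del: mem_Collect_eq)
qed

text \<open>
  Only pairs with \<open>x\<close> in \<open>\<Omega>\<close> and \<open>y\<close> outside count. For those the fiber over \<open>y\<close> is the
  half-line that ends at \<open>u y\<close>, so that the shift by \<open>\<sigma>\<close> sweeps all levels.
\<close>

definition gain :: "'a set \<Rightarrow> ('a \<Rightarrow> real) \<Rightarrow> ('a \<times> real) set \<Rightarrow> real \<Rightarrow> 'a \<times> 'a \<Rightarrow> real \<Rightarrow> ennreal" where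
  "gain \<Omega> u F \<eta> p \<sigma> = (if fst p \<in> \<Omega> \<and> snd p \<notin> \<Omega>
     then emeasure lborel (wrong_side u F \<eta> (fst p) (u (snd p) + \<sigma>)) else 0)"

lemma
  fixes u :: "'a::euclidean_space \<Rightarrow> real"
  assumes u: "u \<in> borel_measurable borel" and F: "F \<in> sets borel"
    and FUs: "F - cylinder \<Omega> M = subgraph u UNIV - cylinder \<Omega> M" and M: "0 \<le> M"
  shows fiber_near_halfline: "near_halfline (fiber F x) (u x)"
    and abs_excess_fiber_le: "\<bar>excess (fiber F x) (u x)\<bar> \<le> 2 * M"
    and excess_fiber_outside: "x \<notin> \<Omega> \<Longrightarrow> excess (fiber F x) (u x) = 0"
proof -
  have FU: "z \<notin> cylinder \<Omega> M \<Longrightarrow> z \<in> F \<longleftrightarrow> z \<in> subgraph u UNIV" for z using FUs by blast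
  let ?h = "\<lambda>t. indicat_real (fiber F x) t - indicat_real {..<u x} t"
  have [measurable]: "fiber F x \<in> sets borel" by (rule sets_fiber[OF F])
  have bd: "norm (?h t) \<le> indicat_real {-M<..<M} t" for t
    using FU[of "(x, t)"] by (auto simp: cylinder_def subgraph_def indicator_def)
  have iM: "integrable lborel (indicat_real {-M<..<M})" using M by (auto intro!: integrable_real_indicator)
  have i: "integrable lborel ?h"
    by (rule Bochner_Integration.integrable_bound[OF iM]) (use bd in \<open>auto intro!: AE_I2\<close>)
  then show "near_halfline (fiber F x) (u x)" by (simp add: near_halfline_def)
  have "\<bar>LINT t|lborel. ?h t\<bar> \<le> (LINT t|lborel. norm (?h t))"
    using integral_norm_bound[of lborel ?h] by (simp only: real_norm_def)
  also have "\<dots> \<le> (LINT t|lborel. indicat_real {-M<..<M} t)"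
    using bd by (intro integral_mono integrable_norm i iM) auto
  also have "\<dots> = 2 * M" using M by (simp add: measure_def)
  finally show "\<bar>excess (fiber F x) (u x)\<bar> \<le> 2 * M" unfolding excess_def .
  assume "x \<notin> \<Omega>"
  then have "?h = (\<lambda>t. 0)"
    using FU by (auto simp: cylinder_def subgraph_def indicator_def fun_eq_iff)
  then show "excess (fiber F x) (u x) = 0" unfolding excess_def by simp
qed

lemma sect_split:
  fixes S T :: "(('a::euclidean_space \<times> real) \<times> 'a \<times> real) set"
  assumes "S \<in> sets borel" "T \<in> sets borel"
  shows "sect S p \<sigma> = sect (S \<inter> T) p \<sigma> + sect (S - T) p \<sigma>"
proof (cases p)
  case (Pair x y)
  have m: "S \<inter> T \<in> sets borel" "S - T \<in> sets borel" using assms by auto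
  have "{t. ((x, t), (y, t - \<sigma>)) \<in> S} = {t. ((x, t), (y, t - \<sigma>)) \<in> S \<inter> T} \<union> {t. ((x, t), (y, t - \<sigma>)) \<in> S - T}"
    by auto
  moreover have "emeasure lborel ({t. ((x, t), (y, t - \<sigma>)) \<in> S \<inter> T} \<union> {t. ((x, t), (y, t - \<sigma>)) \<in> S - T}) =
    emeasure lborel {t. ((x, t), (y, t - \<sigma>)) \<in> S \<inter> T} + emeasure lborel {t. ((x, t), (y, t - \<sigma>)) \<in> S - T}"
    by (rule plus_emeasure[symmetric]) (use sect_eq_emeasure(1)[OF m(1)] sect_eq_emeasure(1)[OF m(2)] in auto)
  ultimately show ?thesis
    unfolding Pair sect_eq_emeasure(2)[OF assms(1)] sect_eq_emeasure(2)[OF m(1)] sect_eq_emeasure(2)[OF m(2)]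
    by simp
qed

text \<open>
  The inequality is first shown for the full symmetric differences: by \<open>halfline_gain\<close> for pairs that
  leave \<open>\<Omega>\<close>, and by \<open>disagree_shift_lower\<close> and convexity otherwise. The pairs with both points
  outside the cylinder contribute the same finite length for \<open>F\<close> and for the subgraph, and
  cancel. Multiplying by \<open>\<theta>\<close> instead of dividing keeps all terms nonnegative.
\<close>

lemma slice_inequality:
  fixes u :: "'a::euclidean_space \<Rightarrow> real" and \<Omega> :: "'a set"
  defines "U \<equiv> subgraph u UNIV"
  assumes \<Omega>: "open \<Omega>" and u: "u \<in> borel_measurable borel" and F: "F \<in> sets borel"
    and FUs: "F - cylinder \<Omega> M = U - cylinder \<Omega> M" and M: "0 \<le> M"
    and \<theta>: "0 < \<theta>" "\<theta> \<le> 1" "\<theta> * (2 * M) \<le> \<eta>"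
  shows "ennreal \<theta> * sect (disagree U \<inter> Qset (cylinder \<Omega> M)) (x, y) \<sigma>
      + ennreal \<bar>(u x + \<theta> * excess (fiber F x) (u x)) - (u y + \<theta> * excess (fiber F y) (u y)) - \<sigma>\<bar>
      + ennreal \<theta> * gain \<Omega> u F \<eta> (x, y) \<sigma>
    \<le> ennreal \<theta> * sect (disagree F \<inter> Qset (cylinder \<Omega> M)) (x, y) \<sigma> + ennreal \<bar>u x - u y - \<sigma>\<bar>"
proof -
  have U: "U \<in> sets borel" unfolding U_def by (rule sets_subgraph[OF u])
  let ?Q = "Qset (cylinder \<Omega> M)"
  have Q: "?Q \<in> sets borel" by (intro sets_Qset sets_cylinder \<Omega>)
  have FU: "z \<notin> cylinder \<Omega> M \<Longrightarrow> z \<in> F \<longleftrightarrow> z \<in> U" for z using FUs by blast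
  note FU' = FUs[unfolded U_def]
  note nh = fiber_near_halfline[OF u F FU' M] and ab = abs_excess_fiber_le[OF u F FU' M]
    and out = excess_fiber_outside[OF u F FU' M]
  let ?d = "\<lambda>x. excess (fiber F x) (u x)"
  define z where "z = u x - u y - \<sigma>"
  define D where "D = ?d x - ?d y"
  \<comment> \<open>The common contribution of the pairs with both points outside the cylinder.\<close>
  define W where "W = sect (disagree U - ?Q) (x, y) \<sigma>"
  have off: "disagree F - ?Q = disagree U - ?Q"
    using FU by (auto simp: disagree_def Qset_def)
  have Fs: "sect (disagree F) (x, y) \<sigma> = sect (disagree F \<inter> ?Q) (x, y) \<sigma> + W"
    using sect_split[OF sets_disagree[OF F] Q] by (simp add: W_def off)
  have Us: "sect (disagree U) (x, y) \<sigma> = sect (disagree U \<inter> ?Q) (x, y) \<sigma> + W"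
    using sect_split[OF sets_disagree[OF U] Q] by (simp add: W_def)
  have Uz: "sect (disagree U) (x, y) \<sigma> = ennreal \<bar>z\<bar>"
    unfolding U_def z_def by (rule sect_disagree_subgraph[OF u])
  have Wfin: "W < \<infinity>"
    using Us Uz by (metis ennreal_add_eq_top ennreal_less_top infinity_ennreal_def less_top)
  have main: "ennreal \<theta> * ennreal \<bar>z\<bar> + ennreal \<bar>z + \<theta> * D\<bar> + ennreal \<theta> * gain \<Omega> u F \<eta> (x, y) \<sigma>
      \<le> ennreal \<theta> * sect (disagree F) (x, y) \<sigma> + ennreal \<bar>z\<bar>"
  proof (cases "x \<in> \<Omega> \<and> y \<notin> \<Omega>")
    case True
    have ty: "(y, t) \<in> F \<longleftrightarrow> t < u y" for t
      using FU[of "(y, t)"] True by (simp add: cylinder_def U_def subgraph_def)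
    have "sect (disagree F) (x, y) \<sigma> = emeasure lborel {t. (t \<in> fiber F x) \<noteq> (t < u y + \<sigma>)}"
      by (subst sect_eq_emeasure(2)[OF sets_disagree[OF F]]) (simp add: disagree_def ty algebra_simps)
    moreover have "gain \<Omega> u F \<eta> (x, y) \<sigma> = emeasure lborel {t. (u x + \<eta> < u y + \<sigma> \<and> u y + \<sigma> \<le> t \<and> t \<in> fiber F x)
        \<or> (u y + \<sigma> < u x - \<eta> \<and> t < u y + \<sigma> \<and> t \<notin> fiber F x)}"
      using True by (simp add: gain_def wrong_side_def)
    moreover have "\<theta> * \<bar>?d x\<bar> \<le> \<eta>"
      using mult_left_mono[OF ab[where x = x], of \<theta>] \<theta> by linarith
    moreover have "z = u x - (u y + \<sigma>)" "D = ?d x"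
      using out[where x = y] True by (simp_all add: z_def D_def)
    ultimately show ?thesis
      using halfline_gain[OF nh[where x = x] \<theta>(1,2), of \<eta> "u y + \<sigma>"] by simp
  next
    case False
    then have g: "gain \<Omega> u F \<eta> (x, y) \<sigma> = 0" by (auto simp: gain_def)
    have "ennreal \<bar>z + D\<bar> \<le> sect (disagree F) (x, y) \<sigma>"
      using disagree_shift_lower[OF nh[where x = x] nh[where x = y], of \<sigma>]
      by (subst sect_eq_emeasure(2)[OF sets_disagree[OF F]]) (simp add: disagree_def z_def D_def algebra_simps)
    then have "ennreal \<theta> * ennreal \<bar>z + D\<bar> + ennreal \<bar>z\<bar> \<le> ennreal \<theta> * sect (disagree F) (x, y) \<sigma> + ennreal \<bar>z\<bar>"
      by (intro add_right_mono mult_left_mono) auto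
    moreover have "ennreal \<theta> * ennreal \<bar>z\<bar> + ennreal \<bar>z + \<theta> * D\<bar> \<le> ennreal \<theta> * ennreal \<bar>z + D\<bar> + ennreal \<bar>z\<bar>"
    proof -
      have th0: "0 \<le> \<theta>" using \<theta> by simp
      have "ennreal (\<theta> * \<bar>z\<bar> + \<bar>z + \<theta> * D\<bar>) \<le> ennreal (\<theta> * \<bar>z + D\<bar> + \<bar>z\<bar>)"
        by (intro ennreal_leI abs_convex_step) (use \<theta> in auto)
      then show ?thesis
        by (simp only: ennreal_plus ennreal_mult' mult_nonneg_nonneg abs_ge_zero th0)
    qed
    ultimately show ?thesis unfolding g mult_zero_right add_0_right by (rule order_trans[rotated])
  qed
  have eq: "(u x + \<theta> * ?d x) - (u y + \<theta> * ?d y) - \<sigma> = z + \<theta> * D"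
    by (simp add: z_def D_def algebra_simps)
  let ?a = "ennreal \<theta> * sect (disagree U \<inter> ?Q) (x, y) \<sigma>" and ?b = "ennreal \<theta> * sect (disagree F \<inter> ?Q) (x, y) \<sigma>"
  have "ennreal \<theta> * W + (?a + ennreal \<bar>z + \<theta> * D\<bar> + ennreal \<theta> * gain \<Omega> u F \<eta> (x, y) \<sigma>)
     \<le> ennreal \<theta> * W + (?b + ennreal \<bar>z\<bar>)"
    using main unfolding Uz[symmetric] Fs unfolding Us by (simp only: distrib_left ac_simps)
  then show ?thesis
    unfolding eq z_def[symmetric] using Wfin
    by (subst (asm) ennreal_add_left_cancel_le) (auto simp: ennreal_mult_eq_top_iff)
qed

section \<open>Integration of the slice inequality\<close>

text \<open>
  A comparison of possibly infinite integrals when only the difference \<open>e = q - p\<close> of the correction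
  terms is integrable. The energies themselves may be infinite because of the interaction of
  \<open>\<Omega>\<close> with far points, where the exterior datum may grow.
\<close>

lemma nn_integral_le_by_energy:
  fixes f g :: "'a \<Rightarrow> ennreal" and e p q :: "'a \<Rightarrow> real"
  assumes [measurable]: "f \<in> borel_measurable M" "g \<in> borel_measurable M"
    and e: "integrable M e" "(LINT x|M. e x) \<le> 0"
    and le: "AE x in M. 0 \<le> p x \<and> 0 \<le> q x \<and> g x + ennreal (p x) \<le> f x + ennreal (q x) \<and> q x - p x = e x"
  shows "(\<integral>\<^sup>+x. g x \<partial>M) \<le> (\<integral>\<^sup>+x. f x \<partial>M)"
proof -
  have [measurable]: "e \<in> borel_measurable M" using e by auto
  have "AE x in M. g x + ennreal (- e x) \<le> f x + ennreal (e x)"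
    using le
  proof eventually_elim
    case (elim x)
    show ?case
    proof (cases "p x \<le> q x")
      case True
      have "ennreal (q x) = ennreal (e x) + ennreal (p x)"
      proof -
        have "q x = e x + p x" "0 \<le> e x" "0 \<le> p x" using elim True by linarith+
        then show ?thesis by (simp only: ennreal_plus)
      qed
      moreover have "ennreal (- e x) = 0" using elim True by (intro ennreal_neg) auto
      ultimately have "ennreal (p x) + (g x + ennreal (- e x)) \<le> ennreal (p x) + (f x + ennreal (e x))"
        using elim by (simp add: ac_simps)
      then show ?thesis by (subst (asm) ennreal_add_left_cancel_le) auto
    next
      case False
      have "ennreal (p x) = ennreal (- e x) + ennreal (q x)"
      proof -
        have "p x = - e x + q x" "0 \<le> - e x" "0 \<le> q x" using elim False by linarith+
        then show ?thesis by (simp only: ennreal_plus)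
      qed
      moreover have "ennreal (e x) = 0" using elim False by (intro ennreal_neg) auto
      ultimately have "ennreal (q x) + (g x + ennreal (- e x)) \<le> ennreal (q x) + (f x + ennreal (e x))"
        using elim by (simp add: ac_simps)
      then show ?thesis by (subst (asm) ennreal_add_left_cancel_le) auto
    qed
  qed
  then have "(\<integral>\<^sup>+x. g x + ennreal (- e x) \<partial>M) \<le> (\<integral>\<^sup>+x. f x + ennreal (e x) \<partial>M)"
    by (rule nn_integral_mono_AE)
  then have *: "(\<integral>\<^sup>+x. g x \<partial>M) + (\<integral>\<^sup>+x. ennreal (- e x) \<partial>M) \<le> (\<integral>\<^sup>+x. f x \<partial>M) + (\<integral>\<^sup>+x. ennreal (e x) \<partial>M)"
    by (simp add: nn_integral_add)
  have fin: "(\<integral>\<^sup>+x. ennreal (e x) \<partial>M) \<noteq> \<infinity>" "(\<integral>\<^sup>+x. ennreal (- e x) \<partial>M) \<noteq> \<infinity>"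
    using e(1) by (auto simp: real_integrable_def)
  have "enn2real (\<integral>\<^sup>+x. ennreal (e x) \<partial>M) \<le> enn2real (\<integral>\<^sup>+x. ennreal (- e x) \<partial>M)"
    using e by (simp add: real_lebesgue_integral_def)
  then have le2: "(\<integral>\<^sup>+x. ennreal (e x) \<partial>M) \<le> (\<integral>\<^sup>+x. ennreal (- e x) \<partial>M)"
    using fin by (metis enn2real_le ennreal_enn2real_if infinity_ennreal_def enn2real_nonneg ennreal_enn2real less_top)
  have "(\<integral>\<^sup>+x. ennreal (- e x) \<partial>M) + (\<integral>\<^sup>+x. g x \<partial>M) \<le> (\<integral>\<^sup>+x. ennreal (- e x) \<partial>M) + (\<integral>\<^sup>+x. f x \<partial>M)"
    using order_trans[OF * add_left_mono[OF le2]] by (simp add: add.commute)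
  then show ?thesis
    using fin by (subst (asm) ennreal_add_left_cancel_le) auto
qed

lemma AE_lborel_pair_neq: "AE p in (lborel :: ('a::euclidean_space \<times> 'a) measure). fst p \<noteq> snd p"
proof -
  have d: "{p :: 'a \<times> 'a. fst p = snd p} \<in> sets borel"
    by (intro borel_closed closed_Collect_eq continuous_intros)
  have "(\<integral>\<^sup>+p. indicator {p :: 'a \<times> 'a. fst p = snd p} p \<partial>lborel) =
      (\<integral>\<^sup>+x. \<integral>\<^sup>+y. indicator {p :: 'a \<times> 'a. fst p = snd p} (x, y) \<partial>lborel \<partial>lborel)"
    using d by (intro nn_integral_lborel_pair) auto
  also have "\<dots> = (\<integral>\<^sup>+x. \<integral>\<^sup>+y. indicator {x} (y::'a) \<partial>lborel \<partial>lborel)"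
    by (intro nn_integral_cong) (auto simp: indicator_def)
  also have "\<dots> = 0" by simp
  finally have "emeasure lborel {p :: 'a \<times> 'a. fst p = snd p} = 0" using d by simp
  then have "{p :: 'a \<times> 'a. fst p = snd p} \<in> null_sets lborel" using d by (simp add: null_sets_def)
  then have "AE p in lborel. p \<notin> {p :: 'a \<times> 'a. fst p = snd p}" by (rule AE_not_in)
  then show ?thesis by simp
qed

lemma nn_integral_lborel_translate:
  fixes h :: "'a::euclidean_space \<Rightarrow> ennreal"
  assumes h: "h \<in> borel_measurable borel"
  shows "(\<integral>\<^sup>+y. h (x - y) \<partial>lborel) = (\<integral>\<^sup>+z. h (- z) \<partial>lborel)"
proof -
  have m: "(\<lambda>z. h (- z)) \<in> borel_measurable borel"
    by (rule measurable_compose[OF borel_measurable_continuous_onI h]) (intro continuous_intros)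
  have "(\<integral>\<^sup>+z. h (- z) \<partial>lborel) = (\<integral>\<^sup>+z. h (- z) \<partial>distr lborel borel ((+) (- x)))"
    by (simp only: lborel_distr_plus)
  also have "\<dots> = (\<integral>\<^sup>+y. h (- ((- x) + y)) \<partial>lborel)"
    using m by (subst nn_integral_distr) auto
  also have "(\<lambda>y. h (- ((- x) + y))) = (\<lambda>y. h (x - y))" by auto
  finally show ?thesis by simp
qed

lemma nn_integral_pairs_difference:
  fixes h :: "'a::euclidean_space \<Rightarrow> ennreal"
  assumes h: "h \<in> borel_measurable borel" and \<Omega>: "\<Omega> \<in> sets borel"
  shows "(\<integral>\<^sup>+p. indicator \<Omega> (fst p) * h (fst p - snd p) \<partial>lborel) = emeasure lborel \<Omega> * (\<integral>\<^sup>+z. h (- z) \<partial>lborel)"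
proof -
  have hd: "(\<lambda>p :: 'a \<times> 'a. h (fst p - snd p)) \<in> borel_measurable borel"
    by (rule measurable_compose[OF _ h]) (intro borel_measurable_continuous_onI continuous_intros)
  have hx: "(\<lambda>y. h (x - y)) \<in> borel_measurable lborel" for x
    using measurable_compose[OF _ h, of "\<lambda>y. x - y" borel] by simp
  have "(\<lambda>p :: 'a \<times> 'a. indicator \<Omega> (fst p) :: ennreal) \<in> borel_measurable borel"
    using \<Omega> by measurable
  from borel_measurable_times_ennreal[OF this hd]
  have "(\<integral>\<^sup>+p. indicator \<Omega> (fst p) * h (fst p - snd p) \<partial>lborel)
      = (\<integral>\<^sup>+x. \<integral>\<^sup>+y. indicator \<Omega> x * h (x - y) \<partial>lborel \<partial>lborel)"
    by (subst nn_integral_lborel_pair) simp_all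
  also have "\<dots> = (\<integral>\<^sup>+x. indicator \<Omega> x * (\<integral>\<^sup>+z. h (- z) \<partial>lborel) \<partial>lborel)"
    by (simp only: nn_integral_cmult[OF hx] nn_integral_lborel_translate[OF h])
  also have "\<dots> = emeasure lborel \<Omega> * (\<integral>\<^sup>+z. h (- z) \<partial>lborel)"
    using \<Omega> by (subst nn_integral_multc) simp_all
  finally show ?thesis .
qed

lemma nn_integral_near_pairs:
  fixes \<Omega> :: "'a::euclidean_space set"
  assumes \<Omega>: "\<Omega> \<in> sets borel" "bounded \<Omega>" and a: "0 \<le> a" "a < real DIM('a)"
  shows "(\<integral>\<^sup>+p. indicator (\<Omega> \<times> \<Omega>) p * ennreal (norm (fst p - snd p) powr (- a)) \<partial>lborel) < \<infinity>"
proof -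
  obtain B where B: "B > 0" "\<And>x. x \<in> \<Omega> \<Longrightarrow> norm x \<le> B"
    using \<Omega>(2) by (auto simp: bounded_pos)
  let ?h = "\<lambda>z::'a. ennreal (norm z powr (- a)) * indicator {z. norm z \<le> 2 * B} z"
  have hm: "?h \<in> borel_measurable borel" by measurable
  have "(\<integral>\<^sup>+p. indicator (\<Omega> \<times> \<Omega>) p * ennreal (norm (fst p - snd p) powr (- a)) \<partial>lborel)
      \<le> (\<integral>\<^sup>+p. indicator \<Omega> (fst p) * ?h (fst p - snd p) \<partial>lborel)"
  proof (rule nn_integral_mono)
    fix p :: "'a \<times> 'a"
    have "norm (fst p - snd p) \<le> 2 * B" if "fst p \<in> \<Omega>" "snd p \<in> \<Omega>"
      using norm_triangle_ineq4[of "fst p" "snd p"] B(2)[OF that(1)] B(2)[OF that(2)] by linarith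
    then show "indicator (\<Omega> \<times> \<Omega>) p * ennreal (norm (fst p - snd p) powr (- a)) \<le> indicator \<Omega> (fst p) * ?h (fst p - snd p)"
      by (cases p) (auto simp: indicator_def)
  qed
  also have "\<dots> = emeasure lborel \<Omega> * (\<integral>\<^sup>+z. ?h (- z) \<partial>lborel)"
    by (rule nn_integral_pairs_difference[OF hm \<Omega>(1)])
  also have "\<dots> < \<infinity>"
    using nn_integral_norm_powr_near[OF a, of "2 * B"] B emeasure_bounded_finite[OF \<Omega>(2)]
    by (simp add: ennreal_mult_less_top indicator_def)
  finally show ?thesis .
qed

lemma nn_integral_far_pairs:
  fixes \<Omega> :: "'a::euclidean_space set"
  assumes \<Omega>: "\<Omega> \<in> sets borel" "bounded \<Omega>" and a: "a > real DIM('a)"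
  shows "(\<integral>\<^sup>+p. indicator {p. fst p \<in> \<Omega> \<and> 1 \<le> norm (fst p - snd p)} p
     * ennreal (norm (fst p - snd p) powr (- a)) \<partial>lborel) < \<infinity>"
proof -
  let ?h = "\<lambda>z::'a. ennreal (norm z powr (- a)) * indicator {z. 1 \<le> norm z} z"
  have hm: "?h \<in> borel_measurable borel" by measurable
  have "(\<integral>\<^sup>+p. indicator {p. fst p \<in> \<Omega> \<and> 1 \<le> norm (fst p - snd p)} p
     * ennreal (norm (fst p - snd p) powr (- a)) \<partial>lborel) = (\<integral>\<^sup>+p. indicator \<Omega> (fst p) * ?h (fst p - snd p) \<partial>lborel)"
    by (intro nn_integral_cong) (auto simp: indicator_def)
  also have "\<dots> = emeasure lborel \<Omega> * (\<integral>\<^sup>+z. ?h (- z) \<partial>lborel)"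
    by (rule nn_integral_pairs_difference[OF hm \<Omega>(1)])
  also have "\<dots> < \<infinity>"
    using nn_integral_norm_powr_far[OF a] emeasure_bounded_finite[OF \<Omega>(2)]
    by (simp add: ennreal_mult_less_top indicator_def)
  finally show ?thesis .
qed

lemma nn_integral_pkern:
  fixes p :: "'a::euclidean_space \<times> 'a"
  assumes "s > 0" "fst p \<noteq> snd p"
  shows "(\<integral>\<^sup>+\<sigma>. pkern s p \<sigma> \<partial>lborel) =
    ennreal (norm (fst p - snd p) powr (- (real DIM('a) + s)) * mass_gs DIM('a) s)"
  unfolding pkern_def using assms by (intro nn_integral_kern) auto

text \<open>
  The energy density of a pair of base points, shifted by a term that depends on the distance only,
  so that it equals the kernel integral of \<open>\<bar>v x - v y - \<sigma>\<bar>\<close>.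
\<close>

definition interaction :: "real \<Rightarrow> ('a::euclidean_space \<Rightarrow> real) \<Rightarrow> 'a \<times> 'a \<Rightarrow> real" where
  "interaction s v p = norm (fst p - snd p) powr (- (real DIM('a) - 1 + s))
     * Phi DIM('a) s ((v (fst p) - v (snd p)) / norm (fst p - snd p))"

lemma nn_integral_pkern_abs:
  fixes p :: "'a::euclidean_space \<times> 'a"
  assumes "s > 0" "fst p \<noteq> snd p"
  shows "(\<integral>\<^sup>+\<sigma>. pkern s p \<sigma> * ennreal \<bar>v (fst p) - v (snd p) - \<sigma>\<bar> \<partial>lborel) = ennreal (interaction s v p)"
  unfolding pkern_def interaction_def using assms by (intro nn_integral_kern_abs_diff) auto

lemma Phi_nonneg: "0 \<le> Phi n s d"
  unfolding Phi_def using gs_pos[of n s] by (intro Bochner_Integration.integral_nonneg) (simp add: less_imp_le)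

lemma interaction_nonneg: "0 \<le> interaction s v p"
  unfolding interaction_def by (intro mult_nonneg_nonneg Phi_nonneg) simp

text \<open>
  The point where the perimeter and the functional of the obstacle problem meet: the constant
  \<open>Phi n s 0\<close> cancels in differences.
\<close>

lemma interaction_diff_eq:
  fixes u v :: "real^'n \<Rightarrow> real"
  assumes "s > 0"
  shows "interaction s u p - interaction s v p = 2 * energy_diff s u v p"
proof -
  have n: "1 \<le> CARD('n)" by (simp add: Suc_leI)
  have "Phi CARD('n) s a - Phi CARD('n) s b = 2 * (GGs CARD('n) s a - GGs CARD('n) s b)" for a b
    using Phi_eq_GGs[OF assms n, of a] Phi_eq_GGs[OF assms n, of b] by simp
  then have "interaction s u p - interaction s v p =
     norm (fst p - snd p) powr (- (real CARD('n) - 1 + s)) *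
     (2 * (GGs CARD('n) s ((u (fst p) - u (snd p)) / norm (fst p - snd p))
         - GGs CARD('n) s ((v (fst p) - v (snd p)) / norm (fst p - snd p))))"
    unfolding interaction_def by (simp only: right_diff_distrib[symmetric] DIM_cart DIM_real mult_1_right)
  also have "\<dots> = 2 * energy_diff s u v p"
    by (simp only: energy_diff_def case_prod_beta powr_minus divide_inverse mult_ac)
  finally show ?thesis .
qed

lemma powr_shift:
  fixes r :: real
  assumes "r > 0"
  shows "r powr (- (a - 1 + s)) * (c * (d / r)) = c * (d / r powr (a + s))"
proof -
  have "r powr (- (a - 1 + s)) = r powr (1 + (- (a + s)))" by (simp add: algebra_simps)
  also have "\<dots> = r * inverse (r powr (a + s))" 
    using assms powr_add[of r 1 "- (a + s)"] by (simp only: powr_minus powr_one less_imp_le)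
  finally show ?thesis using assms by (simp add: divide_inverse)
qed

lemma interaction_lower:
  fixes v :: "'a::euclidean_space \<Rightarrow> real"
  assumes "s > 0" "fst p \<noteq> snd p"
  shows "mass_gs DIM('a) s * (\<bar>v (fst p) - v (snd p)\<bar> / norm (fst p - snd p) powr (real DIM('a) + s)) \<le> interaction s v p"
proof -
  let ?r = "norm (fst p - snd p)" and ?d = "v (fst p) - v (snd p)"
  have r: "?r > 0" using assms by simp
  have "mass_gs DIM('a) s * \<bar>?d / ?r\<bar> \<le> Phi DIM('a) s (?d / ?r)"
    by (intro Phi_lower assms) simp
  then have "?r powr (- (real DIM('a) - 1 + s)) * (mass_gs DIM('a) s * (\<bar>?d\<bar> / ?r)) \<le> interaction s v p"
    unfolding interaction_def by (intro mult_left_mono) (simp_all add: abs_divide)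
  then show ?thesis unfolding powr_shift[OF r] .
qed

lemma interaction_upper:
  fixes v :: "'a::euclidean_space \<Rightarrow> real"
  assumes "s > 0" "fst p \<noteq> snd p"
  shows "interaction s v p \<le> mass_gs DIM('a) s * (\<bar>v (fst p) - v (snd p)\<bar> / norm (fst p - snd p) powr (real DIM('a) + s))
     + Phi DIM('a) s 0 * norm (fst p - snd p) powr (- (real DIM('a) - 1 + s))"
proof -
  let ?r = "norm (fst p - snd p)" and ?d = "v (fst p) - v (snd p)"
  have r: "?r > 0" using assms by simp
  have "Phi DIM('a) s (?d / ?r) \<le> mass_gs DIM('a) s * \<bar>?d / ?r\<bar> + Phi DIM('a) s 0"
    by (intro Phi_upper assms) simp
  then have "interaction s v p \<le> ?r powr (- (real DIM('a) - 1 + s)) * (mass_gs DIM('a) s * (\<bar>?d\<bar> / ?r) + Phi DIM('a) s 0)"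
    unfolding interaction_def by (intro mult_left_mono) (simp_all add: abs_divide)
  then show ?thesis unfolding distrib_left powr_shift[OF r] by (simp only: mult.commute)
qed

lemma measurable_pair_dist:
  "(\<lambda>p :: 'a::euclidean_space \<times> 'a. norm (fst p - snd p)) \<in> borel_measurable borel"
  by (intro borel_measurable_continuous_onI continuous_intros)

lemma measurable_pair_comp:
  fixes v :: "'a::euclidean_space \<Rightarrow> 'b::topological_space"
  assumes "v \<in> borel_measurable borel"
  shows "(\<lambda>p :: 'a \<times> 'a. v (fst p)) \<in> borel_measurable borel"
    and "(\<lambda>p :: 'a \<times> 'a. v (snd p)) \<in> borel_measurable borel"
  by (rule measurable_compose[OF _ assms], intro borel_measurable_continuous_onI continuous_intros)+

lemma borel_imp_lborel: "f \<in> borel_measurable borel \<Longrightarrow> f \<in> borel_measurable lborel"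
  by simp

lemma measurable_interaction:
  fixes u :: "'a::euclidean_space \<Rightarrow> real"
  assumes s: "0 < s" and u: "u \<in> borel_measurable borel"
  shows "interaction s u \<in> borel_measurable borel"
proof -
  have Ph: "Phi DIM('a) s \<in> borel_measurable borel"
    by (rule borel_measurable_continuous_onI[OF DERIV_continuous_on])
       (rule DERIV_subset[OF DERIV_Phi[OF s] subset_UNIV], simp)
  note nm = measurable_pair_dist
  have "(\<lambda>p. (u (fst p) - u (snd p)) / norm (fst p - snd p)) \<in> borel_measurable borel"
    by (intro borel_measurable_divide borel_measurable_diff measurable_pair_comp u nm)
  from borel_measurable_times[OF powr_real_measurable[OF nm borel_measurable_const] measurable_compose[OF this Ph]]
  show ?thesis unfolding interaction_def .
qed

lemma measurable_excess_fiber: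
  fixes F :: "('a::euclidean_space \<times> real) set"
  assumes "F \<in> sets borel" "u \<in> borel_measurable borel"
  shows "(\<lambda>x. excess (fiber F x) (u x)) \<in> borel_measurable borel"
proof -
  note [measurable] = assms
  have 1: "(\<lambda>w. indicat_real F w) \<in> borel_measurable borel" by measurable
  have 2: "(\<lambda>w. indicat_real (subgraph u UNIV) w) \<in> borel_measurable borel" by measurable
  have eq: "(\<lambda>w. indicat_real F w - indicat_real (subgraph u UNIV) w) = (\<lambda>w. indicat_real (fiber F (fst w)) (snd w) - indicat_real {..<u (fst w)} (snd w))"
    by (auto simp: indicator_def subgraph_def)
  have "(\<lambda>w. indicat_real F w - indicat_real (subgraph u UNIV) w) \<in> borel_measurable (borel \<Otimes>\<^sub>M borel)"
    unfolding borel_prod by (intro borel_measurable_diff 1 2)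
  then have "(\<lambda>(x, t). indicat_real (fiber F x) t - indicat_real {..<u x} t) \<in> borel_measurable (borel \<Otimes>\<^sub>M lborel)"
    unfolding eq case_prod_beta' by (simp cong: measurable_cong_sets)
  then show ?thesis
    unfolding excess_def by (rule lborel.borel_measurable_lebesgue_integral)
qed

lemma measurable_gain [measurable (raw)]:
  fixes F :: "('a::euclidean_space \<times> real) set"
  assumes "F \<in> sets borel" "u \<in> borel_measurable borel" "\<Omega> \<in> sets borel"
    and fg: "f \<in> borel_measurable M" "g \<in> borel_measurable M"
  shows "(\<lambda>w. gain \<Omega> u F \<eta> (f w) (g w)) \<in> borel_measurable M"
proof -
  note [measurable] = assms(1-3)
  let ?P = "\<lambda>w :: (('a \<times> 'a) \<times> real) \<times> real. fst (fst (fst w)) \<in> \<Omega> \<and> snd (fst (fst w)) \<notin> \<Omega> \<and>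
     ((u (fst (fst (fst w))) + \<eta> < u (snd (fst (fst w))) + snd (fst w) \<and> u (snd (fst (fst w))) + snd (fst w) \<le> snd w \<and> (fst (fst (fst w)), snd w) \<in> F)
    \<or> (u (snd (fst (fst w))) + snd (fst w) < u (fst (fst (fst w))) - \<eta> \<and> snd w < u (snd (fst (fst w))) + snd (fst w) \<and> (fst (fst (fst w)), snd w) \<notin> F))"
  have c1: "(\<lambda>w :: (('a \<times> 'a) \<times> real) \<times> real. fst (fst (fst w))) \<in> borel_measurable borel"
    and c2: "(\<lambda>w :: (('a \<times> 'a) \<times> real) \<times> real. snd (fst (fst w))) \<in> borel_measurable borel"
    and c3: "(\<lambda>w :: (('a \<times> 'a) \<times> real) \<times> real. snd (fst w)) \<in> borel_measurable borel"
    and c4: "(\<lambda>w :: (('a \<times> 'a) \<times> real) \<times> real. snd w) \<in> borel_measurable borel"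
    and c5: "(\<lambda>w :: (('a \<times> 'a) \<times> real) \<times> real. (fst (fst (fst w)), snd w)) \<in> borel_measurable borel"
    by (intro borel_measurable_continuous_onI continuous_intros)+
  note [measurable] = c1 c2 c3 c4 c5 measurable_compose[OF c1 assms(2)] measurable_compose[OF c2 assms(2)]
  have "Measurable.pred borel ?P" by measurable
  then have S: "{w. ?P w} \<in> sets borel" by (simp add: pred_def)
  have eq: "gain \<Omega> u F \<eta> p \<sigma> = (\<integral>\<^sup>+t. indicator {w. ?P w} ((p, \<sigma>), t) \<partial>lborel)" for p \<sigma>
  proof -
    have m: "{t. ?P ((p, \<sigma>), t)} \<in> sets borel"
    proof -
      have "(\<lambda>t. ((p, \<sigma>), t)) \<in> borel_measurable borel"
        by (intro borel_measurable_continuous_onI continuous_intros)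
      from measurable_sets[OF this S] show ?thesis by (simp add: vimage_def)
    qed
    have "(\<integral>\<^sup>+t. indicator {w. ?P w} ((p, \<sigma>), t) \<partial>lborel) = (\<integral>\<^sup>+t. indicator {t. ?P ((p, \<sigma>), t)} t \<partial>lborel)"
      by (intro nn_integral_cong) (simp add: indicator_def)
    also have "\<dots> = emeasure lborel {t. ?P ((p, \<sigma>), t)}"
      using m by (simp only: nn_integral_indicator sets_lborel)
    finally show ?thesis
      by (cases "fst p \<in> \<Omega>"; cases "snd p \<in> \<Omega>") (simp_all add: gain_def wrong_side_def)
  qed
  have "(\<lambda>q. gain \<Omega> u F \<eta> (fst q) (snd q)) \<in> borel_measurable borel"
    unfolding eq using S by (intro measurable_nn_integral_lborel) (simp add: borel_prod)
  from measurable_compose[OF borel_measurable_Pair[OF fg] this] show ?thesis by simp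
qed

lemma integrated_slice_inequality:
  fixes u :: "'a::euclidean_space \<Rightarrow> real" and \<Omega> :: "'a set"
  defines "U \<equiv> subgraph u UNIV"
  assumes s: "0 < s" and \<Omega>: "open \<Omega>" and u: "u \<in> borel_measurable borel" and F: "F \<in> sets borel"
    and FU: "F - cylinder \<Omega> M = U - cylinder \<Omega> M" and M: "0 \<le> M"
    and \<theta>: "0 < \<theta>" "\<theta> \<le> 1" "\<theta> * (2 * M) \<le> \<eta>"
    and p: "fst p \<noteq> snd p"
  shows "ennreal \<theta> * (kernel_integral s p (sect (disagree U \<inter> Qset (cylinder \<Omega> M)) p)
          + kernel_integral s p (gain \<Omega> u F \<eta> p))
      + ennreal (interaction s (\<lambda>x. u x + \<theta> * excess (fiber F x) (u x)) p)
    \<le> ennreal \<theta> * kernel_integral s p (sect (disagree F \<inter> Qset (cylinder \<Omega> M)) p)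
      + ennreal (interaction s u p)"
proof -
  let ?Q = "Qset (cylinder \<Omega> M)" and ?m = "\<lambda>x. u x + \<theta> * excess (fiber F x) (u x)"
  have U: "U \<in> sets borel" unfolding U_def by (rule sets_subgraph[OF u])
  have QU: "disagree U \<inter> ?Q \<in> sets borel" "disagree F \<inter> ?Q \<in> sets borel"
    using U F \<Omega> by (auto intro!: sets.Int sets_disagree sets_Qset sets_cylinder)
  have "\<Omega> \<in> sets borel" using \<Omega> by simp
  note gm = measurable_gain[OF F u this]
  have mk: "(\<lambda>\<sigma>. pkern s p \<sigma>) \<in> borel_measurable borel"
    by (intro measurable_pkern borel_measurable_const measurable_ident_sets refl)
  have m1: "(\<lambda>\<sigma>. sect (disagree U \<inter> ?Q) p \<sigma>) \<in> borel_measurable borel"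
    and m2: "(\<lambda>\<sigma>. sect (disagree F \<inter> ?Q) p \<sigma>) \<in> borel_measurable borel"
    by (intro measurable_sect QU borel_measurable_const measurable_ident_sets refl)+
  have m3: "(\<lambda>\<sigma>. gain \<Omega> u F \<eta> p \<sigma>) \<in> borel_measurable borel"
    by (intro gm borel_measurable_const measurable_ident_sets refl)
  have m4: "(\<lambda>\<sigma>. ennreal \<bar>a - \<sigma>\<bar>) \<in> borel_measurable borel" for a
    by measurable
  have k1: "(\<lambda>\<sigma>. pkern s p \<sigma> * sect (disagree U \<inter> ?Q) p \<sigma>) \<in> borel_measurable lborel"
    and k2: "(\<lambda>\<sigma>. pkern s p \<sigma> * sect (disagree F \<inter> ?Q) p \<sigma>) \<in> borel_measurable lborel"
    and k3: "(\<lambda>\<sigma>. pkern s p \<sigma> * gain \<Omega> u F \<eta> p \<sigma>) \<in> borel_measurable lborel"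
    and k4: "(\<lambda>\<sigma>. pkern s p \<sigma> * ennreal \<bar>a - \<sigma>\<bar>) \<in> borel_measurable lborel" for a
    using mk m1 m2 m3 m4 by (auto intro!: borel_measurable_times_ennreal)
  have "(\<integral>\<^sup>+\<sigma>. ennreal \<theta> * (pkern s p \<sigma> * sect (disagree U \<inter> ?Q) p \<sigma> + pkern s p \<sigma> * gain \<Omega> u F \<eta> p \<sigma>)
        + pkern s p \<sigma> * ennreal \<bar>?m (fst p) - ?m (snd p) - \<sigma>\<bar> \<partial>lborel)
     \<le> (\<integral>\<^sup>+\<sigma>. ennreal \<theta> * (pkern s p \<sigma> * sect (disagree F \<inter> ?Q) p \<sigma>) + pkern s p \<sigma> * ennreal \<bar>u (fst p) - u (snd p) - \<sigma>\<bar> \<partial>lborel)"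
  proof (rule nn_integral_mono)
    fix \<sigma> :: real
    have "pkern s p \<sigma> * (ennreal \<theta> * sect (disagree U \<inter> ?Q) (fst p, snd p) \<sigma>
      + ennreal \<bar>?m (fst p) - ?m (snd p) - \<sigma>\<bar> + ennreal \<theta> * gain \<Omega> u F \<eta> (fst p, snd p) \<sigma>)
     \<le> pkern s p \<sigma> * (ennreal \<theta> * sect (disagree F \<inter> ?Q) (fst p, snd p) \<sigma> + ennreal \<bar>u (fst p) - u (snd p) - \<sigma>\<bar>)"
      unfolding U_def
      by (intro mult_left_mono slice_inequality \<Omega> u F FU[unfolded U_def] M \<theta>) simp
    then show "ennreal \<theta> * (pkern s p \<sigma> * sect (disagree U \<inter> ?Q) p \<sigma> + pkern s p \<sigma> * gain \<Omega> u F \<eta> p \<sigma>)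
        + pkern s p \<sigma> * ennreal \<bar>?m (fst p) - ?m (snd p) - \<sigma>\<bar>
     \<le> ennreal \<theta> * (pkern s p \<sigma> * sect (disagree F \<inter> ?Q) p \<sigma>) + pkern s p \<sigma> * ennreal \<bar>u (fst p) - u (snd p) - \<sigma>\<bar>"
      by (simp only: prod.collapse distrib_left ac_simps)
  qed
  also have "(\<integral>\<^sup>+\<sigma>. ennreal \<theta> * (pkern s p \<sigma> * sect (disagree F \<inter> ?Q) p \<sigma>) + pkern s p \<sigma> * ennreal \<bar>u (fst p) - u (snd p) - \<sigma>\<bar> \<partial>lborel)
    = ennreal \<theta> * kernel_integral s p (sect (disagree F \<inter> ?Q) p) + ennreal (interaction s u p)"
    unfolding nn_integral_pkern_abs[OF s p, symmetric]
    by (simp only: nn_integral_add[OF borel_measurable_times_ennreal[OF borel_measurable_const k2] k4] nn_integral_cmult[OF k2])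
  also have "(\<integral>\<^sup>+\<sigma>. ennreal \<theta> * (pkern s p \<sigma> * sect (disagree U \<inter> ?Q) p \<sigma> + pkern s p \<sigma> * gain \<Omega> u F \<eta> p \<sigma>)
        + pkern s p \<sigma> * ennreal \<bar>?m (fst p) - ?m (snd p) - \<sigma>\<bar> \<partial>lborel)
    = ennreal \<theta> * (kernel_integral s p (sect (disagree U \<inter> ?Q) p)
          + kernel_integral s p (gain \<Omega> u F \<eta> p)) + ennreal (interaction s ?m p)"
    unfolding nn_integral_pkern_abs[OF s p, symmetric]
    by (simp only: nn_integral_add[OF borel_measurable_times_ennreal[OF borel_measurable_const borel_measurable_add[OF k1 k3]] k4]
        nn_integral_cmult[OF borel_measurable_add[OF k1 k3]] nn_integral_add[OF k1 k3])
  finally show ?thesis .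
qed

text \<open>
  The seminorm may be replaced by the kernel integral, since \<open>Phi\<close> differs from a multiple of the
  absolute value by a bounded amount and the corresponding power of the distance is integrable on
  the bounded set \<open>\<Omega> \<times> \<Omega>\<close>.
\<close>

lemma Ws_iff:
  fixes v :: "real^'n \<Rightarrow> real"
  assumes v: "v \<in> borel_measurable borel" and \<Omega>: "open \<Omega>" "bounded \<Omega>" and s: "0 < s" "s < 1"
  shows "v \<in> Ws s \<Omega> \<longleftrightarrow> (\<integral>\<^sup>+x. ennreal \<bar>v x\<bar> * indicator \<Omega> x \<partial>lborel) < \<infinity> \<and>
     (\<integral>\<^sup>+p. indicator (\<Omega> \<times> \<Omega>) p * ennreal (interaction s v p) \<partial>lborel) < \<infinity>"
proof -
  define c where "c = mass_gs CARD('n) s"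
  have n: "1 \<le> CARD('n)" by (simp add: Suc_leI)
  have c: "c > 0" unfolding c_def by (rule mass_gs_pos[OF s(1) n])
  let ?k = "\<lambda>p. \<bar>v (fst p) - v (snd p)\<bar> / norm (fst p - snd p) powr (real CARD('n) + s)"
  let ?N = "\<lambda>p :: (real^'n) \<times> (real^'n). norm (fst p - snd p) powr (- (real CARD('n) - 1 + s))"
  have vl: "v \<in> borel_measurable lebesgue" using v by (intro measurable_completion) simp
  have OO: "\<Omega> \<times> \<Omega> \<in> sets borel" using \<Omega> by (intro borel_open open_Times)
  have Nm: "(\<lambda>p :: (real^'n) \<times> (real^'n). norm (fst p - snd p) powr a :: real) \<in> borel_measurable borel" for a
    by (intro powr_real_measurable measurable_pair_dist borel_measurable_const)
  have km: "?k \<in> borel_measurable borel"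
    by (intro borel_measurable_divide borel_measurable_abs borel_measurable_diff measurable_pair_comp v Nm)
  have OOm: "(\<lambda>p. indicator (\<Omega> \<times> \<Omega>) p :: ennreal) \<in> borel_measurable lborel"
    using OO by simp
  have k1: "(\<lambda>p. ennreal (?k p) * indicator (\<Omega> \<times> \<Omega>) p) \<in> borel_measurable lborel"
    using km by (intro borel_measurable_times_ennreal OOm measurable_compose[OF _ measurable_ennreal]) simp
  have k2: "(\<lambda>p. indicator (\<Omega> \<times> \<Omega>) p * ennreal (?N p)) \<in> borel_measurable lborel"
    using Nm by (intro borel_measurable_times_ennreal OOm measurable_compose[OF _ measurable_ennreal]) simp
  have eq: "(\<integral>\<^sup>+p. ennreal (?k p) * indicator (\<Omega> \<times> \<Omega>) p \<partial>lborel) < \<infinity> \<longleftrightarrow>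
     (\<integral>\<^sup>+p. indicator (\<Omega> \<times> \<Omega>) p * ennreal (interaction s v p) \<partial>lborel) < \<infinity>" (is "?A < \<infinity> \<longleftrightarrow> ?B < \<infinity>")
  proof
    assume A: "?A < \<infinity>"
    have "?B \<le> (\<integral>\<^sup>+p. ennreal c * (ennreal (?k p) * indicator (\<Omega> \<times> \<Omega>) p)
        + ennreal (Phi CARD('n) s 0) * (indicator (\<Omega> \<times> \<Omega>) p * ennreal (?N p)) \<partial>lborel)"
    proof (rule nn_integral_mono_AE, use AE_lborel_pair_neq in eventually_elim)
      case (elim p)
      have "ennreal (interaction s v p) \<le> ennreal (c * ?k p + Phi CARD('n) s 0 * ?N p)"
        using interaction_upper[OF s(1) elim, of v] by (intro ennreal_leI) (simp add: c_def)
      also have "\<dots> = ennreal c * ennreal (?k p) + ennreal (Phi CARD('n) s 0) * ennreal (?N p)"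
      proof -
        have "0 \<le> c * ?k p" "0 \<le> Phi CARD('n) s 0 * ?N p" using c Phi_nonneg[of "CARD('n)" s 0] by simp_all
        then show ?thesis using c Phi_nonneg[of "CARD('n)" s 0] by (simp only: ennreal_plus ennreal_mult' less_imp_le)
      qed
      finally show ?case by (simp add: indicator_def)
    qed
    also have "\<dots> = ennreal c * ?A + ennreal (Phi CARD('n) s 0) * (\<integral>\<^sup>+p. indicator (\<Omega> \<times> \<Omega>) p * ennreal (?N p) \<partial>lborel)"
      by (simp only: nn_integral_add[OF borel_measurable_times_ennreal[OF borel_measurable_const k1]
            borel_measurable_times_ennreal[OF borel_measurable_const k2]]
          nn_integral_cmult[OF k1] nn_integral_cmult[OF k2])
    also have "\<dots> < \<infinity>"
      using A nn_integral_near_pairs[of \<Omega> "real CARD('n) - 1 + s"] \<Omega> s n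
      by (simp add: ennreal_mult_less_top of_nat_diff)
    finally show "?B < \<infinity>" .
  next
    assume B: "?B < \<infinity>"
    have "?A \<le> (\<integral>\<^sup>+p. ennreal (1 / c) * (indicator (\<Omega> \<times> \<Omega>) p * ennreal (interaction s v p)) \<partial>lborel)"
    proof (rule nn_integral_mono_AE, use AE_lborel_pair_neq in eventually_elim)
      case (elim p)
      have "c * ?k p \<le> interaction s v p" using interaction_lower[OF s(1) elim, of v] by (simp add: c_def)
      then have "?k p \<le> (1 / c) * interaction s v p" using c by (simp add: field_simps)
      then have "ennreal (?k p) \<le> ennreal ((1 / c) * interaction s v p)" by (rule ennreal_leI)
      also have "\<dots> = ennreal (1 / c) * ennreal (interaction s v p)"
        using c by (intro ennreal_mult') simp
      finally show ?case by (simp add: indicator_def)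
    qed
    also have "\<dots> = ennreal (1 / c) * ?B"
    proof (rule nn_integral_cmult)
      have "interaction s v \<in> borel_measurable borel" by (rule measurable_interaction[OF s(1) v])
      then show "(\<lambda>p. indicator (\<Omega> \<times> \<Omega>) p * ennreal (interaction s v p)) \<in> borel_measurable lborel"
        by (intro borel_measurable_times_ennreal OOm measurable_compose[OF _ measurable_ennreal]) simp
    qed
    also have "\<dots> < \<infinity>" using B by (simp add: ennreal_mult_less_top)
    finally show "?A < \<infinity>" .
  qed
  show ?thesis
    unfolding Ws_def mem_Collect_eq nn_integral_completion using vl eq by (simp only: ennreal_add_less_top simp_thms infinity_ennreal_def)
qed

section \<open>Competitors of the obstacle problem and the gain of perimeter\<close>

lemma borel_imp_lebesgue: "f \<in> borel_measurable borel \<Longrightarrow> f \<in> borel_measurable lebesgue"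
  by (intro measurable_completion) simp

lemma measurable_nn_integral_pkern:
  fixes h :: "'a::euclidean_space \<times> 'a \<Rightarrow> real \<Rightarrow> ennreal"
  assumes "(\<lambda>w. h (fst w) (snd w)) \<in> borel_measurable borel"
  shows "(\<lambda>p. \<integral>\<^sup>+\<sigma>. pkern s p \<sigma> * h p \<sigma> \<partial>lborel) \<in> borel_measurable borel"
proof -
  have "(\<lambda>w :: ('a \<times> 'a) \<times> real. fst w) \<in> borel_measurable borel"
    "(\<lambda>w :: ('a \<times> 'a) \<times> real. snd w) \<in> borel_measurable borel"
    by (intro borel_measurable_continuous_onI continuous_intros)+
  from borel_measurable_times_ennreal[OF measurable_pkern[OF this] assms] show ?thesis
    by (intro measurable_nn_integral_lborel) (simp add: borel_prod)
qed

lemma measurable_energy_diff: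
  fixes u v :: "real^'n \<Rightarrow> real"
  assumes u: "u \<in> borel_measurable borel" and v: "v \<in> borel_measurable borel"
  shows "energy_diff s u v \<in> borel_measurable borel"
proof -
  have G: "(\<lambda>p :: (real^'n) \<times> (real^'n). GGs CARD('n) s ((w (fst p) - w (snd p)) / norm (fst p - snd p))) \<in> borel_measurable borel"
    if "w \<in> borel_measurable borel" for w :: "real^'n \<Rightarrow> real"
    by (rule measurable_compose[OF _ measurable_GGs])
       (intro borel_measurable_divide borel_measurable_diff measurable_pair_comp that measurable_pair_dist)
  show ?thesis
    unfolding energy_diff_def case_prod_beta'
    by (intro borel_measurable_divide borel_measurable_diff G u v powr_real_measurable measurable_pair_dist borel_measurable_const)
qed

lemma energy_diff_integral:
  fixes u v :: "real^'n \<Rightarrow> real"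
  assumes u: "u \<in> borel_measurable borel" and v: "v \<in> borel_measurable borel" and \<Omega>: "open \<Omega>"
    and sol: "solves_obstacle_problem s \<Omega> A \<phi> \<psi> u" and vin: "v \<in> Ws_obstacle s \<Omega> A \<phi> \<psi>"
  shows "integrable lborel (\<lambda>p. indicator (Qset \<Omega>) p *\<^sub>R energy_diff s u v p)"
    and "(LINT p|lborel. indicator (Qset \<Omega>) p *\<^sub>R energy_diff s u v p) \<le> 0"
proof -
  have "Qset \<Omega> \<in> sets borel" using \<Omega> by (intro sets_Qset) simp
  then have m: "(\<lambda>p. indicator (Qset \<Omega>) p *\<^sub>R energy_diff s u v p) \<in> borel_measurable lborel"
    using measurable_energy_diff[OF u v] by simp
  have "set_integrable lebesgue (Qset \<Omega>) (energy_diff s u v)"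
    and le: "(LINT z:Qset \<Omega>|lebesgue. energy_diff s u v z) \<le> 0"
    using sol vin by (auto simp: solves_obstacle_problem_def)
  then show "integrable lborel (\<lambda>p. indicator (Qset \<Omega>) p *\<^sub>R energy_diff s u v p)"
    using integrable_completion[OF m] by (simp add: set_integrable_def)
  show "(LINT p|lborel. indicator (Qset \<Omega>) p *\<^sub>R energy_diff s u v p) \<le> 0"
    using le integral_completion[OF m] by (simp add: set_lebesgue_integral_def)
qed

text \<open>
  The function that moves \<open>u\<close> a fraction \<open>\<theta>\<close> towards the rearrangement of \<open>F\<close> is admissible. Its
  energy in \<open>\<Omega> \<times> \<Omega>\<close> is controlled by the perimeter of \<open>F\<close> and the energy of \<open>u\<close>. It stays above
  \<open>\<psi>\<close> because the fiber of \<open>F\<close> contains the half-line below \<open>\<psi> x\<close>, so that its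
  rearrangement cannot end below \<open>\<psi> x\<close>.
\<close>

lemma competitor_in_Ws_obstacle:
  fixes u :: "real^'n \<Rightarrow> real"
  assumes s: "0 < s" "s < 1" and \<Omega>: "open \<Omega>" "bounded \<Omega>" and A: "A \<subseteq> \<Omega>"
    and u: "u \<in> borel_measurable borel" and uin: "u \<in> Ws_obstacle s \<Omega> A \<phi> \<psi>" and F: "F \<in> sets borel"
    and FU: "F - cylinder \<Omega> M = subgraph u UNIV - cylinder \<Omega> M" and M: "0 \<le> M"
    and obst: "ae_subset (subgraph \<psi> A) F" and fin: "Per s F (cylinder \<Omega> M) < \<infinity>"
    and \<theta>: "0 < \<theta>" "\<theta> \<le> 1"
  shows "(\<lambda>x. u x + \<theta> * excess (fiber F x) (u x)) \<in> borel_measurable borel"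
    and "(\<lambda>x. u x + \<theta> * excess (fiber F x) (u x)) \<in> Ws_obstacle s \<Omega> A \<phi> \<psi>"
proof -
  let ?m = "\<lambda>x. u x + \<theta> * excess (fiber F x) (u x)"
  show mm: "?m \<in> borel_measurable borel"
    by (intro borel_measurable_add u borel_measurable_times borel_measurable_const measurable_excess_fiber F)
  note ab = abs_excess_fiber_le[OF u F FU M] and out = excess_fiber_outside[OF u F FU M]
    and nh = fiber_near_halfline[OF u F FU M]
  have ob: "open \<Omega>" "bounded \<Omega>" by fact+
  have Om: "\<Omega> \<in> sets borel" using \<Omega> by simp
  have uW: "(\<integral>\<^sup>+x. ennreal \<bar>u x\<bar> * indicator \<Omega> x \<partial>lborel) < \<infinity>"
     "(\<integral>\<^sup>+p. indicator (\<Omega> \<times> \<Omega>) p * ennreal (interaction s u p) \<partial>lborel) < \<infinity>"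
    using uin Ws_iff[OF u ob s] by (auto simp: Ws_obstacle_def)
  have "?m \<in> Ws s \<Omega>"
    unfolding Ws_iff[OF mm ob s]
  proof
    have "(\<integral>\<^sup>+x. ennreal \<bar>?m x\<bar> * indicator \<Omega> x \<partial>lborel)
      \<le> (\<integral>\<^sup>+x. ennreal \<bar>u x\<bar> * indicator \<Omega> x + ennreal (2 * M) * indicator \<Omega> x \<partial>lborel)"
    proof (rule nn_integral_mono)
      fix x
      have "\<theta> * \<bar>excess (fiber F x) (u x)\<bar> \<le> 1 * (2 * M)"
        using \<theta> ab[where x = x] by (intro mult_mono) auto
      then have "\<bar>?m x\<bar> \<le> \<bar>u x\<bar> + 2 * M"
        using abs_triangle_ineq[of "u x" "\<theta> * excess (fiber F x) (u x)"] \<theta> by (simp add: abs_mult)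
      then have "ennreal \<bar>?m x\<bar> \<le> ennreal \<bar>u x\<bar> + ennreal (2 * M)"
      proof -
        have "ennreal \<bar>?m x\<bar> \<le> ennreal (\<bar>u x\<bar> + 2 * M)" by (rule ennreal_leI) fact
        also have "\<dots> = ennreal \<bar>u x\<bar> + ennreal (2 * M)" using M by (intro ennreal_plus) auto
        finally show ?thesis .
      qed
      then show "ennreal \<bar>?m x\<bar> * indicator \<Omega> x \<le> ennreal \<bar>u x\<bar> * indicator \<Omega> x + ennreal (2 * M) * indicator \<Omega> x"
        by (simp add: indicator_def)
    qed
    also have "\<dots> = (\<integral>\<^sup>+x. ennreal \<bar>u x\<bar> * indicator \<Omega> x \<partial>lborel) + ennreal (2 * M) * emeasure lborel \<Omega>"
      using Om u by (subst nn_integral_add) (simp_all add: nn_integral_cmult_indicator)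
    also have "\<dots> < \<infinity>"
      using uW(1) emeasure_bounded_finite[OF \<Omega>(2)] by (simp add: ennreal_mult_less_top)
    finally show "(\<integral>\<^sup>+x. ennreal \<bar>?m x\<bar> * indicator \<Omega> x \<partial>lborel) < \<infinity>" .
  next
    let ?f = "\<lambda>p. kernel_integral s p (sect (disagree F \<inter> Qset (cylinder \<Omega> M)) p)"
    have QF: "disagree F \<inter> Qset (cylinder \<Omega> M) \<in> sets borel"
      by (intro sets.Int sets_disagree F sets_Qset sets_cylinder \<Omega>)
    have fm: "?f \<in> borel_measurable borel"
      by (intro measurable_nn_integral_lborel borel_measurable_times_ennreal measurable_pkern measurable_sect QF)
         (simp_all add: borel_prod borel_measurable_continuous_onI continuous_intros)
    have um: "interaction s u \<in> borel_measurable borel" by (rule measurable_interaction[OF s(1) u])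
    have OO: "\<Omega> \<times> \<Omega> \<in> sets borel" using \<Omega> by (intro borel_open open_Times)
    have um2: "(\<lambda>p. indicator (\<Omega> \<times> \<Omega>) p * ennreal (interaction s u p)) \<in> borel_measurable lborel"
      using um OO by simp
    have "(\<integral>\<^sup>+p. indicator (\<Omega> \<times> \<Omega>) p * ennreal (interaction s ?m p) \<partial>lborel)
      \<le> (\<integral>\<^sup>+p. ?f p + indicator (\<Omega> \<times> \<Omega>) p * ennreal (interaction s u p) \<partial>lborel)"
    proof (rule nn_integral_mono_AE, use AE_lborel_pair_neq in eventually_elim)
      case (elim p)
      have "ennreal (interaction s ?m p) \<le> ennreal \<theta> * ?f p + ennreal (interaction s u p)"
        using integrated_slice_inequality[OF s(1) \<Omega>(1) u F FU M \<theta> order_refl elim]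
        by (rule order_trans[rotated]) simp
      also have "\<dots> \<le> 1 * ?f p + ennreal (interaction s u p)"
        using \<theta> by (intro add_right_mono mult_right_mono) (simp_all add: ennreal_le_1)
      finally show ?case by (simp add: indicator_def)
    qed
    also have "\<dots> = Per s F (cylinder \<Omega> M) + (\<integral>\<^sup>+p. indicator (\<Omega> \<times> \<Omega>) p * ennreal (interaction s u p) \<partial>lborel)"
      using fm um2 by (subst nn_integral_add) (simp_all add: Per_slices[OF F sets_cylinder[OF \<Omega>(1)]])
    also have "\<dots> < \<infinity>" using fin uW(2) by simp
    finally show "(\<integral>\<^sup>+p. indicator (\<Omega> \<times> \<Omega>) p * ennreal (interaction s ?m p) \<partial>lborel) < \<infinity>" .
  qed
  moreover have "AE x in lebesgue. x \<notin> \<Omega> \<longrightarrow> ?m x = \<phi> x"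
  proof -
    have "AE x in lebesgue. x \<notin> \<Omega> \<longrightarrow> u x = \<phi> x" using uin by (simp add: Ws_obstacle_def)
    then show ?thesis
    proof eventually_elim
      case (elim x)
      show ?case
      proof
        assume x: "x \<notin> \<Omega>"
        show "?m x = \<phi> x" unfolding out[OF x] using elim x by simp
      qed
    qed
  qed
  moreover have "AE x in lebesgue. x \<in> A \<longrightarrow> \<psi> x \<le> ?m x"
  proof -
    have "AE x in lborel. x \<in> A \<longrightarrow> \<psi> x \<le> u x"
      using uin by (simp add: Ws_obstacle_def AE_completion_iff)
    moreover have "AE x in lborel. AE t in lborel. (x, t) \<in> subgraph \<psi> A \<longrightarrow> (x, t) \<in> F"
      using obst unfolding ae_subset_def by (rule AE_lebesgue_pairD)
    ultimately have "AE x in lborel. x \<in> A \<longrightarrow> \<psi> x \<le> ?m x"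
    proof eventually_elim
      case (elim x)
      show ?case
      proof
        assume xA: "x \<in> A"
        then have le: "\<psi> x \<le> u x" using elim by blast
        obtain p q where pq: "p \<ge> 0" "q \<ge> 0"
          "emeasure lborel {t. t < u x \<and> t \<notin> fiber F x} = ennreal q"
          "p - q = u x + excess (fiber F x) (u x) - u x"
          by (rule halfline_excess_parts[OF nh[where x = x], of "u x"])
        have mF: "{t. t < u x \<and> t \<notin> fiber F x} \<in> sets borel"
        proof -
          have "{t. t < u x \<and> t \<notin> fiber F x} = {..<u x} - fiber F x" by auto
          then show ?thesis using sets_fiber[OF F] by (simp del: mem_Collect_eq)
        qed
        have "ennreal q \<le> emeasure lborel {\<psi> x..<u x}"
          unfolding pq(3)[symmetric]
        proof (rule emeasure_mono_AE)
          have "AE t in lborel. (x, t) \<in> subgraph \<psi> A \<longrightarrow> (x, t) \<in> F" using elim by blast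
          then show "AE t in lborel. t \<in> {t. t < u x \<and> t \<notin> fiber F x} \<longrightarrow> t \<in> {\<psi> x..<u x}"
            by eventually_elim (use xA in \<open>auto simp: subgraph_def\<close>)
        qed simp
        then have "q \<le> u x - \<psi> x" using le pq by simp
        then have "excess (fiber F x) (u x) \<ge> - (u x - \<psi> x)" using pq by linarith
        then have "\<theta> * excess (fiber F x) (u x) \<ge> \<theta> * (- (u x - \<psi> x))"
          using \<theta> by (intro mult_left_mono) auto
        moreover have "\<theta> * (u x - \<psi> x) \<le> 1 * (u x - \<psi> x)"
          using \<theta> le by (intro mult_right_mono) auto
        ultimately show "\<psi> x \<le> ?m x" unfolding mult_minus_right mult_1 by linarith
      qed
    qed
    then show ?thesis by (simp add: AE_completion_iff)
  qed
  ultimately show "?m \<in> Ws_obstacle s \<Omega> A \<phi> \<psi>"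
    by (simp add: Ws_obstacle_def)
qed

text \<open>
  The minimality of \<open>u\<close> enters only here, against the competitor built from \<open>F\<close>. The fraction
  \<open>\<theta>\<close> is so small that \<open>\<theta> * (2 * M)\<close>, a bound for the displacement of \<open>u\<close>, is at most \<open>\<eta>\<close>.
\<close>

lemma perimeter_gain:
  fixes u :: "real^'n \<Rightarrow> real"
  assumes s: "0 < s" "s < 1" and \<Omega>: "open \<Omega>" "bounded \<Omega>" and A: "A \<subseteq> \<Omega>"
    and u: "u \<in> borel_measurable borel" and sol: "solves_obstacle_problem s \<Omega> A \<phi> \<psi> u"
    and F: "F \<in> sets borel"
    and FU: "F - cylinder \<Omega> M = subgraph u UNIV - cylinder \<Omega> M" and M: "0 \<le> M"
    and obst: "ae_subset (subgraph \<psi> A) F" and \<eta>: "0 < \<eta>"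
  shows "Per s (subgraph u UNIV) (cylinder \<Omega> M)
      + (\<integral>\<^sup>+p. kernel_integral s p (gain \<Omega> u F \<eta> p) \<partial>lborel) \<le> Per s F (cylinder \<Omega> M)"
proof (cases "Per s F (cylinder \<Omega> M) < \<infinity>")
  case False
  then have "Per s F (cylinder \<Omega> M) = top"
    using less_top[of "Per s F (cylinder \<Omega> M)"] unfolding infinity_ennreal_def by blast
  then show ?thesis by simp
next
  case fin: True
  \<comment> \<open>Dividing by the sum, not by the height alone, keeps the fraction at most 1 and covers height 0.\<close>
  define \<theta> where "\<theta> = \<eta> / (2 * M + \<eta>)"
  have \<theta>: "0 < \<theta>" "\<theta> \<le> 1" "\<theta> * (2 * M) \<le> \<eta>"
    using M \<eta> by (auto simp: \<theta>_def field_simps add_pos_nonneg)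
  let ?m = "\<lambda>x. u x + \<theta> * excess (fiber F x) (u x)" and ?U = "subgraph u UNIV" and ?Q = "Qset (cylinder \<Omega> M)"
  have uin: "u \<in> Ws_obstacle s \<Omega> A \<phi> \<psi>" using sol by (simp add: solves_obstacle_problem_def)
  note mm = competitor_in_Ws_obstacle(1)[OF s \<Omega> A u uin F FU M obst fin \<theta>(1,2)]
    and mW = competitor_in_Ws_obstacle(2)[OF s \<Omega> A u uin F FU M obst fin \<theta>(1,2)]
  note out = excess_fiber_outside[OF u F FU M]
  have Om: "\<Omega> \<in> sets borel" using \<Omega> by simp
  have U: "?U \<in> sets borel" by (rule sets_subgraph[OF u])
  define pU where "pU = (\<lambda>p. kernel_integral s p (sect (disagree ?U \<inter> ?Q) p))"
  define pF where "pF = (\<lambda>p. kernel_integral s p (sect (disagree F \<inter> ?Q) p))"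
  define pG where "pG = (\<lambda>p. kernel_integral s p (gain \<Omega> u F \<eta> p))"
  have QF: "disagree F \<inter> ?Q \<in> sets borel" and QU: "disagree ?U \<inter> ?Q \<in> sets borel"
    by (intro sets.Int sets_disagree F U sets_Qset sets_cylinder \<Omega>)+
  have c: "(\<lambda>w :: ((real^'n) \<times> (real^'n)) \<times> real. fst w) \<in> borel_measurable borel"
    "(\<lambda>w :: ((real^'n) \<times> (real^'n)) \<times> real. snd w) \<in> borel_measurable borel"
    by (intro borel_measurable_continuous_onI continuous_intros)+
  have pm1: "pU \<in> borel_measurable borel"
    unfolding pU_def
    by (rule measurable_nn_integral_pkern, rule measurable_sect[OF QU c])
  have pm2: "pF \<in> borel_measurable borel"
    unfolding pF_def
    by (rule measurable_nn_integral_pkern, rule measurable_sect[OF QF c])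
  have pm3: "pG \<in> borel_measurable borel"
    unfolding pG_def
    by (rule measurable_nn_integral_pkern, rule measurable_gain[OF F u Om c])
  have pm: "pU \<in> borel_measurable lborel" "pF \<in> borel_measurable lborel" "pG \<in> borel_measurable lborel"
    using pm1 pm2 pm3 by simp_all
  let ?e = "\<lambda>p. 2 * (indicator (Qset \<Omega>) p *\<^sub>R energy_diff s u ?m p)"
  note en = energy_diff_integral[OF u mm \<Omega>(1) sol mW]
  have "(\<integral>\<^sup>+p. ennreal \<theta> * (pU p + pG p) \<partial>lborel) \<le> (\<integral>\<^sup>+p. ennreal \<theta> * pF p \<partial>lborel)"
  proof (rule nn_integral_le_by_energy)
    show "integrable lborel ?e" by (intro integrable_mult_right en(1))
    show "(LINT p|lborel. ?e p) \<le> 0" using en(2) by (simp only: integral_mult_right_zero)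
    show "AE p in lborel. 0 \<le> interaction s ?m p \<and> 0 \<le> interaction s u p \<and>
        ennreal \<theta> * (pU p + pG p) + ennreal (interaction s ?m p) \<le> ennreal \<theta> * pF p + ennreal (interaction s u p) \<and>
        interaction s u p - interaction s ?m p = ?e p"
      using AE_lborel_pair_neq
    proof eventually_elim
      case (elim p)
      have 1: "ennreal \<theta> * (pU p + pG p) + ennreal (interaction s ?m p) \<le> ennreal \<theta> * pF p + ennreal (interaction s u p)"
        unfolding pU_def pF_def pG_def by (rule integrated_slice_inequality[OF s(1) \<Omega>(1) u F FU M \<theta> elim])
      have 2: "interaction s u p - interaction s ?m p = ?e p"
      proof (cases "p \<in> Qset \<Omega>")
        case True
        then show ?thesis by (simp add: interaction_diff_eq[OF s(1)])
      next
        case False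
        then have "fst p \<notin> \<Omega>" "snd p \<notin> \<Omega>" by (auto simp: Qset_def mem_Times_iff)
        then have "excess (fiber F (fst p)) (u (fst p)) = 0" "excess (fiber F (snd p)) (u (snd p)) = 0"
          by (auto intro: out)
        then have "interaction s ?m p = interaction s u p"
          unfolding interaction_def by (simp only: mult_zero_right add_0_right)
        then show ?thesis using False by simp
      qed
      show ?case using 1 2 interaction_nonneg by blast
    qed
  qed (use pm in \<open>auto intro!: borel_measurable_times_ennreal borel_measurable_add\<close>)
  then have "ennreal \<theta> * ((\<integral>\<^sup>+p. pU p \<partial>lborel) + (\<integral>\<^sup>+p. pG p \<partial>lborel)) \<le> ennreal \<theta> * (\<integral>\<^sup>+p. pF p \<partial>lborel)"
    by (simp only: nn_integral_cmult[OF borel_measurable_add[OF pm(1,3)]] nn_integral_cmult[OF pm(2)] nn_integral_add[OF pm(1,3)])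
  then have "(\<integral>\<^sup>+p. pU p \<partial>lborel) + (\<integral>\<^sup>+p. pG p \<partial>lborel) \<le> (\<integral>\<^sup>+p. pF p \<partial>lborel)"
    using \<theta>(1) by (subst (asm) ennreal_mult_le_mult_iff) auto
  then show ?thesis
    unfolding Per_slices[OF U sets_cylinder[OF \<Omega>(1)]] Per_slices[OF F sets_cylinder[OF \<Omega>(1)]]
    by (simp only: pU_def pF_def pG_def)
qed

section \<open>Finiteness of the perimeter of the subgraph\<close>

lemma GGs_increment:
  assumes "0 < h" "b \<le> a"
  shows "h * Gs n s b \<le> GGs n s (a + h) - GGs n s a"
proof -
  obtain z where z: "a < z" "z < a + h" "GGs n s (a + h) - GGs n s a = (a + h - a) * Gs n s z"
    using MVT2[of a "a + h" "GGs n s" "Gs n s"] DERIV_GGs assms by auto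
  have "Gs n s b \<le> Gs n s z" using Gs_strict_mono[of b z n s] z assms by simp
  then show ?thesis using z(3) assms by simp
qed

lemma Linf_loc_bounded_on_ball:
  assumes "Linf_loc (\<phi> :: 'a::euclidean_space \<Rightarrow> real)"
  obtains C where "0 \<le> C" "AE y in lebesgue. y \<in> cball 0 R \<longrightarrow> \<bar>\<phi> y\<bar> \<le> C"
proof -
  have "Linf (cball 0 R) \<phi>" using assms by (simp add: Linf_loc_def)
  then have fin: "Linf_norm (cball 0 R) \<phi> < \<infinity>" by (simp add: Linf_def)
  have nn: "0 \<le> Linf_norm (cball 0 R) \<phi>" by (simp add: Linf_norm_def)
  define C where "C = real_of_ereal (Linf_norm (cball 0 R) \<phi>)"
  have C: "Linf_norm (cball 0 R) \<phi> = ereal C" "0 \<le> C"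
    using fin nn by (auto simp: C_def real_of_ereal_pos ereal_real')
  have "AE y in lebesgue_on (cball 0 R). ereal \<bar>\<phi> y\<bar> \<le> esssup (lebesgue_on (cball 0 R)) (\<lambda>x. ereal \<bar>\<phi> x\<bar>)"
    by (rule esssup_AE)
  then have "AE y in lebesgue_on (cball 0 R). \<bar>\<phi> y\<bar> \<le> C"
  proof eventually_elim
    case (elim y)
    also have "esssup (lebesgue_on (cball 0 R)) (\<lambda>x. ereal \<bar>\<phi> x\<bar>) \<le> Linf_norm (cball 0 R) \<phi>"
      by (simp add: Linf_norm_def)
    finally show ?case using C by simp
  qed
  then have "AE y in lebesgue. y \<in> cball 0 R \<longrightarrow> \<bar>\<phi> y\<bar> \<le> C"
    by (subst (asm) AE_restrict_space_iff) auto
  with C(2) show ?thesis by (rule that)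
qed

text \<open>
  Truncation from below contracts differences inside \<open>\<Omega>\<close>, and adding a constant there does not
  change them; both operations raise \<open>u\<close> and so respect the obstacle.
\<close>

lemma truncated_in_Ws_obstacle:
  fixes u :: "real^'n \<Rightarrow> real" and b c :: real
  assumes \<Omega>: "open \<Omega>" "bounded \<Omega>" and A: "A \<subseteq> \<Omega>" and u: "u \<in> borel_measurable borel"
    and uin: "u \<in> Ws_obstacle s \<Omega> A \<phi> \<psi>" and b: "0 \<le> b"
  defines "v \<equiv> \<lambda>x. if x \<in> \<Omega> then max (u x) c + b else u x"
  shows "v \<in> borel_measurable borel" "v \<in> Ws_obstacle s \<Omega> A \<phi> \<psi>"
proof -
  have Om: "\<Omega> \<in> sets borel" using \<Omega> by simp
  show vm: "v \<in> borel_measurable borel"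
    unfolding v_def using u Om by (intro measurable_If) auto
  have "(\<integral>\<^sup>+x. ennreal \<bar>v x\<bar> * indicator \<Omega> x \<partial>lebesgue)
      \<le> (\<integral>\<^sup>+x. ennreal \<bar>u x\<bar> * indicator \<Omega> x + ennreal (\<bar>c\<bar> + b) * indicator \<Omega> x \<partial>lebesgue)"
  proof (rule nn_integral_mono)
    fix x
    have "\<bar>max (u x) c + b\<bar> \<le> \<bar>u x\<bar> + (\<bar>c\<bar> + b)"
      using b by (cases "u x \<le> c") (auto simp: max_def abs_if)
    then have "ennreal \<bar>max (u x) c + b\<bar> \<le> ennreal (\<bar>u x\<bar> + (\<bar>c\<bar> + b))" by (rule ennreal_leI)
    also have "\<dots> = ennreal \<bar>u x\<bar> + ennreal (\<bar>c\<bar> + b)" using b by (intro ennreal_plus) auto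
    finally show "ennreal \<bar>v x\<bar> * indicator \<Omega> x \<le> ennreal \<bar>u x\<bar> * indicator \<Omega> x + ennreal (\<bar>c\<bar> + b) * indicator \<Omega> x"
      by (simp add: indicator_def v_def)
  qed
  also have "\<dots> = (\<integral>\<^sup>+x. ennreal \<bar>u x\<bar> * indicator \<Omega> x \<partial>lebesgue) + ennreal (\<bar>c\<bar> + b) * emeasure lborel \<Omega>"
    unfolding nn_integral_completion
    using Om u by (subst nn_integral_add) (simp_all add: nn_integral_cmult_indicator)
  also have "\<dots> < \<infinity>"
    using uin emeasure_bounded_finite[OF \<Omega>(2)] by (simp add: ennreal_mult_less_top Ws_obstacle_def Ws_def)
  finally have 1: "(\<integral>\<^sup>+x. ennreal \<bar>v x\<bar> * indicator \<Omega> x \<partial>lebesgue) < \<infinity>" .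
  have "(\<integral>\<^sup>+z\<in>\<Omega> \<times> \<Omega>. ennreal (\<bar>v (fst z) - v (snd z)\<bar> / norm (fst z - snd z) powr (real CARD('n) + s)) \<partial>lebesgue)
     \<le> (\<integral>\<^sup>+z\<in>\<Omega> \<times> \<Omega>. ennreal (\<bar>u (fst z) - u (snd z)\<bar> / norm (fst z - snd z) powr (real CARD('n) + s)) \<partial>lebesgue)"
  proof (rule nn_integral_mono)
    fix z :: "(real^'n) \<times> (real^'n)"
    have "\<bar>v (fst z) - v (snd z)\<bar> \<le> \<bar>u (fst z) - u (snd z)\<bar>" if "z \<in> \<Omega> \<times> \<Omega>"
      using that by (auto simp: v_def max_def)
    then show "ennreal (\<bar>v (fst z) - v (snd z)\<bar> / norm (fst z - snd z) powr (real CARD('n) + s)) * indicator (\<Omega> \<times> \<Omega>) z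
       \<le> ennreal (\<bar>u (fst z) - u (snd z)\<bar> / norm (fst z - snd z) powr (real CARD('n) + s)) * indicator (\<Omega> \<times> \<Omega>) z"
      by (cases "z \<in> \<Omega> \<times> \<Omega>") (auto intro!: ennreal_leI divide_right_mono)
  qed
  also have "\<dots> < \<infinity>" using uin by (simp add: Ws_obstacle_def Ws_def)
  finally have "v \<in> Ws s \<Omega>"
    using 1 borel_imp_lebesgue[OF vm] by (simp add: Ws_def)
  moreover have "AE x in lebesgue. x \<notin> \<Omega> \<longrightarrow> v x = \<phi> x"
    using uin by (simp add: Ws_obstacle_def v_def)
  moreover have "AE x in lebesgue. x \<in> A \<longrightarrow> \<psi> x \<le> v x"
  proof -
    have "AE x in lebesgue. x \<in> A \<longrightarrow> \<psi> x \<le> u x" using uin by (simp add: Ws_obstacle_def)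
    then show ?thesis by eventually_elim (use A b in \<open>auto simp: v_def\<close>)
  qed
  ultimately show "v \<in> Ws_obstacle s \<Omega> A \<phi> \<psi>" by (simp add: Ws_obstacle_def)
qed

text \<open>
  Inside \<open>\<Omega>\<close>, compare \<open>u\<close> with its truncation from below at a level above a bound for \<open>u\<close> near
  \<open>\<Omega>\<close>, and with that truncation raised by 1. Both energy differences are integrable, hence so is
  the energy difference of the two truncations. Between a point of \<open>\<Omega>\<close> and a nearby point
  outside, both slopes are at least \<open>1 / (2 * R)\<close>, so that \<open>Gs\<close> is bounded below between them
  and the density is at least a constant times the distance to the power \<open>- n - s\<close>.
\<close>

lemma boundary_interaction_finite:
  fixes u :: "real^'n \<Rightarrow> real"
  assumes s: "0 < s" "s < 1" and \<Omega>: "open \<Omega>" "bounded \<Omega>" and A: "A \<subseteq> \<Omega>"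
    and u: "u \<in> borel_measurable borel" and sol: "solves_obstacle_problem s \<Omega> A \<phi> \<psi> u"
    and \<phi>: "Linf_loc \<phi>"
  shows "(\<integral>\<^sup>+p. indicator (\<Omega> \<times> - \<Omega>) p * ennreal (norm (fst p - snd p) powr (- (real CARD('n) + s))) \<partial>lborel) < \<infinity>"
proof -
  obtain B where B: "B > 0" "\<And>x. x \<in> \<Omega> \<Longrightarrow> norm x \<le> B"
    using \<Omega>(2) by (auto simp: bounded_pos)
  define R where "R = B + 1"
  have R: "R > 0" using B by (simp add: R_def)
  obtain C where C: "0 \<le> C" "AE y in lebesgue. y \<in> cball 0 R \<longrightarrow> \<bar>\<phi> y\<bar> \<le> C"
    using Linf_loc_bounded_on_ball[OF \<phi>, of R] by blast
  have uin: "u \<in> Ws_obstacle s \<Omega> A \<phi> \<psi>" using sol by (simp add: solves_obstacle_problem_def)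
  define v where "v = (\<lambda>b x. if x \<in> \<Omega> then max (u x) (C + 1) + b else u x)"
  have v: "v b \<in> borel_measurable borel" "v b \<in> Ws_obstacle s \<Omega> A \<phi> \<psi>" if "0 \<le> b" for b
    unfolding v_def using truncated_in_Ws_obstacle[OF \<Omega> A u uin that] by blast+
  let ?e = "\<lambda>b p. indicator (Qset \<Omega>) p *\<^sub>R energy_diff s u (v b) p"
  let ?h = "\<lambda>p. ?e 0 p - ?e 1 p"
  have hi: "integrable lborel ?h"
    by (intro Bochner_Integration.integrable_diff energy_diff_integral(1)[OF u v(1) \<Omega>(1) sol v(2)]) auto
  \<comment> \<open>The lower bound for the derivative of the density on slopes that occur near the boundary.\<close>
  define c0 where "c0 = Gs CARD('n) s (1 / (2 * R))"
  have c0: "c0 > 0" using Gs_strict_mono[of 0 "1 / (2 * R)" "CARD('n)" s] R by (simp add: c0_def Gs_0)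
  let ?N = "\<lambda>p :: (real^'n) \<times> (real^'n). norm (fst p - snd p) powr (- (real CARD('n) + s))"
  have "AE y in lebesgue. y \<notin> \<Omega> \<longrightarrow> u y = \<phi> y" using uin by (simp add: Ws_obstacle_def)
  with C(2) have "AE y in lebesgue. y \<in> cball 0 R - \<Omega> \<longrightarrow> \<bar>u y\<bar> \<le> C"
    by eventually_elim auto
  then have "AE p in (lebesgue :: ((real^'n) \<times> (real^'n)) measure). snd p \<in> cball 0 R - \<Omega> \<longrightarrow> \<bar>u (snd p)\<bar> \<le> C"
    by (rule AE_lebesgue_snd)
  then have bd: "AE p in (lborel :: ((real^'n) \<times> (real^'n)) measure). snd p \<in> cball 0 R - \<Omega> \<longrightarrow> \<bar>u (snd p)\<bar> \<le> C"
    by (simp add: AE_completion_iff)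
  have near: "(\<integral>\<^sup>+p. indicator (\<Omega> \<times> (cball 0 R - \<Omega>)) p * ennreal (?N p) \<partial>lborel) < \<infinity>"
  proof -
    have "(\<integral>\<^sup>+p. indicator (\<Omega> \<times> (cball 0 R - \<Omega>)) p * ennreal (?N p) \<partial>lborel)
      \<le> (\<integral>\<^sup>+p. ennreal (1 / c0) * ennreal (norm (?h p)) \<partial>lborel)"
    proof (rule nn_integral_mono_AE, use bd AE_lborel_pair_neq in eventually_elim)
      case (elim p)
      show ?case
      proof (cases "p \<in> \<Omega> \<times> (cball 0 R - \<Omega>)")
        case True
        then have x: "fst p \<in> \<Omega>" and y: "snd p \<in> cball 0 R" "snd p \<notin> \<Omega>" by (auto simp: mem_Times_iff)
        have uy: "\<bar>u (snd p)\<bar> \<le> C" using elim(1) y by blast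
        let ?r = "norm (fst p - snd p)"
        have r: "0 < ?r" using elim(2) by simp
        have "?r \<le> norm (fst p) + norm (snd p)" by (rule norm_triangle_ineq4)
        then have r2: "?r \<le> 2 * R" using B(2)[OF x] y(1) by (simp add: R_def)
        define a where "a = (v 0 (fst p) - v 0 (snd p)) / ?r"
        have a1: "(v 1 (fst p) - v 1 (snd p)) / ?r = a + 1 / ?r"
          using x y by (simp add: a_def v_def add_divide_distrib[symmetric])
        have "1 \<le> v 0 (fst p) - v 0 (snd p)" using x y uy by (auto simp: v_def max_def)
        then have "1 / ?r \<le> a" unfolding a_def using r by (intro divide_right_mono) auto
        moreover have "1 / (2 * R) \<le> 1 / ?r" using r r2 R by (intro divide_left_mono mult_pos_pos) auto
        ultimately have "1 / (2 * R) \<le> a" by linarith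
        then have inc: "(1 / ?r) * c0 \<le> GGs CARD('n) s (a + 1 / ?r) - GGs CARD('n) s a"
          unfolding c0_def using r by (intro GGs_increment) auto
        have pQ: "p \<in> Qset \<Omega>" using x by (auto simp: Qset_def mem_Times_iff)
        have "?h p = (GGs CARD('n) s (a + 1 / ?r) - GGs CARD('n) s a) / ?r powr (real CARD('n) - 1 + s)"
        proof -
          let ?g = "GGs CARD('n) s ((u (fst p) - u (snd p)) / ?r)" and ?q = "?r powr (real CARD('n) - 1 + s)"
          have "energy_diff s u (v 0) p = (?g - GGs CARD('n) s a) / ?q"
            unfolding energy_diff_def case_prod_beta a_def by (rule refl)
          moreover have "energy_diff s u (v 1) p = (?g - GGs CARD('n) s (a + 1 / ?r)) / ?q"
            unfolding energy_diff_def case_prod_beta a1 by (rule refl)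
          ultimately show ?thesis using pQ by (simp add: diff_divide_distrib)
        qed
        also have "\<dots> \<ge> ((1 / ?r) * c0) / ?r powr (real CARD('n) - 1 + s)"
          by (intro divide_right_mono inc) simp
        also have "((1 / ?r) * c0) / ?r powr (real CARD('n) - 1 + s) = c0 * ?N p"
        proof -
          have "?r powr (- (real CARD('n) - 1 + s)) * (c0 * (1 / ?r)) = c0 * (1 / ?r powr (real CARD('n) + s))"
            by (rule powr_shift[OF r])
          then show ?thesis by (simp only: powr_minus divide_inverse mult_1_left mult_ac)
        qed
        finally have "c0 * ?N p \<le> norm (?h p)" unfolding real_norm_def by linarith
        then have "?N p \<le> (1 / c0) * norm (?h p)" using c0 by (simp add: field_simps)
        then have "ennreal (?N p) \<le> ennreal ((1 / c0) * norm (?h p))" by (rule ennreal_leI)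
        also have "\<dots> = ennreal (1 / c0) * ennreal (norm (?h p))" using c0 by (intro ennreal_mult') simp
        finally show ?thesis using True by simp
      qed simp
    qed
    also have "\<dots> = ennreal (1 / c0) * (\<integral>\<^sup>+p. ennreal (norm (?h p)) \<partial>lborel)"
      by (rule nn_integral_cmult[OF measurable_compose[OF borel_measurable_integrable[OF integrable_norm[OF hi]] measurable_ennreal]])
    also have "\<dots> < \<infinity>"
    proof -
      have "(\<integral>\<^sup>+p. ennreal (norm (?h p)) \<partial>lborel) < \<infinity>"
        using hi unfolding integrable_iff_bounded by blast
      then show ?thesis unfolding infinity_ennreal_def ennreal_mult_less_top by simp
    qed
    finally show ?thesis .
  qed
  have far: "(\<integral>\<^sup>+p. indicator {p. fst p \<in> \<Omega> \<and> 1 \<le> norm (fst p - snd p)} p * ennreal (?N p) \<partial>lborel) < \<infinity>"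
    using nn_integral_far_pairs[of \<Omega> "real CARD('n) + s"] \<Omega> s by simp
  have Nm: "?N \<in> borel_measurable borel"
    by (intro powr_real_measurable borel_measurable_const borel_measurable_continuous_onI continuous_intros)
  have Om: "\<Omega> \<in> sets borel" using \<Omega> by simp
  have m1: "\<Omega> \<times> (cball 0 R - \<Omega>) \<in> sets borel" using Om by (intro borel_Times) auto
  have m2: "{p :: (real^'n) \<times> (real^'n). fst p \<in> \<Omega> \<and> 1 \<le> norm (fst p - snd p)} \<in> sets borel"
  proof -
    have "{p :: (real^'n) \<times> (real^'n). fst p \<in> \<Omega> \<and> 1 \<le> norm (fst p - snd p)} =
      (\<Omega> \<times> UNIV) \<inter> {p. 1 \<le> norm (fst p - snd p)}" by auto
    moreover have "closed {p :: (real^'n) \<times> (real^'n). 1 \<le> norm (fst p - snd p)}"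
      by (intro closed_Collect_le continuous_intros)
    ultimately show ?thesis using Om by (auto intro!: borel_Times sets.Int)
  qed
  have "(\<integral>\<^sup>+p. indicator (\<Omega> \<times> - \<Omega>) p * ennreal (?N p) \<partial>lborel) \<le>
     (\<integral>\<^sup>+p. indicator (\<Omega> \<times> (cball 0 R - \<Omega>)) p * ennreal (?N p)
        + indicator {p. fst p \<in> \<Omega> \<and> 1 \<le> norm (fst p - snd p)} p * ennreal (?N p) \<partial>lborel)"
  proof (rule nn_integral_mono)
    fix p :: "(real^'n) \<times> (real^'n)"
    have "1 \<le> norm (fst p - snd p)" if "fst p \<in> \<Omega>" "snd p \<notin> cball 0 R"
      using B(2)[OF that(1)] that(2) norm_triangle_ineq2[of "snd p" "fst p"]
      by (simp add: R_def norm_minus_commute)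
    then show "indicator (\<Omega> \<times> - \<Omega>) p * ennreal (?N p) \<le> indicator (\<Omega> \<times> (cball 0 R - \<Omega>)) p * ennreal (?N p)
        + indicator {p. fst p \<in> \<Omega> \<and> 1 \<le> norm (fst p - snd p)} p * ennreal (?N p)"
      by (cases p) (auto simp: indicator_def)
  qed
  also have "\<dots> < \<infinity>"
    using near far Nm m1 m2 by (subst nn_integral_add) auto
  finally show ?thesis .
qed

lemma nn_integral_lborel_swap:
  fixes f :: "'a::euclidean_space \<times> 'a \<Rightarrow> ennreal"
  assumes f: "f \<in> borel_measurable borel"
  shows "(\<integral>\<^sup>+p. f (snd p, fst p) \<partial>lborel) = (\<integral>\<^sup>+p. f p \<partial>lborel)"
proof -
  have f': "(\<lambda>p. f (snd p, fst p)) \<in> borel_measurable borel"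
    by (rule measurable_compose[OF _ f]) (intro borel_measurable_continuous_onI continuous_intros)
  have "(\<integral>\<^sup>+p. f (snd p, fst p) \<partial>lborel) = (\<integral>\<^sup>+x. \<integral>\<^sup>+y. f (y, x) \<partial>lborel \<partial>lborel)"
    by (subst nn_integral_lborel_pair[OF f']) simp
  also have "\<dots> = (\<integral>\<^sup>+y. \<integral>\<^sup>+x. f (y, x) \<partial>lborel \<partial>lborel)"
    by (rule nn_integral_lborel_pair_swap[OF f'])
  also have "\<dots> = (\<integral>\<^sup>+p. f p \<partial>lborel)" by (rule nn_integral_lborel_pair[OF f, symmetric])
  finally show ?thesis .
qed

lemma sect_mono: "S \<subseteq> T \<Longrightarrow> sect S p \<sigma> \<le> sect T p \<sigma>"
  unfolding sect_def by (intro nn_integral_mono) (auto simp: indicator_def)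

lemma sect_empty: "(\<And>t. ((fst p, t), (snd p, t - \<sigma>)) \<notin> S) \<Longrightarrow> sect S p \<sigma> = 0"
  unfolding sect_def by simp

lemma sect_le_interval:
  assumes "\<And>t. ((fst p, t), (snd p, t - \<sigma>)) \<in> S \<Longrightarrow> a < t \<and> t < b" and "a \<le> b"
  shows "sect S p \<sigma> \<le> ennreal (b - a)"
proof -
  have "sect S p \<sigma> \<le> (\<integral>\<^sup>+t. indicator {a<..<b} t \<partial>lborel)"
    unfolding sect_def using assms(1) by (intro nn_integral_mono) (auto simp: indicator_def)
  also have "\<dots> = ennreal (b - a)" using assms(2) by simp
  finally show ?thesis .
qed

lemma nn_integral_pkern_le:
  fixes p :: "'a::euclidean_space \<times> 'a"
  assumes s: "0 < s" and p: "fst p \<noteq> snd p" and h: "\<And>\<sigma>. h \<sigma> \<le> ennreal c" and c: "0 \<le> c"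
  shows "(\<integral>\<^sup>+\<sigma>. pkern s p \<sigma> * h \<sigma> \<partial>lborel) \<le>
     ennreal (c * mass_gs DIM('a) s) * ennreal (norm (fst p - snd p) powr (- (real DIM('a) + s)))"
proof -
  have m: "pkern s p \<in> borel_measurable lborel"
    using measurable_pkern[of "\<lambda>_. p" borel "\<lambda>\<sigma>. \<sigma>" s] by simp
  have "(\<integral>\<^sup>+\<sigma>. pkern s p \<sigma> * h \<sigma> \<partial>lborel) \<le> (\<integral>\<^sup>+\<sigma>. pkern s p \<sigma> * ennreal c \<partial>lborel)"
    by (intro nn_integral_mono mult_left_mono h) simp
  also have "\<dots> = ennreal (norm (fst p - snd p) powr (- (real DIM('a) + s)) * mass_gs DIM('a) s) * ennreal c"
    by (simp only: nn_integral_multc[OF m] nn_integral_pkern[OF s p])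
  also have "\<dots> = ennreal (c * mass_gs DIM('a) s) * ennreal (norm (fst p - snd p) powr (- (real DIM('a) + s)))"
  proof -
    have ms: "0 \<le> mass_gs DIM('a) s" using mass_gs_pos[OF s, of "DIM('a)"] by (simp add: less_imp_le)
    have "ennreal (norm (fst p - snd p) powr (- (real DIM('a) + s)) * mass_gs DIM('a) s) * ennreal c
      = ennreal (norm (fst p - snd p) powr (- (real DIM('a) + s)) * mass_gs DIM('a) s * c)"
      using ms by (intro ennreal_mult'[symmetric]) simp
    also have "norm (fst p - snd p) powr (- (real DIM('a) + s)) * mass_gs DIM('a) s * c =
      (c * mass_gs DIM('a) s) * norm (fst p - snd p) powr (- (real DIM('a) + s))" by (simp only: mult_ac)
    also have "ennreal \<dots> = ennreal (c * mass_gs DIM('a) s) * ennreal (norm (fst p - snd p) powr (- (real DIM('a) + s)))"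
      using ms c by (intro ennreal_mult') simp
    finally show ?thesis .
  qed
  finally show ?thesis .
qed

text \<open>
  Pairs inside \<open>\<Omega>\<close> contribute at most the energy of \<open>u\<close>. For pairs across the boundary of \<open>\<Omega>\<close>
  the point inside the cylinder has height in an interval of length \<open>2 * M\<close>.
\<close>

lemma Per_subgraph_finite:
  fixes u :: "real^'n \<Rightarrow> real"
  assumes s: "0 < s" "s < 1" and \<Omega>: "open \<Omega>" "bounded \<Omega>" and A: "A \<subseteq> \<Omega>"
    and u: "u \<in> borel_measurable borel" and sol: "solves_obstacle_problem s \<Omega> A \<phi> \<psi> u"
    and \<phi>: "Linf_loc \<phi>" and M: "0 \<le> M"
  shows "Per s (subgraph u UNIV) (cylinder \<Omega> M) < \<infinity>"
proof -
  let ?U = "subgraph u UNIV" and ?Q = "Qset (cylinder \<Omega> M)"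
  let ?N = "\<lambda>p :: (real^'n) \<times> (real^'n). ennreal (norm (fst p - snd p) powr (- (real CARD('n) + s)))"
  let ?J = "\<lambda>p. indicator (\<Omega> \<times> - \<Omega>) p * ?N p"
  let ?c = "ennreal (2 * M * mass_gs CARD('n) s)"
  let ?I = "\<lambda>p. indicator (\<Omega> \<times> \<Omega>) p * ennreal (interaction s u p)"
  have U: "?U \<in> sets borel" by (rule sets_subgraph[OF u])
  have Om: "\<Omega> \<in> sets borel" using \<Omega> by simp
  have QU: "disagree ?U \<inter> ?Q \<in> sets borel"
    by (intro sets.Int sets_disagree U sets_Qset sets_cylinder \<Omega>)
  have Nm: "(\<lambda>p :: (real^'n) \<times> (real^'n). norm (fst p - snd p) powr (- (real CARD('n) + s))) \<in> borel_measurable borel"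
    by (intro powr_real_measurable borel_measurable_const borel_measurable_continuous_onI continuous_intros)
  have "\<Omega> \<times> - \<Omega> \<in> sets borel" "\<Omega> \<times> \<Omega> \<in> sets borel" using Om by (auto intro!: borel_Times)
  then have J: "?J \<in> borel_measurable borel" and I: "?I \<in> borel_measurable borel"
    using Nm measurable_interaction[OF s(1) u] by simp_all
  have sw: "(\<lambda>p :: (real^'n) \<times> (real^'n). (snd p, fst p)) \<in> borel_measurable borel"
    by (intro borel_measurable_continuous_onI continuous_intros)
  have J': "(\<lambda>p. ?J (snd p, fst p)) \<in> borel_measurable borel"
    by (rule measurable_compose[OF sw J])
  have pt: "AE p in lborel. kernel_integral s p (sect (disagree ?U \<inter> ?Q) p)
      \<le> ?I p + (?c * ?J p + ?c * ?J (snd p, fst p))"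
    using AE_lborel_pair_neq
  proof eventually_elim
    case (elim p)
    consider "fst p \<in> \<Omega>" "snd p \<in> \<Omega>" | "fst p \<in> \<Omega>" "snd p \<notin> \<Omega>" | "fst p \<notin> \<Omega>" "snd p \<in> \<Omega>"
      | "fst p \<notin> \<Omega>" "snd p \<notin> \<Omega>" by blast
    then show ?case
    proof cases
      case 1
      have "kernel_integral s p (sect (disagree ?U \<inter> ?Q) p)
        \<le> (\<integral>\<^sup>+\<sigma>. pkern s p \<sigma> * ennreal \<bar>u (fst p) - u (snd p) - \<sigma>\<bar> \<partial>lborel)"
      proof (intro nn_integral_mono mult_left_mono)
        fix \<sigma>
        have "sect (disagree ?U \<inter> ?Q) p \<sigma> \<le> sect (disagree ?U) p \<sigma>" by (rule sect_mono) simp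
        also have "\<dots> = ennreal \<bar>u (fst p) - u (snd p) - \<sigma>\<bar>"
          using sect_disagree_subgraph[OF u, of "fst p" "snd p" \<sigma>] by simp
        finally show "sect (disagree ?U \<inter> ?Q) p \<sigma> \<le> ennreal \<bar>u (fst p) - u (snd p) - \<sigma>\<bar>" .
      qed simp
      also have "\<dots> = ?I p" using 1 nn_integral_pkern_abs[OF s(1) elim, of u] by (simp add: indicator_def mem_Times_iff)
      finally show ?thesis by (simp add: add_increasing2)
    next
      case 2
      have "sect (disagree ?U \<inter> ?Q) p \<sigma> \<le> ennreal (2 * M)" for \<sigma>
        using sect_le_interval[of p \<sigma> "disagree ?U \<inter> ?Q" "- M" M] 2 M by (auto simp: Qset_def cylinder_def)
      then have "kernel_integral s p (sect (disagree ?U \<inter> ?Q) p) \<le> ?c * ?N p"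
        using nn_integral_pkern_le[OF s(1) elim, of "sect (disagree ?U \<inter> ?Q) p" "2 * M"] M by simp
      also have "\<dots> = ?c * ?J p" using 2 by (simp add: indicator_def mem_Times_iff)
      finally show ?thesis by (simp add: add_increasing add_increasing2)
    next
      case 3
      have "sect (disagree ?U \<inter> ?Q) p \<sigma> \<le> ennreal (2 * M)" for \<sigma>
        using sect_le_interval[of p \<sigma> "disagree ?U \<inter> ?Q" "\<sigma> - M" "\<sigma> + M"] 3 M by (auto simp: Qset_def cylinder_def)
      then have "kernel_integral s p (sect (disagree ?U \<inter> ?Q) p) \<le> ?c * ?N p"
        using nn_integral_pkern_le[OF s(1) elim, of "sect (disagree ?U \<inter> ?Q) p" "2 * M"] M by simp
      also have "\<dots> = ?c * ?J (snd p, fst p)"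
        using 3 by (simp add: indicator_def norm_minus_commute)
      finally show ?thesis by (simp add: add_increasing)
    next
      case 4
      then have "sect (disagree ?U \<inter> ?Q) p \<sigma> = 0" for \<sigma>
        by (intro sect_empty) (auto simp: Qset_def cylinder_def)
      then show ?thesis by simp
    qed
  qed
  have "Per s ?U (cylinder \<Omega> M) \<le> (\<integral>\<^sup>+p. ?I p + (?c * ?J p + ?c * ?J (snd p, fst p)) \<partial>lborel)"
    unfolding Per_slices[OF U sets_cylinder[OF \<Omega>(1)]] by (rule nn_integral_mono_AE[OF pt])
  also have "\<dots> = (\<integral>\<^sup>+p. ?I p \<partial>lborel) + (?c * (\<integral>\<^sup>+p. ?J p \<partial>lborel) + ?c * (\<integral>\<^sup>+p. ?J (snd p, fst p) \<partial>lborel))"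
  proof -
    have l1: "?I \<in> borel_measurable lborel" using I by simp
    have l2: "?J \<in> borel_measurable lborel" using J by simp
    have l3: "(\<lambda>p. ?J (snd p, fst p)) \<in> borel_measurable lborel" by (rule borel_imp_lborel[OF J'])
    note l = l1 l2 l3
    note cm = borel_measurable_times_ennreal[OF borel_measurable_const]
    show ?thesis
      by (simp only: nn_integral_add[OF l(1) borel_measurable_add[OF cm[OF l(2)] cm[OF l(3)]]]
          nn_integral_add[OF cm[OF l(2)] cm[OF l(3)]] nn_integral_cmult[OF l(2)] nn_integral_cmult[OF l(3)])
  qed
  also have "(\<integral>\<^sup>+p. ?J (snd p, fst p) \<partial>lborel) = (\<integral>\<^sup>+p. ?J p \<partial>lborel)"
    by (rule nn_integral_lborel_swap[OF J])
  also have "(\<integral>\<^sup>+p. ?I p \<partial>lborel) + (?c * (\<integral>\<^sup>+p. ?J p \<partial>lborel) + ?c * (\<integral>\<^sup>+p. ?J p \<partial>lborel)) < \<infinity>"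
  proof -
    have "(\<integral>\<^sup>+p. ?J p \<partial>lborel) < \<infinity>" by (rule boundary_interaction_finite[OF s \<Omega> A u sol \<phi>])
    moreover have "(\<integral>\<^sup>+p. ?I p \<partial>lborel) < \<infinity>"
      using sol Ws_iff[OF u \<Omega> s] by (auto simp: solves_obstacle_problem_def Ws_obstacle_def)
    ultimately show ?thesis by (simp add: ennreal_mult_less_top)
  qed
  finally show ?thesis .
qed

section \<open>Exchanging two sets inside a cylinder\<close>

lemma AE_lborel_ex_open:
  fixes S :: "'a::euclidean_space set"
  assumes P: "AE x in lborel. P x" and S: "open S" "S \<noteq> {}"
  shows "\<exists>x\<in>S. P x"
proof (rule ccontr)
  assume "\<not> (\<exists>x\<in>S. P x)"
  obtain N where N: "N \<in> null_sets lborel" "\<And>x. x \<notin> N \<Longrightarrow> P x"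
    using P by (auto elim!: AE_E3)
  then have "S \<subseteq> N" using \<open>\<not> (\<exists>x\<in>S. P x)\<close> by blast
  moreover have "negligible N"
    using N(1) by (simp add: negligible_iff_null_sets null_sets_completionI)
  ultimately have "negligible S" by (rule negligible_subset[rotated])
  then show False using open_not_negligible[OF S] by blast
qed

text \<open>
  As \<open>p\<close> ranges over pairs with \<open>y\<close> outside \<open>\<Omega>\<close>, a property that holds for almost every shift
  holds for a dense set of levels \<open>c = u y + \<sigma>\<close>; a single such \<open>y\<close> suffices, and there is
  one because the complement of a bounded set is not null.
\<close>

lemma AE_fiber_dense:
  fixes \<Omega> :: "'a::euclidean_space set"
  assumes \<Omega>: "bounded \<Omega>"
    and ae: "AE p in (lborel :: ('a \<times> 'a) measure). AE \<sigma> in lborel. p \<in> \<Omega> \<times> - \<Omega> \<longrightarrow> R (fst p) (u (snd p) + \<sigma>)"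
  shows "AE x in lborel. x \<in> \<Omega> \<longrightarrow> (\<forall>a b. a < b \<longrightarrow> (\<exists>c. a < c \<and> c < b \<and> R x (c::real)))"
proof -
  obtain B where B: "\<And>x. x \<in> \<Omega> \<Longrightarrow> norm x \<le> B" "B > 0"
    using \<Omega> by (auto simp: bounded_pos)
  have "AE p in (lborel :: 'a measure) \<Otimes>\<^sub>M (lborel :: 'a measure). AE \<sigma> in lborel. p \<in> \<Omega> \<times> - \<Omega> \<longrightarrow> R (fst p) (u (snd p) + \<sigma>)"
    using ae by (simp only: lborel_prod)
  then have "AE x in lborel. AE y in lborel. AE \<sigma> in lborel. (x, y) \<in> \<Omega> \<times> - \<Omega> \<longrightarrow> R (fst (x, y)) (u (snd (x, y)) + \<sigma>)"
    by (rule lborel_pair.AE_pair)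
  then show ?thesis
  proof eventually_elim
    case (elim x)
    show ?case
    proof (intro impI allI)
      fix a b :: real assume x: "x \<in> \<Omega>" and ab: "a < b"
      have "open {y :: 'a. B < norm y}" by (intro open_Collect_less continuous_intros)
      moreover obtain y0 :: 'a where "norm y0 = B + 1" using vector_choose_size[of "B + 1"] B(2) by auto
      then have "y0 \<in> {y :: 'a. B < norm y}" by simp
      then have "{y :: 'a. B < norm y} \<noteq> {}" by blast
      ultimately obtain y :: 'a where y: "B < norm y"
        "AE \<sigma> in lborel. (x, y) \<in> \<Omega> \<times> - \<Omega> \<longrightarrow> R (fst (x, y)) (u (snd (x, y)) + \<sigma>)"
        using AE_lborel_ex_open[OF elim, of "{y. B < norm y}"] by blast
      have "y \<notin> \<Omega>" using B(1)[of y] y(1) by auto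
      have "\<exists>\<sigma>\<in>{a - u y<..<b - u y}. (x, y) \<in> \<Omega> \<times> - \<Omega> \<longrightarrow> R (fst (x, y)) (u (snd (x, y)) + \<sigma>)"
        by (rule AE_lborel_ex_open[OF y(2)]) (use ab in auto)
      then obtain \<sigma> where \<sigma>: "\<sigma> \<in> {a - u y<..<b - u y}"
        "(x, y) \<in> \<Omega> \<times> - \<Omega> \<longrightarrow> R (fst (x, y)) (u (snd (x, y)) + \<sigma>)" by blast
      show "\<exists>c. a < c \<and> c < b \<and> R x c"
        using \<sigma> x \<open>y \<notin> \<Omega>\<close> by (intro exI[of _ "u y + \<sigma>"]) auto
    qed
  qed
qed

definition splice :: "'a set \<Rightarrow> 'a set \<Rightarrow> 'a set \<Rightarrow> 'a set" where
  "splice E U C = (E \<inter> C) \<union> (U - C)"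

text \<open>
  The only pairs, up to their order, for which an exchange of \<open>E\<close> and \<open>U\<close> inside \<open>C\<close> can raise the sum
  of the two perimeters, when \<open>E\<close> and \<open>U\<close> agree outside \<open>D\<close>.
\<close>

definition cross_pairs :: "'a set \<Rightarrow> 'a set \<Rightarrow> 'a set \<Rightarrow> 'a set \<Rightarrow> ('a \<times> 'a) set" where
  "cross_pairs E U D C = C \<times> ((D - C) \<inter> ((E - U) \<union> (U - E)))"

text \<open>
  For a pair inside \<open>C\<close>, and for a pair whose outer point is a point of agreement, the exchange only
  permutes the two integrands. For every other pair it raises their sum by at most 2, and each such
  pair occurs in both orders; hence the factor 4.
\<close>

lemma Per_splice_le:
  fixes E U C D :: "('a::euclidean_space \<times> real) set"
  assumes sets: "E \<in> sets borel" "U \<in> sets borel" "C \<in> sets borel" "D \<in> sets borel"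
    and EU: "E - D = U - D"
  shows "Per s (splice E U C) C + Per s (splice U E C) C
    \<le> Per s U C + Per s E C + 4 * (\<integral>\<^sup>+p. kernel_integral s p (sect (cross_pairs E U D C) p) \<partial>lborel)"
proof -
  let ?K = "\<lambda>Z :: ('a \<times> real) \<times> 'a \<times> real. pkern s (fst (fst Z), fst (snd Z)) (snd (fst Z) - snd (snd Z))"
  let ?S = "cross_pairs E U D C"
  have K: "?K \<in> borel_measurable borel"
    by (intro measurable_pkern borel_measurable_continuous_onI continuous_intros)
  have S: "?S \<in> sets borel" unfolding cross_pairs_def using sets by (auto intro!: borel_Times)
  have sp: "splice E U C \<in> sets borel" "splice U E C \<in> sets borel" using sets by (auto simp: splice_def)
  have dm: "(\<lambda>Z. indicator (disagree F \<inter> Qset C) Z * ?K Z) \<in> borel_measurable lborel" if "F \<in> sets borel" for F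
  proof -
    have "disagree F \<inter> Qset C \<in> sets borel" by (intro sets.Int sets_disagree sets_Qset that sets)
    then show ?thesis using K by simp
  qed
  have Sm: "(\<lambda>Z. indicator ?S Z * ?K Z) \<in> borel_measurable borel" using S K by simp
  have Sm': "(\<lambda>Z. indicator ?S (snd Z, fst Z) * ?K (snd Z, fst Z)) \<in> borel_measurable borel"
    by (rule measurable_compose[OF _ Sm]) (intro borel_measurable_continuous_onI continuous_intros)
  have Ksym: "?K (snd Z, fst Z) = ?K Z" for Z
  proof -
    have "snd (snd Z) - snd (fst Z) = - (snd (fst Z) - snd (snd Z))" by simp
    then show ?thesis unfolding pkern_def fst_conv snd_conv by (simp only: kern_uminus norm_minus_commute)
  qed
  have "Per s (splice E U C) C + Per s (splice U E C) C =
     (\<integral>\<^sup>+Z. indicator (disagree (splice E U C) \<inter> Qset C) Z * ?K Z + indicator (disagree (splice U E C) \<inter> Qset C) Z * ?K Z \<partial>lborel)"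
    unfolding Per_eq_indicator by (rule nn_integral_add[OF dm[OF sp(1)] dm[OF sp(2)], symmetric])
  also have "\<dots> \<le> (\<integral>\<^sup>+Z. (indicator (disagree U \<inter> Qset C) Z * ?K Z + indicator (disagree E \<inter> Qset C) Z * ?K Z) +
     2 * (indicator ?S Z * ?K Z + indicator ?S (snd Z, fst Z) * ?K (snd Z, fst Z)) \<partial>lborel)"
  proof (rule nn_integral_mono)
    fix Z :: "('a \<times> real) \<times> 'a \<times> real"
    have mem: "z \<in> splice E U C \<longleftrightarrow> (if z \<in> C then z \<in> E else z \<in> U)"
      "z \<in> splice U E C \<longleftrightarrow> (if z \<in> C then z \<in> U else z \<in> E)" for z
      by (auto simp: splice_def)
    have memS: "W \<in> ?S \<longleftrightarrow> fst W \<in> C \<and> snd W \<notin> C \<and> (snd W \<in> E) \<noteq> (snd W \<in> U)" for W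
      using EU by (cases W) (auto simp: cross_pairs_def)
    have memQ: "Z \<in> disagree F \<inter> Qset C \<longleftrightarrow> (fst Z \<in> F) \<noteq> (snd Z \<in> F) \<and> (fst Z \<in> C \<or> snd Z \<in> C)" for F
      by (auto simp: disagree_def Qset_def mem_Times_iff)
    have "(indicator (disagree (splice E U C) \<inter> Qset C) Z + indicator (disagree (splice U E C) \<inter> Qset C) Z :: ennreal)
      \<le> (indicator (disagree U \<inter> Qset C) Z + indicator (disagree E \<inter> Qset C) Z) + 2 * (indicator ?S Z + indicator ?S (snd Z, fst Z))"
      unfolding indicator_def memQ memS mem fst_conv snd_conv
      by (cases "fst Z \<in> C"; cases "snd Z \<in> C"; cases "fst Z \<in> E"; cases "snd Z \<in> E";
          cases "fst Z \<in> U"; cases "snd Z \<in> U"; simp)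
    then have "(indicator (disagree (splice E U C) \<inter> Qset C) Z + indicator (disagree (splice U E C) \<inter> Qset C) Z) * ?K Z
      \<le> ((indicator (disagree U \<inter> Qset C) Z + indicator (disagree E \<inter> Qset C) Z) + 2 * (indicator ?S Z + indicator ?S (snd Z, fst Z))) * ?K Z"
      by (rule mult_right_mono) simp
    then show "indicator (disagree (splice E U C) \<inter> Qset C) Z * ?K Z + indicator (disagree (splice U E C) \<inter> Qset C) Z * ?K Z
      \<le> (indicator (disagree U \<inter> Qset C) Z * ?K Z + indicator (disagree E \<inter> Qset C) Z * ?K Z) +
     2 * (indicator ?S Z * ?K Z + indicator ?S (snd Z, fst Z) * ?K (snd Z, fst Z))"
      unfolding Ksym by (simp only: distrib_right distrib_left mult.assoc)
  qed
  also have "\<dots> = (Per s U C + Per s E C) + 2 * ((\<integral>\<^sup>+Z. indicator ?S Z * ?K Z \<partial>lborel)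
      + (\<integral>\<^sup>+Z. indicator ?S (snd Z, fst Z) * ?K (snd Z, fst Z) \<partial>lborel))"
  proof -
    note a1 = borel_imp_lborel[OF Sm] and a2 = borel_imp_lborel[OF Sm']
    note a3 = borel_measurable_add[OF a1 a2]
    show ?thesis
      unfolding Per_eq_indicator nn_integral_add[OF borel_measurable_add[OF dm[OF sets(2)] dm[OF sets(1)]] borel_measurable_times_ennreal[OF borel_measurable_const a3]]
        nn_integral_add[OF dm[OF sets(2)] dm[OF sets(1)]] nn_integral_cmult[OF a3] nn_integral_add[OF a1 a2]
      by (rule refl)
  qed
  also have "(\<integral>\<^sup>+Z. indicator ?S (snd Z, fst Z) * ?K (snd Z, fst Z) \<partial>lborel) = (\<integral>\<^sup>+Z. indicator ?S Z * ?K Z \<partial>lborel)"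
    by (rule nn_integral_lborel_swap[OF Sm])
  also have "(\<integral>\<^sup>+Z. indicator ?S Z * ?K Z \<partial>lborel) = (\<integral>\<^sup>+p. kernel_integral s p (sect ?S p) \<partial>lborel)"
    by (rule nn_integral_slices[OF S])
  finally show ?thesis
    by (simp add: mult_2[symmetric] mult.assoc[symmetric])
qed

text \<open>
  One level above \<open>u x\<close> and one below, each with a finite part of the fiber on the wrong side, leave
  only the bounded interval between them.
\<close>

lemma near_halfline_fiber_finite:
  fixes E :: "('a::euclidean_space \<times> real) set"
  assumes E: "E \<in> sets borel"
    and c: "emeasure lborel (wrong_side u E \<eta> x c1) < \<infinity>" "u x + \<eta> < c1"
       "emeasure lborel (wrong_side u E \<eta> x c2) < \<infinity>" "c2 < u x - \<eta>" and \<eta>: "0 \<le> \<eta>"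
  shows "emeasure lborel {t. ((x, t) \<in> E) \<noteq> (t < u x)} < \<infinity>"
proof -
  have fm: "fiber E x \<in> sets borel" by (rule sets_fiber[OF E])
  have w1: "wrong_side u E \<eta> x c1 = {c1..} \<inter> fiber E x" using c \<eta> by (auto simp: wrong_side_def)
  have w2: "wrong_side u E \<eta> x c2 = {..<c2} - fiber E x" using c \<eta> by (auto simp: wrong_side_def)
  have m: "{c1..} \<inter> fiber E x \<in> sets lborel" "{..<c2} - fiber E x \<in> sets lborel" using fm by auto
  have "emeasure lborel {t. ((x, t) \<in> E) \<noteq> (t < u x)} \<le>
     emeasure lborel (({c1..} \<inter> fiber E x) \<union> (({..<c2} - fiber E x) \<union> {c2..c1}))"
  proof (rule emeasure_mono)
    have "c2 \<le> u x" "u x \<le> c1" using c \<eta> by linarith+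
    then show "{t. ((x, t) \<in> E) \<noteq> (t < u x)} \<subseteq> ({c1..} \<inter> fiber E x) \<union> (({..<c2} - fiber E x) \<union> {c2..c1})"
      by auto
  qed (use m in auto)
  also have "\<dots> \<le> emeasure lborel ({c1..} \<inter> fiber E x) + emeasure lborel (({..<c2} - fiber E x) \<union> {c2..c1})"
    using m by (intro emeasure_subadditive) auto
  also have "\<dots> \<le> emeasure lborel ({c1..} \<inter> fiber E x) + (emeasure lborel ({..<c2} - fiber E x) + emeasure lborel {c2..c1})"
    using m by (intro add_left_mono emeasure_subadditive) auto
  also have "\<dots> < \<infinity>"
    using c w1 w2 \<eta> by simp
  finally show ?thesis .
qed

text \<open>
  Levels with a null part on the wrong side approach \<open>u x\<close> from above and from below; the union of
  countably many of these parts exhausts the symmetric difference.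
\<close>

lemma fiber_null:
  fixes E :: "('a::euclidean_space \<times> real) set"
  assumes E: "E \<in> sets borel"
    and dense: "\<And>i a b. a < b \<Longrightarrow> \<exists>c. a < c \<and> c < b \<and> emeasure lborel (wrong_side u E (1 / real (Suc i)) x c) = 0"
  shows "emeasure lborel {t. ((x, t) \<in> E) \<noteq> (t < u x)} = 0"
proof -
  have fm: "fiber E x \<in> sets borel" by (rule sets_fiber[OF E])
  let ?e = "\<lambda>i. 1 / real (Suc i)"
  have e0: "0 < ?e i" for i by simp
  have l1: "u x + ?e i < u x + 2 * ?e i" and l2: "u x - 2 * ?e i < u x - ?e i" for i
    using e0[of i] by linarith+
  have "\<forall>i. \<exists>c. u x + ?e i < c \<and> c < u x + 2 * ?e i \<and> emeasure lborel (wrong_side u E (?e i) x c) = 0"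
    by (intro allI dense l1)
  from choice[OF this] obtain c where "\<forall>i. u x + ?e i < c i \<and> c i < u x + 2 * ?e i \<and> emeasure lborel (wrong_side u E (?e i) x (c i)) = 0"
    by (rule exE)
  then have c: "u x + ?e i < c i" "c i < u x + 2 * ?e i" "emeasure lborel (wrong_side u E (?e i) x (c i)) = 0" for i
    by blast+
  have "\<forall>i. \<exists>c. u x - 2 * ?e i < c \<and> c < u x - ?e i \<and> emeasure lborel (wrong_side u E (?e i) x c) = 0"
    by (intro allI dense l2)
  from choice[OF this] obtain d where "\<forall>i. u x - 2 * ?e i < d i \<and> d i < u x - ?e i \<and> emeasure lborel (wrong_side u E (?e i) x (d i)) = 0"
    by (rule exE)
  then have d: "u x - 2 * ?e i < d i" "d i < u x - ?e i" "emeasure lborel (wrong_side u E (?e i) x (d i)) = 0" for i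
    by blast+
  have w1: "wrong_side u E (?e i) x (c i) = {c i..} \<inter> fiber E x" for i
  proof -
    have "\<not> c i < u x - ?e i" using c(1)[of i] e0[of i] by linarith
    then show ?thesis using c(1)[of i] by (auto simp: wrong_side_def simp del: of_nat_Suc)
  qed
  have w2: "wrong_side u E (?e i) x (d i) = {..<d i} - fiber E x" for i
  proof -
    have "\<not> u x + ?e i < d i" using d(2)[of i] e0[of i] by linarith
    then show ?thesis using d(2)[of i] by (auto simp: wrong_side_def simp del: of_nat_Suc)
  qed
  have n1: "{c i..} \<inter> fiber E x \<in> null_sets lborel" "{..<d i} - fiber E x \<in> null_sets lborel" for i
    using c(3)[of i] d(3)[of i] fm unfolding w1 w2 by (auto simp: null_sets_def)
  have "{t. ((x, t) \<in> E) \<noteq> (t < u x)} \<subseteq> (\<Union>i. {c i..} \<inter> fiber E x) \<union> ((\<Union>i. {..<d i} - fiber E x) \<union> {u x})"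
  proof
    fix t assume t: "t \<in> {t. ((x, t) \<in> E) \<noteq> (t < u x)}"
    have conv: "\<exists>i. 2 * ?e i < \<delta>" if "0 < \<delta>" for \<delta> :: real
    proof -
      have "0 < \<delta> / 2" using that by simp
      from reals_Archimedean[OF this] obtain i where "inverse (real (Suc i)) < \<delta> / 2" by blast
      then have "2 * ?e i < \<delta>" unfolding inverse_eq_divide by linarith
      then show ?thesis by blast
    qed
    consider "u x < t" | "t < u x" | "t = u x" by linarith
    then show "t \<in> (\<Union>i. {c i..} \<inter> fiber E x) \<union> ((\<Union>i. {..<d i} - fiber E x) \<union> {u x})"
    proof cases
      case 1
      then have "0 < t - u x" by simp
      from conv[OF this] obtain i where "2 * ?e i < t - u x" by blast
      then have "c i \<le> t" using c(2)[of i] by linarith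
      then show ?thesis using t 1 by auto
    next
      case 2
      then have "0 < u x - t" by simp
      from conv[OF this] obtain i where "2 * ?e i < u x - t" by blast
      then have "t < d i" using d(1)[of i] by linarith
      then show ?thesis using t 2 by auto
    qed simp
  qed
  then have sub: "{t. ((x, t) \<in> E) \<noteq> (t < u x)} \<subseteq> (\<Union>i. {c i..} \<inter> fiber E x) \<union> ((\<Union>i. {..<d i} - fiber E x) \<union> {u x})" .
  have N1: "(\<Union>i. {c i..} \<inter> fiber E x) \<in> null_sets lborel" by (intro null_sets_UN n1)
  have N2: "(\<Union>i. {..<d i} - fiber E x) \<in> null_sets lborel" by (intro null_sets_UN n1)
  have N3: "{u x} \<in> null_sets lborel" by (simp add: null_sets_def)
  note N = null_sets.Un[OF N1 null_sets.Un[OF N2 N3]]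
  have "emeasure lborel {t. ((x, t) \<in> E) \<noteq> (t < u x)} \<le> 0"
    using emeasure_mono[OF sub null_setsD2[OF N]] unfolding null_setsD1[OF N] .
  then show ?thesis by simp
qed

text \<open>
  Two points at vertical distance \<open>\<bar>\<sigma>\<bar>\<close>, one inside the cylinder and one above or below it,
  have heights in an interval of length \<open>\<bar>\<sigma>\<bar>\<close> at one of the two ends.
\<close>

lemma sect_cross_pairs_le:
  fixes E U :: "('a::euclidean_space \<times> real) set"
  assumes M: "0 \<le> M"
  shows "sect (cross_pairs E U (\<Omega> \<times> UNIV) (cylinder \<Omega> M)) p \<sigma> \<le> indicator (\<Omega> \<times> \<Omega>) p * ennreal \<bar>\<sigma>\<bar>"
proof (cases "p \<in> \<Omega> \<times> \<Omega>")
  case True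
  let ?S = "cross_pairs E U (\<Omega> \<times> UNIV) (cylinder \<Omega> M)"
  have "sect ?S p \<sigma> \<le> (\<integral>\<^sup>+t. indicator (if 0 \<le> \<sigma> then {-M..\<sigma> - M} else {\<sigma> + M..M}) t \<partial>lborel)"
    unfolding sect_def
    by (intro nn_integral_mono) (auto simp: indicator_def cross_pairs_def cylinder_def split: if_splits)
  also have "\<dots> \<le> ennreal \<bar>\<sigma>\<bar>" by auto
  finally show ?thesis using True by simp
next
  case False
  then have "sect (cross_pairs E U (\<Omega> \<times> UNIV) (cylinder \<Omega> M)) p \<sigma> = 0"
    by (intro sect_empty) (auto simp: cross_pairs_def cylinder_def mem_Times_iff)
  then show ?thesis by simp
qed

text \<open>
  The outer point lies in the tail, beyond height \<open>j\<close>, of the symmetric difference of the fibers,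
  whose length is finite.
\<close>

lemma sect_cross_pairs_tendsto_0:
  fixes E U :: "('a::euclidean_space \<times> real) set"
  assumes E: "E \<in> sets borel" and U: "U \<in> sets borel"
    and fin: "snd p \<in> \<Omega> \<Longrightarrow> emeasure lborel {t. ((snd p, t) \<in> E) \<noteq> ((snd p, t) \<in> U)} < \<infinity>"
  shows "(\<lambda>j. sect (cross_pairs E U (\<Omega> \<times> UNIV) (cylinder \<Omega> (real j))) p \<sigma>) \<longlonglongrightarrow> 0"
proof (cases "snd p \<in> \<Omega>")
  case False
  then have "sect (cross_pairs E U (\<Omega> \<times> UNIV) (cylinder \<Omega> (real j))) p \<sigma> = 0" for j
    by (intro sect_empty) (auto simp: cross_pairs_def cylinder_def)
  then show ?thesis by simp
next
  case True
  let ?D = "{t. ((snd p, t) \<in> E) \<noteq> ((snd p, t) \<in> U)}"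
  have eq: "?D = (fiber E (snd p) - fiber U (snd p)) \<union> (fiber U (snd p) - fiber E (snd p))" by auto
  have D: "?D \<in> sets borel" unfolding eq by (intro sets.Un sets.Diff sets_fiber E U)
  define B where "B = (\<lambda>j::nat. ?D - {- real j<..<real j})"
  have Bm: "B j \<in> sets lborel" for j using D by (auto simp: B_def simp del: mem_Collect_eq)
  have fD: "emeasure lborel (B j) \<noteq> \<infinity>" for j
  proof -
    have "emeasure lborel (B j) \<le> emeasure lborel ?D" using D by (intro emeasure_mono) (auto simp: B_def)
    then show ?thesis using fin[OF True] by (metis infinity_ennreal_def leD)
  qed
  have dec: "decseq B" by (auto simp: decseq_def B_def)
  have "(\<Inter>j. B j) = {}"
  proof -
    have "t \<notin> (\<Inter>j. B j)" for t
    proof -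
      obtain j where "\<bar>t\<bar> < real j" using reals_Archimedean2 by blast
      then have "t \<notin> B j" by (auto simp: B_def abs_less_iff)
      then show ?thesis by blast
    qed
    then show ?thesis by blast
  qed
  moreover have "(\<lambda>j. emeasure lborel (B j)) \<longlonglongrightarrow> emeasure lborel (\<Inter>j. B j)"
    using Bm fD dec by (intro Lim_emeasure_decseq) auto
  ultimately have lim: "(\<lambda>j. emeasure lborel (B j)) \<longlonglongrightarrow> 0" by simp
  have le: "sect (cross_pairs E U (\<Omega> \<times> UNIV) (cylinder \<Omega> (real j))) p \<sigma> \<le> emeasure lborel (B j)" for j
  proof -
    have "sect (cross_pairs E U (\<Omega> \<times> UNIV) (cylinder \<Omega> (real j))) p \<sigma> \<le> (\<integral>\<^sup>+t. indicator (B j) (- \<sigma> + 1 * t) \<partial>lborel)"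
      unfolding sect_def using True
      by (intro nn_integral_mono) (auto simp: indicator_def cross_pairs_def cylinder_def B_def)
    also have "\<dots> = (\<integral>\<^sup>+t. indicator (B j) t \<partial>lborel)"
      using nn_integral_real_affine[of "indicator (B j)" 1 "- \<sigma>"] Bm[of j] by simp
    also have "\<dots> = emeasure lborel (B j)" by (rule nn_integral_indicator[OF Bm])
    finally show ?thesis .
  qed
  show ?thesis
  proof (rule tendsto_sandwich[OF _ _ tendsto_const lim])
    show "\<forall>\<^sub>F j in sequentially. sect (cross_pairs E U (\<Omega> \<times> UNIV) (cylinder \<Omega> (real j))) p \<sigma> \<le> emeasure lborel (B j)"
      by (intro always_eventually allI le)
  qed simp
qed

text \<open>
  The integrable majorant for the cross terms. It is the energy of the zero function.
\<close>

lemma nn_integral_pkern_abs_finite: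
  assumes \<Omega>: "open \<Omega>" "bounded (\<Omega> :: (real^'n) set)" and s: "0 < s" "s < 1"
  shows "(\<integral>\<^sup>+p. \<integral>\<^sup>+\<sigma>. pkern s p \<sigma> * (indicator (\<Omega> \<times> \<Omega>) p * ennreal \<bar>\<sigma>\<bar>) \<partial>lborel \<partial>lborel) < \<infinity>"
proof -
  have z: "(\<lambda>x. 0) \<in> borel_measurable (borel :: (real^'n) measure)" by simp
  have "(\<lambda>x. 0) \<in> Ws s \<Omega>" by (simp add: Ws_def)
  then have "(\<integral>\<^sup>+p. indicator (\<Omega> \<times> \<Omega>) p * ennreal (interaction s (\<lambda>x. 0) p) \<partial>lborel) < \<infinity>"
    using Ws_iff[OF z \<Omega> s] by blast
  moreover have "(\<integral>\<^sup>+p. \<integral>\<^sup>+\<sigma>. pkern s p \<sigma> * (indicator (\<Omega> \<times> \<Omega>) p * ennreal \<bar>\<sigma>\<bar>) \<partial>lborel \<partial>lborel)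
     = (\<integral>\<^sup>+p. indicator (\<Omega> \<times> \<Omega>) p * ennreal (interaction s (\<lambda>x. 0) p) \<partial>lborel)"
  proof (rule nn_integral_cong_AE, use AE_lborel_pair_neq in eventually_elim)
    case (elim p)
    have "(\<integral>\<^sup>+\<sigma>. pkern s p \<sigma> * ennreal \<bar>\<sigma>\<bar> \<partial>lborel) = ennreal (interaction s (\<lambda>x. 0) p)"
      using nn_integral_pkern_abs[OF s(1) elim, of "\<lambda>x. 0"] by simp
    then show ?case by (cases "p \<in> \<Omega> \<times> \<Omega>") simp_all
  qed
  ultimately show ?thesis by simp
qed

text \<open>
  Outside the cylinder the spliced set is the subgraph, which has nothing on the wrong side.
\<close>

lemma wrong_side_splice:
  assumes "x \<in> \<Omega>" "0 \<le> \<eta>"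
  shows "wrong_side u (splice E (subgraph u UNIV) (cylinder \<Omega> M)) \<eta> x c = wrong_side u E \<eta> x c \<inter> {-M<..<M}"
  using assms by (auto simp: wrong_side_def splice_def cylinder_def subgraph_def)

lemma gain_splice_mono:
  assumes E: "E \<in> sets borel" and u: "u \<in> borel_measurable borel" and \<eta>: "0 \<le> \<eta>" and \<Omega>: "open (\<Omega> :: 'a::euclidean_space set)" and jk: "j \<le> k"
  shows "gain \<Omega> u (splice E (subgraph u UNIV) (cylinder \<Omega> j)) \<eta> p \<sigma>
    \<le> gain \<Omega> u (splice E (subgraph u UNIV) (cylinder \<Omega> k)) \<eta> p \<sigma>"
proof (cases "fst p \<in> \<Omega> \<and> snd p \<notin> \<Omega>")
  case True
  have "emeasure lborel (wrong_side u E \<eta> (fst p) (u (snd p) + \<sigma>) \<inter> {-j<..<j})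
     \<le> emeasure lborel (wrong_side u E \<eta> (fst p) (u (snd p) + \<sigma>) \<inter> {-k<..<k})"
    using jk sets_wrong_side[OF E, of u \<eta>] by (intro emeasure_mono) auto
  then show ?thesis using True wrong_side_splice[OF _ \<eta>, of "fst p" \<Omega> u E] by (simp add: gain_def)
qed (auto simp: gain_def)

lemma SUP_gain_splice:
  assumes E: "E \<in> sets borel" and u: "u \<in> borel_measurable borel" and \<eta>: "0 \<le> \<eta>" and \<Omega>: "open (\<Omega> :: 'a::euclidean_space set)"
    and p: "p \<in> \<Omega> \<times> - \<Omega>"
  shows "(SUP j. gain \<Omega> u (splice E (subgraph u UNIV) (cylinder \<Omega> (real j))) \<eta> p \<sigma>)
    = emeasure lborel (wrong_side u E \<eta> (fst p) (u (snd p) + \<sigma>))"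
proof -
  let ?W = "wrong_side u E \<eta> (fst p) (u (snd p) + \<sigma>)"
  have W: "?W \<in> sets borel" by (rule sets_wrong_side[OF E])
  have "gain \<Omega> u (splice E (subgraph u UNIV) (cylinder \<Omega> (real j))) \<eta> p \<sigma> = emeasure lborel (?W \<inter> {- real j<..<real j})" for j
    using p wrong_side_splice[OF _ \<eta>, of "fst p" \<Omega> u E] by (auto simp: gain_def mem_Times_iff)
  then have "(SUP j. gain \<Omega> u (splice E (subgraph u UNIV) (cylinder \<Omega> (real j))) \<eta> p \<sigma>)
     = (SUP j. emeasure lborel (?W \<inter> {- real j<..<real j}))" by simp
  also have "\<dots> = emeasure lborel (\<Union>j. ?W \<inter> {- real j<..<real j})"
    using W by (intro SUP_emeasure_incseq) (auto simp: incseq_def)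
  also have "(\<Union>j. ?W \<inter> {- real j<..<real j}) = ?W"
  proof -
    have "t \<in> (\<Union>j. {- real j<..<real j})" for t
    proof -
      obtain j where "\<bar>t\<bar> < real j" using reals_Archimedean2 by blast
      then show ?thesis by (auto simp: abs_less_iff intro!: exI[of _ j])
    qed
    then show ?thesis by blast
  qed
  finally show ?thesis .
qed

section \<open>Modification on null sets and minimality of the subgraph\<close>

lemma ae_subset_trans_eq: "ae_eq E F \<Longrightarrow> ae_subset X E \<Longrightarrow> ae_subset X F"
  unfolding ae_eq_def ae_subset_def by (auto elim: eventually_elim2)

lemma ae_eq_sym: "ae_eq E F \<Longrightarrow> ae_eq F E"
  unfolding ae_eq_def by (auto elim: eventually_mono)

lemma ae_eq_trans: "ae_eq E F \<Longrightarrow> ae_eq F G \<Longrightarrow> ae_eq E G"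
  unfolding ae_eq_def by (auto elim: eventually_elim2)

lemma ae_eq_refl: "ae_eq E E"
  unfolding ae_eq_def by simp

lemma ae_eq_Diff: "ae_eq E F \<Longrightarrow> ae_eq (E - C) (F - C)"
  unfolding ae_eq_def by (auto elim: eventually_mono)

lemma Linf_norm_real:
  assumes "Linf A \<psi>"
  obtains K where "0 \<le> K" "\<And>M. K \<le> M \<longleftrightarrow> Linf_norm A \<psi> \<le> ereal M"
proof -
  have "Linf_norm A \<psi> < \<infinity>" "0 \<le> Linf_norm A \<psi>" using assms by (auto simp: Linf_def Linf_norm_def)
  then obtain K where "Linf_norm A \<psi> = ereal K" "0 \<le> K" by (cases "Linf_norm A \<psi>") auto
  then show thesis by (intro that[of K]) auto
qed

lemma lebesgue_ex_borel:
  assumes "(E :: 'a::euclidean_space set) \<in> sets lebesgue"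
  obtains E' where "E' \<in> sets borel" "ae_eq E E'"
proof
  have m: "main_part lborel E \<in> sets borel" using main_part_sets[OF assms] by simp
  then show "main_part lborel E \<in> sets borel" .
  show "ae_eq E (main_part lborel E)"
    unfolding ae_eq_def AE_completion_iff using AE_in_main_part[OF assms] by (auto elim: eventually_mono)
qed

lemma solves_geometric_cong:
  assumes E: "solves_geometric_obstacle_problem s \<Omega> A \<phi> \<psi> E" and F: "ae_eq E F" "F \<in> sets lebesgue"
  shows "solves_geometric_obstacle_problem s \<Omega> A \<phi> \<psi> F"
proof -
  have FE: "ae_eq F E" using F ae_eq_sym by blast
  have P: "Per s F C = Per s E C" for C by (rule Per_cong_AE[OF FE])
  have D: "ae_eq (F - C) (E - C)" for C by (rule ae_eq_Diff[OF FE])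
  show ?thesis
    unfolding solves_geometric_obstacle_problem_def P
  proof (intro conjI allI impI ballI)
    show "F \<in> sets lebesgue" by fact
    show "ae_eq (F - \<Omega> \<times> UNIV) (subgraph \<phi> UNIV - \<Omega> \<times> UNIV)"
      using ae_eq_trans[OF D] E by (auto simp: solves_geometric_obstacle_problem_def)
    show "ae_subset (subgraph \<psi> A) F"
      using ae_subset_trans_eq[OF F(1)] E by (auto simp: solves_geometric_obstacle_problem_def)
    fix M assume M: "Linf_norm A \<psi> \<le> ereal M"
    show "Per s E (cylinder \<Omega> M) < \<infinity>" using E M by (auto simp: solves_geometric_obstacle_problem_def)
    fix G assume G: "G \<in> sets lebesgue" "ae_eq (G - cylinder \<Omega> M) (F - cylinder \<Omega> M)" "ae_subset (subgraph \<psi> A) G"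
    have "ae_eq (G - cylinder \<Omega> M) (E - cylinder \<Omega> M)" by (rule ae_eq_trans[OF G(2) D])
    then show "Per s E (cylinder \<Omega> M) \<le> Per s G (cylinder \<Omega> M)"
      using E M G by (auto simp: solves_geometric_obstacle_problem_def)
  qed
qed

lemma Ws_obstacle_cong_AE:
  fixes u v :: "real^'n \<Rightarrow> real"
  assumes uv: "AE x in lebesgue. u x = v x" and v: "v \<in> borel_measurable lebesgue"
    and u: "u \<in> Ws_obstacle s \<Omega> A \<phi> \<psi>"
  shows "v \<in> Ws_obstacle s \<Omega> A \<phi> \<psi>"
proof -
  have 1: "(\<integral>\<^sup>+x\<in>\<Omega>. ennreal \<bar>v x\<bar> \<partial>lebesgue) = (\<integral>\<^sup>+x\<in>\<Omega>. ennreal \<bar>u x\<bar> \<partial>lebesgue)"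
    by (rule nn_integral_cong_AE, use uv in eventually_elim) simp
  have 2: "(\<integral>\<^sup>+z\<in>\<Omega> \<times> \<Omega>. ennreal (\<bar>v (fst z) - v (snd z)\<bar> / norm (fst z - snd z) powr (real CARD('n) + s)) \<partial>lebesgue)
    = (\<integral>\<^sup>+z\<in>\<Omega> \<times> \<Omega>. ennreal (\<bar>u (fst z) - u (snd z)\<bar> / norm (fst z - snd z) powr (real CARD('n) + s)) \<partial>lebesgue)"
    by (rule nn_integral_cong_AE, use AE_lebesgue_fst[OF uv] AE_lebesgue_snd[OF uv] in eventually_elim) simp
  have "v \<in> Ws s \<Omega>" using u v unfolding Ws_obstacle_def Ws_def mem_Collect_eq 1 2 by blast
  moreover have "AE x in lebesgue. x \<notin> \<Omega> \<longrightarrow> v x = \<phi> x"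
  proof -
    have "AE x in lebesgue. x \<notin> \<Omega> \<longrightarrow> u x = \<phi> x" using u by (simp add: Ws_obstacle_def)
    with uv show ?thesis by eventually_elim simp
  qed
  moreover have "AE x in lebesgue. x \<in> A \<longrightarrow> \<psi> x \<le> v x"
  proof -
    have "AE x in lebesgue. x \<in> A \<longrightarrow> \<psi> x \<le> u x" using u by (simp add: Ws_obstacle_def)
    with uv show ?thesis by eventually_elim simp
  qed
  ultimately show ?thesis by (simp add: Ws_obstacle_def)
qed

lemma solves_obstacle_cong_AE:
  fixes u v :: "real^'n \<Rightarrow> real"
  assumes uv: "AE x in lebesgue. u x = v x" and v: "v \<in> borel_measurable lebesgue"
    and sol: "solves_obstacle_problem s \<Omega> A \<phi> \<psi> u"
  shows "solves_obstacle_problem s \<Omega> A \<phi> \<psi> v"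
  unfolding solves_obstacle_problem_def
proof (intro conjI ballI)
  show "v \<in> Ws_obstacle s \<Omega> A \<phi> \<psi>"
    using Ws_obstacle_cong_AE[OF uv v] sol by (simp add: solves_obstacle_problem_def)
  fix w assume w: "w \<in> Ws_obstacle s \<Omega> A \<phi> \<psi>"
  have ae: "AE p in lebesgue. indicator (Qset \<Omega>) p *\<^sub>R energy_diff s v w p = indicator (Qset \<Omega>) p *\<^sub>R energy_diff s u w p"
    using AE_lebesgue_fst[OF uv] AE_lebesgue_snd[OF uv]
    by eventually_elim (simp add: energy_diff_def case_prod_beta)
  have i: "integrable lebesgue (\<lambda>p. indicator (Qset \<Omega>) p *\<^sub>R energy_diff s u w p)"
    and l: "(LINT p|lebesgue. indicator (Qset \<Omega>) p *\<^sub>R energy_diff s u w p) \<le> 0"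
    using sol w by (auto simp: solves_obstacle_problem_def set_integrable_def set_lebesgue_integral_def)
  have ae': "AE p in lebesgue. indicator (Qset \<Omega>) p *\<^sub>R energy_diff s u w p = indicator (Qset \<Omega>) p *\<^sub>R energy_diff s v w p"
    using ae by (rule eventually_mono) (rule sym)
  have m: "(\<lambda>p. indicator (Qset \<Omega>) p *\<^sub>R energy_diff s v w p) \<in> borel_measurable lebesgue"
    by (rule borel_measurable_AE[OF borel_measurable_integrable[OF i] ae'])
  show "set_integrable lebesgue (Qset \<Omega>) (energy_diff s v w)"
    unfolding set_integrable_def
    using integrable_cong_AE[OF borel_measurable_integrable[OF i] m ae'] i by blast
  show "(LINT z:Qset \<Omega>|lebesgue. energy_diff s v w z) \<le> 0"
    unfolding set_lebesgue_integral_def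
    using integral_cong_AE[OF borel_measurable_integrable[OF i] m ae'] l by simp
qed

lemma subgraph_solves_geometric:
  fixes u :: "real^'n \<Rightarrow> real"
  assumes s: "0 < s" "s < 1" and \<Omega>: "open \<Omega>" "bounded \<Omega>" and A: "A \<subseteq> \<Omega>"
    and u: "u \<in> borel_measurable borel" and sol: "solves_obstacle_problem s \<Omega> A \<phi> \<psi> u"
    and \<phi>: "Linf_loc \<phi>" and \<psi>: "Linf A \<psi>"
  shows "solves_geometric_obstacle_problem s \<Omega> A \<phi> \<psi> (subgraph u UNIV)"
proof -
  let ?U = "subgraph u UNIV"
  have uin: "u \<in> Ws_obstacle s \<Omega> A \<phi> \<psi>" using sol by (simp add: solves_obstacle_problem_def)
  have U: "?U \<in> sets borel" by (rule sets_subgraph[OF u])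
  have ae\<phi>: "AE x in lebesgue. x \<notin> \<Omega> \<longrightarrow> u x = \<phi> x" and ae\<psi>: "AE x in lebesgue. x \<in> A \<longrightarrow> \<psi> x \<le> u x"
    using uin by (auto simp: Ws_obstacle_def)
  obtain K where K: "0 \<le> K" "\<And>M. K \<le> M \<longleftrightarrow> Linf_norm A \<psi> \<le> ereal M" using Linf_norm_real[OF \<psi>] by metis
  show ?thesis
    unfolding solves_geometric_obstacle_problem_def
  proof (intro conjI allI impI ballI)
    show "?U \<in> sets lebesgue" using U by (simp add: sets_completionI_sets)
    show "ae_eq (?U - \<Omega> \<times> UNIV) (subgraph \<phi> UNIV - \<Omega> \<times> UNIV)"
      unfolding ae_eq_def using AE_lebesgue_fst[OF ae\<phi>] by eventually_elim (auto simp: subgraph_def)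
    show "ae_subset (subgraph \<psi> A) ?U"
      unfolding ae_subset_def using AE_lebesgue_fst[OF ae\<psi>] by eventually_elim (auto simp: subgraph_def)
    fix M assume "Linf_norm A \<psi> \<le> ereal M"
    then have M: "0 \<le> M" using K by (meson order_trans)
    show "Per s ?U (cylinder \<Omega> M) < \<infinity>"
      by (rule Per_subgraph_finite[OF s \<Omega> A u sol \<phi> M])
    fix F assume F: "F \<in> sets lebesgue" "ae_eq (F - cylinder \<Omega> M) (?U - cylinder \<Omega> M)" "ae_subset (subgraph \<psi> A) F"
    obtain F0 where F0: "F0 \<in> sets borel" "ae_eq F F0" using lebesgue_ex_borel[OF F(1)] by blast
    let ?F = "splice F0 ?U (cylinder \<Omega> M)"
    have Fm: "?F \<in> sets borel" using F0(1) U sets_cylinder[OF \<Omega>(1), of M] by (auto simp: splice_def)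
    have FF: "ae_eq F ?F"
      using F0(2) F(2) unfolding ae_eq_def by eventually_elim (auto simp: splice_def)
    have "Per s ?U (cylinder \<Omega> M) + (\<integral>\<^sup>+p. kernel_integral s p (gain \<Omega> u ?F 1 p) \<partial>lborel) \<le> Per s ?F (cylinder \<Omega> M)"
    proof (rule perimeter_gain[OF s \<Omega> A u sol Fm _ M ae_subset_trans_eq[OF FF F(3)]])
      show "?F - cylinder \<Omega> M = ?U - cylinder \<Omega> M" by (auto simp: splice_def)
    qed simp
    then have "Per s ?U (cylinder \<Omega> M) \<le> Per s ?F (cylinder \<Omega> M)"
      by (rule order_trans[rotated]) simp
    also have "\<dots> = Per s F (cylinder \<Omega> M)" by (rule Per_cong_AE[OF ae_eq_sym[OF FF]])
    finally show "Per s ?U (cylinder \<Omega> M) \<le> Per s F (cylinder \<Omega> M)" .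
  qed
qed

section \<open>Uniqueness\<close>

text \<open>
  The gain \<open>a j \<eta>\<close> of the set spliced at height \<open>j\<close> is at most four times the cross term \<open>err j\<close>
  once \<open>j\<close> exceeds the bound of the obstacle, and it increases with \<open>j\<close>. Boundedness of the cross terms gives fibers of finite discrepancy, and
  this lets the cross terms tend to 0, so that all gains vanish.
\<close>

lemma geometric_solution_unique:
  fixes u :: "real^'n \<Rightarrow> real"
  assumes s: "0 < s" "s < 1" and \<Omega>: "open \<Omega>" "bounded \<Omega>" and A: "A \<subseteq> \<Omega>"
    and u: "u \<in> borel_measurable borel" and sol: "solves_obstacle_problem s \<Omega> A \<phi> \<psi> u"
    and \<phi>: "Linf_loc \<phi>" and \<psi>: "Linf A \<psi>"
    and E: "E \<in> sets borel" and EU: "E - \<Omega> \<times> UNIV = subgraph u UNIV - \<Omega> \<times> UNIV"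
    and Esol: "solves_geometric_obstacle_problem s \<Omega> A \<phi> \<psi> E"
  shows "ae_eq E (subgraph u UNIV)"
proof -
  define U where "U = subgraph u UNIV"
  define C where "C = (\<lambda>j::nat. cylinder \<Omega> (real j))"
  define H where "H = (\<lambda>j. splice E U (C j))"
  define S where "S = (\<lambda>j. cross_pairs E U (\<Omega> \<times> UNIV) (C j))"
  define err where "err = (\<lambda>j. \<integral>\<^sup>+p. kernel_integral s p (sect (S j) p) \<partial>lborel)"
  define a where "a = (\<lambda>j \<eta>. \<integral>\<^sup>+p. kernel_integral s p (gain \<Omega> u (H j) \<eta> p) \<partial>lborel)"
  have U: "U \<in> sets borel" unfolding U_def by (rule sets_subgraph[OF u])
  have Om: "\<Omega> \<in> sets borel" using \<Omega> by simp
  have Cm: "C j \<in> sets borel" for j unfolding C_def by (rule sets_cylinder[OF \<Omega>(1)])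
  have OU: "\<Omega> \<times> UNIV \<in> sets (borel :: ((real^'n) \<times> real) measure)" using Om by (intro borel_Times) auto
  have Hm: "H j \<in> sets borel" for j using E U Cm[of j] by (auto simp: H_def splice_def)
  have Sm: "S j \<in> sets borel" for j
    unfolding S_def cross_pairs_def using E U Cm[of j] OU by (auto intro!: borel_Times)
  have Usol: "solves_geometric_obstacle_problem s \<Omega> A \<phi> \<psi> U"
    unfolding U_def by (rule subgraph_solves_geometric[OF s \<Omega> A u sol \<phi> \<psi>])
  obtain K where K: "0 \<le> K" "\<And>M. K \<le> M \<longleftrightarrow> Linf_norm A \<psi> \<le> ereal M" using Linf_norm_real[OF \<psi>] by metis
  have obE: "ae_subset (subgraph \<psi> A) E" and obU: "ae_subset (subgraph \<psi> A) U"
    using Esol Usol by (auto simp: solves_geometric_obstacle_problem_def)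
  have obs: "ae_subset (subgraph \<psi> A) (splice E U X)" "ae_subset (subgraph \<psi> A) (splice U E X)" for X
    using obE obU unfolding ae_subset_def by (eventually_elim; auto simp: splice_def)+

  \<comment> \<open>The spliced sets are competitors of one solution each; the finite perimeters cancel.\<close>
  have gain_le: "a j \<eta> \<le> 4 * err j" if j: "K \<le> real j" and \<eta>: "0 < \<eta>" for j \<eta>
  proof -
    have cmp: "Per s U (C j) + a j \<eta> \<le> Per s (H j) (C j)"
      unfolding U_def C_def a_def
    proof (rule perimeter_gain[OF s \<Omega> A u sol Hm _ _ _ \<eta>])
      show "H j - cylinder \<Omega> (real j) = subgraph u UNIV - cylinder \<Omega> (real j)"
        by (auto simp: H_def splice_def U_def C_def)
      show "ae_subset (subgraph \<psi> A) (H j)" unfolding H_def by (rule obs)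
    qed simp
    have EF: "Per s E (C j) < \<infinity>" "Per s U (C j) < \<infinity>"
      using Esol Usol j K(2)[of "real j"] unfolding solves_geometric_obstacle_problem_def C_def by blast+
    have min: "Per s E (C j) \<le> Per s (splice U E (C j)) (C j)"
    proof -
      have "splice U E (C j) \<in> sets lebesgue"
        using E U Cm[of j] by (auto simp: splice_def sets_completionI_sets)
      moreover have "splice U E (C j) - C j = E - C j" by (auto simp: splice_def)
      then have "ae_eq (splice U E (C j) - C j) (E - C j)" by (simp add: ae_eq_refl)
      ultimately show ?thesis
        using Esol j K(2)[of "real j"] obs(2)[of "C j"] unfolding solves_geometric_obstacle_problem_def C_def by blast
    qed
    have "(Per s U (C j) + Per s E (C j)) + a j \<eta> = (Per s U (C j) + a j \<eta>) + Per s E (C j)" by (simp only: ac_simps)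
    also have "\<dots> \<le> Per s (H j) (C j) + Per s (splice U E (C j)) (C j)"
      by (rule add_mono[OF cmp min])
    also have "\<dots> \<le> Per s U (C j) + Per s E (C j) + 4 * err j"
      unfolding H_def err_def S_def by (rule Per_splice_le[OF E U Cm OU EU[folded U_def]])
    finally show ?thesis
      using EF by (subst (asm) ennreal_add_left_cancel_le) auto
  qed

  have gm: "(\<lambda>w. gain \<Omega> u (H j) \<eta> (fst w) (snd w)) \<in> borel_measurable borel" for j \<eta>
    by (intro measurable_gain Hm u Om borel_measurable_continuous_onI continuous_intros)
  have gmono: "gain \<Omega> u (H j) \<eta> p \<sigma> \<le> gain \<Omega> u (H k) \<eta> p \<sigma>" if "j \<le> k" "0 \<le> \<eta>" for j k \<eta> p \<sigma>
    unfolding H_def U_def C_def using that by (intro gain_splice_mono[OF E u _ \<Omega>(1)]) auto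
  have amono: "a j \<eta> \<le> a k \<eta>" if "j \<le> k" "0 \<le> \<eta>" for j k \<eta>
    unfolding a_def using gmono[OF that] by (intro nn_integral_mono mult_left_mono) auto

  let ?D = "\<lambda>p \<sigma>. pkern s p \<sigma> * (indicator (\<Omega> \<times> \<Omega>) p * ennreal \<bar>\<sigma>\<bar>)"
  define e0 where "e0 = (\<integral>\<^sup>+p. \<integral>\<^sup>+\<sigma>. ?D p \<sigma> \<partial>lborel \<partial>lborel)"
  have e0: "e0 < \<infinity>" unfolding e0_def by (rule nn_integral_pkern_abs_finite[OF \<Omega> s])
  have sectD: "sect (S j) p \<sigma> \<le> indicator (\<Omega> \<times> \<Omega>) p * ennreal \<bar>\<sigma>\<bar>" for j p \<sigma>
    unfolding S_def C_def by (rule sect_cross_pairs_le) simp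
  have err_le: "err j \<le> e0" for j
    unfolding err_def e0_def by (intro nn_integral_mono mult_left_mono sectD) simp

  have a_bound: "a j 1 \<le> 4 * e0" for j
  proof -
    obtain k :: nat where k: "K \<le> real k" using real_arch_simple by blast
    have "a j 1 \<le> a (max j k) 1" by (rule amono) auto
    also have "\<dots> \<le> 4 * err (max j k)" using k by (intro gain_le) auto
    also have "\<dots> \<le> 4 * e0" by (intro mult_left_mono err_le) simp
    finally show ?thesis .
  qed
  have SUPg: "(SUP j. gain \<Omega> u (H j) \<eta> p \<sigma>) = emeasure lborel (wrong_side u E \<eta> (fst p) (u (snd p) + \<sigma>))"
    if "p \<in> \<Omega> \<times> - \<Omega>" "0 \<le> \<eta>" for p \<sigma> \<eta>
    unfolding H_def U_def C_def by (rule SUP_gain_splice[OF E u that(2) \<Omega>(1) that(1)])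
  have gmj: "(\<lambda>\<sigma>. gain \<Omega> u (H j) \<eta> p \<sigma>) \<in> borel_measurable borel" for j \<eta> p
    by (intro measurable_gain Hm u Om borel_measurable_continuous_onI continuous_intros)
  have pkm: "(\<lambda>\<sigma>. pkern s p \<sigma>) \<in> borel_measurable borel" for p :: "(real^'n) \<times> (real^'n)"
    by (intro measurable_pkern borel_measurable_continuous_onI continuous_intros)
  have pgm: "(\<lambda>\<sigma>. pkern s p \<sigma> * gain \<Omega> u (H j) \<eta> p \<sigma>) \<in> borel_measurable lborel" for j \<eta> p
    by (rule borel_imp_lborel[OF borel_measurable_times_ennreal[OF pkm gmj]])
  have ipgm: "(\<lambda>p. kernel_integral s p (gain \<Omega> u (H j) \<eta> p)) \<in> borel_measurable lborel" for j \<eta>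
    by (rule borel_imp_lborel[OF measurable_nn_integral_pkern[OF gm]])
  have pk_pos: "pkern s p \<sigma> \<noteq> 0" if "fst p \<noteq> snd p" for p :: "(real^'n) \<times> (real^'n)" and \<sigma>
    using kern_pos[of "norm (fst p - snd p)" "DIM(real^'n)" s \<sigma>] that by (simp add: pkern_def del: DIM_cart)

  \<comment> \<open>Monotone convergence in the height, with a bound that does not depend on the height.\<close>
  have fin_ae: "AE p in (lborel :: ((real^'n) \<times> (real^'n)) measure). AE \<sigma> in lborel. p \<in> \<Omega> \<times> - \<Omega> \<longrightarrow>
      emeasure lborel (wrong_side u E 1 (fst p) (u (snd p) + \<sigma>)) < \<infinity>"
  proof -
    have inc: "incseq (\<lambda>j \<sigma>. pkern s p \<sigma> * gain \<Omega> u (H j) 1 p \<sigma>)" for p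
      by (auto simp: incseq_def le_fun_def intro!: mult_left_mono gmono)
    have inc2: "incseq (\<lambda>j p. kernel_integral s p (gain \<Omega> u (H j) 1 p))"
      by (auto simp: incseq_def le_fun_def intro!: nn_integral_mono mult_left_mono gmono)
    have "(\<integral>\<^sup>+p. \<integral>\<^sup>+\<sigma>. (SUP j. pkern s p \<sigma> * gain \<Omega> u (H j) 1 p \<sigma>) \<partial>lborel \<partial>lborel)
       = (\<integral>\<^sup>+p. (SUP j. kernel_integral s p (gain \<Omega> u (H j) 1 p)) \<partial>lborel)"
      by (intro nn_integral_cong nn_integral_monotone_convergence_SUP inc pgm)
    also have "\<dots> = (SUP j. a j 1)"
      unfolding a_def by (intro nn_integral_monotone_convergence_SUP inc2 ipgm)
    also have "\<dots> \<le> 4 * e0" by (intro SUP_least a_bound)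
    also have "\<dots> < \<infinity>" using e0 by (simp add: ennreal_mult_less_top)
    finally have fin: "(\<integral>\<^sup>+p. \<integral>\<^sup>+\<sigma>. (SUP j. pkern s p \<sigma> * gain \<Omega> u (H j) 1 p \<sigma>) \<partial>lborel \<partial>lborel) < \<infinity>" .
    have im: "(\<lambda>p. \<integral>\<^sup>+\<sigma>. (SUP j. pkern s p \<sigma> * gain \<Omega> u (H j) 1 p \<sigma>) \<partial>lborel) \<in> borel_measurable lborel"
    proof -
      have "(\<lambda>p. \<integral>\<^sup>+\<sigma>. (SUP j. pkern s p \<sigma> * gain \<Omega> u (H j) 1 p \<sigma>) \<partial>lborel) =
         (\<lambda>p. SUP j. kernel_integral s p (gain \<Omega> u (H j) 1 p))"
        by (intro ext nn_integral_monotone_convergence_SUP inc pgm)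
      also have "\<dots> \<in> borel_measurable lborel" using ipgm by (intro borel_measurable_SUP) auto
      finally show ?thesis .
    qed
    have "AE p in lborel. (\<integral>\<^sup>+\<sigma>. (SUP j. pkern s p \<sigma> * gain \<Omega> u (H j) 1 p \<sigma>) \<partial>lborel) \<noteq> \<infinity>"
      by (rule nn_integral_PInf_AE[OF im]) (use fin in auto)
    with AE_lborel_pair_neq show ?thesis
    proof eventually_elim
      case (elim p)
      have sm: "(\<lambda>\<sigma>. SUP j. pkern s p \<sigma> * gain \<Omega> u (H j) 1 p \<sigma>) \<in> borel_measurable lborel"
        using pgm by (intro borel_measurable_SUP) auto
      have "AE \<sigma> in lborel. (SUP j. pkern s p \<sigma> * gain \<Omega> u (H j) 1 p \<sigma>) \<noteq> \<infinity>"
        by (rule nn_integral_PInf_AE[OF sm elim(2)])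
      then show ?case
      proof eventually_elim
        case (elim \<sigma>)
        show ?case
        proof
          assume p: "p \<in> \<Omega> \<times> - \<Omega>"
          have "(SUP j. pkern s p \<sigma> * gain \<Omega> u (H j) 1 p \<sigma>) = pkern s p \<sigma> * (SUP j. gain \<Omega> u (H j) 1 p \<sigma>)"
            by (rule SUP_mult_left_ennreal[symmetric])
          then have "pkern s p \<sigma> * emeasure lborel (wrong_side u E 1 (fst p) (u (snd p) + \<sigma>)) \<noteq> \<infinity>"
            using elim SUPg[OF p, of 1 \<sigma>] by simp
          then show "emeasure lborel (wrong_side u E 1 (fst p) (u (snd p) + \<sigma>)) < \<infinity>"
            using pk_pos[OF \<open>fst p \<noteq> snd p\<close>, of \<sigma>] by (auto simp: ennreal_mult_eq_top_iff less_top)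
        qed
      qed
    qed
  qed
  have fib_fin: "AE x in lborel. x \<in> \<Omega> \<longrightarrow> emeasure lborel {t. ((x, t) \<in> E) \<noteq> ((x, t) \<in> U)} < \<infinity>"
    using AE_fiber_dense[OF \<Omega>(2), of "\<lambda>x c. emeasure lborel (wrong_side u E 1 x c) < \<infinity>" u, OF fin_ae]
  proof eventually_elim
    case (elim x)
    show ?case
    proof
      assume x: "x \<in> \<Omega>"
      have "u x + 1 < u x + 2" "u x - 2 < u x - 1" by simp_all
      then obtain c1 c2 where c: "u x + 1 < c1" "emeasure lborel (wrong_side u E 1 x c1) < \<infinity>"
        "c2 < u x - 1" "emeasure lborel (wrong_side u E 1 x c2) < \<infinity>"
        using elim x by blast
      show "emeasure lborel {t. ((x, t) \<in> E) \<noteq> ((x, t) \<in> U)} < \<infinity>"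
        using near_halfline_fiber_finite[OF E c(2) c(1) c(4) c(3)] by (simp add: U_def subgraph_def)
    qed
  qed

  \<comment> \<open>Dominated convergence on triples of two base points and a shift.\<close>
  have err0: "err \<longlonglongrightarrow> 0"
  proof -
    let ?f = "\<lambda>j (w :: ((real^'n) \<times> (real^'n)) \<times> real). pkern s (fst w) (snd w) * sect (S j) (fst w) (snd w)"
    let ?g = "\<lambda>w. ?D (fst w) (snd w)"
    have c: "(\<lambda>w :: ((real^'n) \<times> (real^'n)) \<times> real. fst w) \<in> borel_measurable borel"
      "(\<lambda>w :: ((real^'n) \<times> (real^'n)) \<times> real. snd w) \<in> borel_measurable borel"
      "(\<lambda>w :: ((real^'n) \<times> (real^'n)) \<times> real. \<bar>snd w\<bar>) \<in> borel_measurable borel"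
      by (intro borel_measurable_continuous_onI continuous_intros)+
    have OO: "indicator (\<Omega> \<times> \<Omega>) \<in> borel_measurable (borel :: ((real^'n) \<times> (real^'n)) measure)"
      using \<Omega> by (intro borel_measurable_indicator borel_open open_Times)
    have fm: "?f j \<in> borel_measurable borel" for j
      by (intro borel_measurable_times_ennreal measurable_pkern measurable_sect Sm c)
    have gm': "?g \<in> borel_measurable borel"
      by (intro borel_measurable_times_ennreal measurable_pkern measurable_compose[OF c(1) OO]
          measurable_compose[OF c(3) measurable_ennreal] c(1,2))
    have err_eq: "err = (\<lambda>j. \<integral>\<^sup>+w. ?f j w \<partial>lborel)"
      unfolding err_def by (intro ext) (simp add: nn_integral_lborel_pair[OF fm])
    have "(\<integral>\<^sup>+w. ?g w \<partial>lborel) = e0" unfolding e0_def by (simp add: nn_integral_lborel_pair[OF gm'])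
    then have gfin: "(\<integral>\<^sup>+w. ?g w \<partial>lborel) < \<infinity>" using e0 by simp
    have "AE x in lebesgue. x \<in> \<Omega> \<longrightarrow> emeasure lborel {t. ((x, t) \<in> E) \<noteq> ((x, t) \<in> U)} < \<infinity>"
      using fib_fin by (rule AE_completion)
    from AE_lebesgue_fst[OF AE_lebesgue_snd[OF this]]
    have "AE w in (lborel :: (((real^'n) \<times> (real^'n)) \<times> real) measure). snd (fst w) \<in> \<Omega> \<longrightarrow>
        emeasure lborel {t. ((snd (fst w), t) \<in> E) \<noteq> ((snd (fst w), t) \<in> U)} < \<infinity>"
      by (simp add: AE_completion_iff)
    then have lim: "AE w in lborel. (\<lambda>j. ?f j w) \<longlonglongrightarrow> 0"
    proof eventually_elim
      case (elim w)
      have "(\<lambda>j. sect (S j) (fst w) (snd w)) \<longlonglongrightarrow> 0"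
        unfolding S_def C_def using elim by (intro sect_cross_pairs_tendsto_0[OF E U]) blast
      then have "(\<lambda>j. ?f j w) \<longlonglongrightarrow> pkern s (fst w) (snd w) * 0"
        by (intro ennreal_tendsto_cmult) (simp_all add: pkern_def)
      then show ?case by simp
    qed
    have "(\<lambda>j. \<integral>\<^sup>+w. ?f j w \<partial>lborel) \<longlonglongrightarrow> (\<integral>\<^sup>+w. 0 \<partial>(lborel :: (((real^'n) \<times> (real^'n)) \<times> real) measure))"
    proof (rule nn_integral_dominated_convergence[where w = ?g])
      show "AE w in lborel. ?f j w \<le> ?g w" for j
        by (intro AE_I2 mult_left_mono sectD) simp
    qed (use lim gfin borel_imp_lborel[OF fm] borel_imp_lborel[OF gm'] in simp_all)
    then show ?thesis unfolding err_eq by simp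
  qed
  \<comment> \<open>The gain is increasing in the height but bounded by cross terms that tend to 0.\<close>
  have a0: "a j \<eta> = 0" if "0 < \<eta>" for j \<eta>
  proof -
    obtain k :: nat where k: "K \<le> real k" using real_arch_simple by blast
    have le: "a j \<eta> \<le> 4 * err i" if i: "max j k \<le> i" for i
    proof -
      have "a j \<eta> \<le> a i \<eta>" using i \<open>0 < \<eta>\<close> by (intro amono) auto
      also have "\<dots> \<le> 4 * err i" using i k \<open>0 < \<eta>\<close> by (intro gain_le) auto
      finally show ?thesis .
    qed
    have "(\<lambda>i. 4 * err i) \<longlonglongrightarrow> 4 * 0" by (intro ennreal_tendsto_cmult err0) simp
    then have "a j \<eta> \<le> 4 * 0"
      by (rule LIMSEQ_le_const) (use le in blast)
    then show ?thesis by simp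
  qed
  have null_ae: "AE p in (lborel :: ((real^'n) \<times> (real^'n)) measure). AE \<sigma> in lborel. p \<in> \<Omega> \<times> - \<Omega> \<longrightarrow>
      (\<forall>i. emeasure lborel (wrong_side u E (1 / real (Suc i)) (fst p) (u (snd p) + \<sigma>)) = 0)"
  proof -
    have "AE p in lborel. \<forall>j i. kernel_integral s p (gain \<Omega> u (H j) (1 / real (Suc i)) p) = 0"
      unfolding AE_all_countable
    proof (intro allI)
      fix j i
      have "a j (1 / real (Suc i)) = 0" by (rule a0) simp
      then show "AE p in lborel. kernel_integral s p (gain \<Omega> u (H j) (1 / real (Suc i)) p) = 0"
        unfolding a_def by (subst (asm) nn_integral_0_iff_AE[OF ipgm])
    qed
    with AE_lborel_pair_neq show ?thesis
    proof eventually_elim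
      case (elim p)
      have "AE \<sigma> in lborel. \<forall>j i. pkern s p \<sigma> * gain \<Omega> u (H j) (1 / real (Suc i)) p \<sigma> = 0"
        unfolding AE_all_countable
      proof (intro allI)
        fix j i
        show "AE \<sigma> in lborel. pkern s p \<sigma> * gain \<Omega> u (H j) (1 / real (Suc i)) p \<sigma> = 0"
          using elim(2) nn_integral_0_iff_AE[OF pgm] by blast
      qed
      then show ?case
      proof eventually_elim
        case (elim \<sigma>)
        show ?case
        proof (intro impI allI)
          fix i assume p: "p \<in> \<Omega> \<times> - \<Omega>"
          have "gain \<Omega> u (H j) (1 / real (Suc i)) p \<sigma> = 0" for j
            using elim pk_pos[OF \<open>fst p \<noteq> snd p\<close>, of \<sigma>] by (metis mult_eq_0_iff)
          then have "(SUP j. gain \<Omega> u (H j) (1 / real (Suc i)) p \<sigma>) = 0" by simp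
          then show "emeasure lborel (wrong_side u E (1 / real (Suc i)) (fst p) (u (snd p) + \<sigma>)) = 0"
            using SUPg[OF p, of "1 / real (Suc i)" \<sigma>] by simp
        qed
      qed
    qed
  qed
  have fib_null: "AE x in lborel. emeasure lborel {t. ((x, t) \<in> E) \<noteq> ((x, t) \<in> U)} = 0"
    using AE_fiber_dense[OF \<Omega>(2), of "\<lambda>x c. \<forall>i. emeasure lborel (wrong_side u E (1 / real (Suc i)) x c) = 0" u, OF null_ae]
  proof eventually_elim
    case (elim x)
    show ?case
    proof (cases "x \<in> \<Omega>")
      case True
      have "emeasure lborel {t. ((x, t) \<in> E) \<noteq> (t < u x)} = 0"
        by (rule fiber_null[OF E]) (use elim True in blast)
      then show ?thesis by (simp add: U_def subgraph_def)
    next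
      case False
      then have "(x, t) \<in> E \<longleftrightarrow> (x, t) \<in> U" for t using EU by (auto simp: U_def)
      then show ?thesis by simp
    qed
  qed
  let ?N = "(E - U) \<union> (U - E)"
  have N: "?N \<in> sets borel" using E U by auto
  have "emeasure lborel ?N = (\<integral>\<^sup>+z. indicator ?N z \<partial>lborel)" using N by simp
  also have "\<dots> = (\<integral>\<^sup>+x. \<integral>\<^sup>+t. indicator ?N (x, t) \<partial>lborel \<partial>lborel)"
    using N by (intro nn_integral_lborel_pair) simp
  also have "\<dots> = (\<integral>\<^sup>+x. 0 \<partial>(lborel :: (real^'n) measure))"
  proof (rule nn_integral_cong_AE, use fib_null in eventually_elim)
    case (elim x)
    have m: "{t. ((x, t) \<in> E) \<noteq> ((x, t) \<in> U)} \<in> sets lborel"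
    proof -
      have "{t. ((x, t) \<in> E) \<noteq> ((x, t) \<in> U)} = (fiber E x - fiber U x) \<union> (fiber U x - fiber E x)" by auto
      then show ?thesis using sets_fiber[OF E, of x] sets_fiber[OF U, of x] by (simp del: mem_Collect_eq)
    qed
    have "(\<integral>\<^sup>+t. indicator ?N (x, t) \<partial>lborel) = (\<integral>\<^sup>+t. indicator {t. ((x, t) \<in> E) \<noteq> ((x, t) \<in> U)} t \<partial>lborel)"
      by (intro nn_integral_cong) (auto simp: indicator_def)
    also have "\<dots> = 0" using elim by (simp only: nn_integral_indicator[OF m])
    finally show ?case .
  qed
  finally have "?N \<in> null_sets lborel" using N by (simp add: null_sets_def)
  then have "AE z in lebesgue. z \<notin> ?N" by (intro AE_completion AE_not_in)
  then show ?thesis unfolding ae_eq_def U_def[symmetric] by (auto elim: eventually_mono)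
qed

theorem proposition3p4:
  fixes s :: real
    and \<Omega> A :: "(real^'n) set"
    and \<phi> \<psi> u :: "real^'n \<Rightarrow> real"
  assumes "0 < s" and "s < 1"
    and "open \<Omega>" and "bounded \<Omega>" and "C2_boundary \<Omega>"
    and "open A" and "A \<subseteq> \<Omega>"
    and "A = \<Omega> \<or> (compactly_contained A \<Omega> \<and> C2_boundary A)"
    and "Linf A \<psi>" and "Linf_loc \<phi>"
    and "solves_obstacle_problem s \<Omega> A \<phi> \<psi> u"
  shows "solves_geometric_obstacle_problem s \<Omega> A \<phi> \<psi> (subgraph u UNIV) \<and>
    (\<forall>E. solves_geometric_obstacle_problem s \<Omega> A \<phi> \<psi> E \<longrightarrow> ae_eq E (subgraph u UNIV))"
proof -
  have "u \<in> borel_measurable lebesgue"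
    using assms(11) by (simp add: solves_obstacle_problem_def Ws_obstacle_def Ws_def)
  then obtain v where v: "v \<in> borel_measurable lborel" "AE x in lborel. u x = v x"
    using completion_ex_borel_measurable_real[of u lborel] by auto
  have vb: "v \<in> borel_measurable borel" using v(1) by simp
  have uv: "AE x in lebesgue. u x = v x" using v(2) by (rule AE_completion)
  have vsol: "solves_obstacle_problem s \<Omega> A \<phi> \<psi> v"
    by (rule solves_obstacle_cong_AE[OF uv borel_imp_lebesgue[OF vb] assms(11)])
  let ?U = "subgraph u UNIV" and ?V = "subgraph v UNIV"
  have VU: "ae_eq ?V ?U"
    unfolding ae_eq_def using AE_lebesgue_fst[OF uv] by eventually_elim (auto simp: subgraph_def)
  have Vm: "?V \<in> sets borel" by (rule sets_subgraph[OF vb])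
  have Vgeo: "solves_geometric_obstacle_problem s \<Omega> A \<phi> \<psi> ?V"
    by (rule subgraph_solves_geometric[OF assms(1-4,7) vb vsol assms(10,9)])
  have Um: "?U \<in> sets lebesgue"
  proof (rule completion.in_sets_AE)
    show "AE z in lebesgue. z \<in> ?V \<longleftrightarrow> z \<in> ?U" using VU by (simp add: ae_eq_def)
    show "?V \<in> sets lebesgue" using Vm by (simp add: sets_completionI_sets)
  qed simp
  show ?thesis
  proof (intro conjI allI impI)
    show "solves_geometric_obstacle_problem s \<Omega> A \<phi> \<psi> ?U"
      by (rule solves_geometric_cong[OF Vgeo VU Um])
    fix E assume E: "solves_geometric_obstacle_problem s \<Omega> A \<phi> \<psi> E"
    then have "E \<in> sets lebesgue" by (simp add: solves_geometric_obstacle_problem_def)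
    then obtain E0 where E0: "E0 \<in> sets borel" "ae_eq E E0" by (rule lebesgue_ex_borel)
    let ?F = "splice E0 ?V (\<Omega> \<times> UNIV)"
    have "\<Omega> \<times> UNIV \<in> sets (borel :: ((real^'n) \<times> real) measure)"
      using assms(3) by (intro borel_Times) auto
    then have Fm: "?F \<in> sets borel" using E0 Vm by (auto simp: splice_def)
    have "ae_eq (E - \<Omega> \<times> UNIV) (subgraph \<phi> UNIV - \<Omega> \<times> UNIV)" "ae_eq (?V - \<Omega> \<times> UNIV) (subgraph \<phi> UNIV - \<Omega> \<times> UNIV)"
      using E Vgeo by (simp_all add: solves_geometric_obstacle_problem_def)
    then have "ae_eq (E - \<Omega> \<times> UNIV) (?V - \<Omega> \<times> UNIV)" by (rule ae_eq_trans[OF _ ae_eq_sym])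
    then have EF: "ae_eq E ?F"
      using E0(2) unfolding ae_eq_def by eventually_elim (auto simp: splice_def)
    have "solves_geometric_obstacle_problem s \<Omega> A \<phi> \<psi> ?F"
      by (rule solves_geometric_cong[OF E EF]) (simp add: Fm sets_completionI_sets)
    moreover have "?F - \<Omega> \<times> UNIV = ?V - \<Omega> \<times> UNIV" by (auto simp: splice_def)
    ultimately have "ae_eq ?F ?V"
      by (intro geometric_solution_unique[OF assms(1-4,7) vb vsol assms(10,9) Fm])
    then show "ae_eq E ?U" by (rule ae_eq_trans[OF ae_eq_trans[OF EF] VU])
  qed
qed

end
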